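(* Let $M$ be an odd-dimensional smooth manifold with an almost paracontact structure $(\varphi,\xi,\eta)$, and let $\Phi=\begin{pmatrix}\varphi & 0\\ 0 & -\varphi^*\end{pmatrix}$. The induced generalized almost paracontact structure $(\Phi,\xi,\eta)$ is normal if and only if the almost paracontact structure $(\varphi,\xi,\eta)$ is normal.
   Context: An almost paracontact structure $(\varphi,\xi,\eta)$ on an odd-dimensional manifold $M$ consists of a $(1,1)$-tensor field $\varphi$, a vector field $\xi$ and a $1$-form $\eta$ such that $\varphi^2=I-\eta\otimes\xi$ (i.e. $\varphi^2X=X-\eta(X)\xi$) and $\eta(\xi)=1$. The paper takes these conditions to include $\varphi\xi=0$ and $\eta\circ\varphi=0$. The dual of $\varphi$ is $(\varphi^*\alpha)(X)=\alpha(\varphi X)$; block matrices act on sections $X+\alpha$ of $TM\oplus T^*M$ as on columns $(X,\alpha)^T$. Normality of $(\varphi,\xi,\eta)$: for all $X,Y\in\Gamma(TM)$, $N_\varphi(X,Y)-d\eta(X,Y)\,\xi=0$, where $N_\varphi(X,Y)=[\varphi X,\varphi Y]+\varphi^2[X,Y]-\varphi[\varphi X,Y]-\varphi[X,\varphi Y]$ and $d\eta(X,Y)=X(\eta(Y))-Y(\eta(X))-\eta([X,Y])$. Normality of the induced generalized almost paracontact structure $(\Phi,\xi,\eta)$: let $t$ be the coordinate on $\mathbb{R}$, regard $\varphi,\xi,\eta$ as $t$-independent objects on $M\times\mathbb{R}$ (with $\varphi\frac{\partial}{\partial t}=0$, $\eta(\frac{\partial}{\partial t})=0$, $\varphi^*dt=0$).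 The $M$-adapted generalized almost product structure on $M\times\mathbb{R}$ is the endomorphism $P=\begin{pmatrix}\varphi & \beta\\ B & -\varphi^*\end{pmatrix}$ of $T(M\times\mathbb{R})\oplus T^*(M\times\mathbb{R})$ with $\beta=\xi\wedge\frac{\partial}{\partial t}$ and $B=\eta\wedge dt$, acting by $B(X)=\eta(X)\,dt-dt(X)\,\eta$ and $\beta(\alpha)=\alpha(\frac{\partial}{\partial t})\,\xi-\alpha(\xi)\,\frac{\partial}{\partial t}$, so that $\varphi^2=I-\beta B$ and $P^2=I$. The structure $(\Phi,\xi,\eta)$ is called normal if $P$ is integrable, i.e. if its Courant–Nijenhuis tensor $$\mathcal{N}_P(X+\alpha,Y+\gamma)=[P(X+\alpha),P(Y+\gamma)]+P^2[X+\alpha,Y+\gamma]-P[P(X+\alpha),Y+\gamma]-P[X+\alpha,P(Y+\gamma)]$$ vanishes for all sections $X+\alpha,Y+\gamma$ of $T(M\times\mathbb{R})\oplus T^*(M\times\mathbb{R})$, where the Courant bracket is $$[X+\alpha,Y+\gamma]=[X,Y]+L_X\gamma-L_Y\alpha+\tfrac12 d(\alpha(Y)-\gamma(X)).$$ *)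

theory Defs
  imports "HOL-Analysis.Analysis" "HOL-Library.Function_Algebras"
begin

section \<open>Smooth manifolds\<close>

(* Meant for open S; the domain will always be finite-dimensional, where C^k is equivalent to the
   existence and continuity of iterated directional derivatives of differentiable functions. *)
primrec Ck_on :: "nat \<Rightarrow> 'a::real_normed_vector set \<Rightarrow> ('a \<Rightarrow> 'b::real_normed_vector) \<Rightarrow> bool" where
  "Ck_on 0 S f \<longleftrightarrow> continuous_on S f"
| "Ck_on (Suc k) S f \<longleftrightarrow>
     (\<forall>x\<in>S. f differentiable (at x)) \<and> (\<forall>v. Ck_on k S (\<lambda>x. frechet_derivative f (at x) v))"

definition smooth_on :: "'a::real_normed_vector set \<Rightarrow> ('a \<Rightarrow> 'b::real_normed_vector) \<Rightarrow> bool" where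
  "smooth_on S f \<longleftrightarrow> (\<forall>k. Ck_on k S f)"

(* A chart is a domain together with a coordinate map; the values of the coordinate map outside
   the domain are irrelevant. *)
type_synonym ('m, 'e) chart = "'m set \<times> ('m \<Rightarrow> 'e)"

definition is_chart :: "('m::topological_space, 'e::euclidean_space) chart \<Rightarrow> bool" where
  "is_chart = (\<lambda>(U, \<kappa>). open U \<and> open (\<kappa> ` U) \<and> (\<exists>g. homeomorphism U (\<kappa> ` U) \<kappa> g))"

(* The manifold is the whole (Hausdorff, second countable) type 'm; its dimension is DIM('e).
   The atlas need not be maximal. *)
definition smooth_atlas ::
    "('m::{t2_space, second_countable_topology}, 'e::euclidean_space) chart set \<Rightarrow> bool" where
  "smooth_atlas A \<longleftrightarrow>
     (\<Union>(U, \<kappa>)\<in>A. U) = UNIV \<and>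
     (\<forall>c\<in>A. is_chart c) \<and>
     (\<forall>(U, \<kappa>)\<in>A. \<forall>(V, \<psi>)\<in>A. smooth_on (\<kappa> ` (U \<inter> V)) (\<psi> \<circ> inv_into U \<kappa>))"

definition smooth_funs :: "('m, 'e::euclidean_space) chart set \<Rightarrow> ('m \<Rightarrow> real) set" where
  "smooth_funs A = {f. \<forall>(U, \<kappa>)\<in>A. smooth_on (\<kappa> ` U) (f \<circ> inv_into U \<kappa>)}"


section \<open>Vector fields, one-forms and (1,1)-tensor fields\<close>

text \<open>
  Tangent vectors at a point are the derivations at that point of the algebra of smooth functions.
  They are extended by 0 to functions that are not smooth, so that equality of tangent vectors is
  equality of functions. All linear operations are pointwise.
\<close>

type_synonym 'm tangent = "('m \<Rightarrow> real) \<Rightarrow> real"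
type_synonym 'm cotangent = "'m tangent \<Rightarrow> real"

definition tangent_space :: "('m, 'e::euclidean_space) chart set \<Rightarrow> 'm \<Rightarrow> 'm tangent set" where
  "tangent_space A p = {v.
     (\<forall>f\<in>smooth_funs A. \<forall>g\<in>smooth_funs A. v (f + g) = v f + v g) \<and>
     (\<forall>c. \<forall>f\<in>smooth_funs A. v (\<lambda>q. c * f q) = c * v f) \<and>
     (\<forall>f\<in>smooth_funs A. \<forall>g\<in>smooth_funs A. v (f * g) = f p * v g + g p * v f) \<and>
     (\<forall>f. f \<notin> smooth_funs A \<longrightarrow> v f = 0)}"

definition vector_fields :: "('m, 'e::euclidean_space) chart set \<Rightarrow> ('m \<Rightarrow> 'm tangent) set" where
  "vector_fields A =
     {X. (\<forall>p. X p \<in> tangent_space A p) \<and> (\<forall>f\<in>smooth_funs A. (\<lambda>p. X p f) \<in> smooth_funs A)}"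

(* Only the values of a form on tangent_space A p matter; no convention is imposed elsewhere.
   The same applies to endo_fields. Smoothness is tested on smooth vector fields. *)
definition one_forms :: "('m, 'e::euclidean_space) chart set \<Rightarrow> ('m \<Rightarrow> 'm cotangent) set" where
  "one_forms A = {\<alpha>.
     (\<forall>p. \<forall>v\<in>tangent_space A p. \<forall>w\<in>tangent_space A p. \<alpha> p (v + w) = \<alpha> p v + \<alpha> p w) \<and>
     (\<forall>p. \<forall>c. \<forall>v\<in>tangent_space A p. \<alpha> p (\<lambda>f. c * v f) = c * \<alpha> p v) \<and>
     (\<forall>X\<in>vector_fields A. (\<lambda>p. \<alpha> p (X p)) \<in> smooth_funs A)}"

definition endo_fields ::
    "('m, 'e::euclidean_space) chart set \<Rightarrow> ('m \<Rightarrow> 'm tangent \<Rightarrow> 'm tangent) set" where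
  "endo_fields A = {\<phi>.
     (\<forall>p. \<forall>v\<in>tangent_space A p. \<phi> p v \<in> tangent_space A p) \<and>
     (\<forall>p. \<forall>v\<in>tangent_space A p. \<forall>w\<in>tangent_space A p. \<phi> p (v + w) = \<phi> p v + \<phi> p w) \<and>
     (\<forall>p. \<forall>c. \<forall>v\<in>tangent_space A p. \<phi> p (\<lambda>f. c * v f) = (\<lambda>f. c * \<phi> p v f)) \<and>
     (\<forall>X\<in>vector_fields A. (\<lambda>p. \<phi> p (X p)) \<in> vector_fields A)}"

definition lie_bracket :: "('m \<Rightarrow> 'm tangent) \<Rightarrow> ('m \<Rightarrow> 'm tangent) \<Rightarrow> ('m \<Rightarrow> 'm tangent)" where
  "lie_bracket X Y = (\<lambda>p f. X p (\<lambda>q. Y q f) - Y p (\<lambda>q. X q f))"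

definition d_fun :: "('m \<Rightarrow> real) \<Rightarrow> ('m \<Rightarrow> 'm cotangent)" where
  "d_fun f = (\<lambda>p v. v f)"

definition d_form ::
    "('m \<Rightarrow> 'm cotangent) \<Rightarrow> ('m \<Rightarrow> 'm tangent) \<Rightarrow> ('m \<Rightarrow> 'm tangent) \<Rightarrow> ('m \<Rightarrow> real)" where
  "d_form \<alpha> X Y = (\<lambda>p. X p (\<lambda>q. \<alpha> q (Y q)) - Y p (\<lambda>q. \<alpha> q (X q)) - \<alpha> p (lie_bracket X Y p))"

(* The Lie derivative is the form with (L_X \<gamma>)(Z) = X(\<gamma>(Z)) - \<gamma>([X,Z]) for all vector fields Z;
   its value on a tangent vector v at p is read off from any vector field Z with Z p = v. *)
definition lie_deriv ::
    "('m, 'e::euclidean_space) chart set \<Rightarrow> ('m \<Rightarrow> 'm tangent) \<Rightarrow> ('m \<Rightarrow> 'm cotangent) \<Rightarrow> ('m \<Rightarrow> 'm cotangent)"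
  where
  "lie_deriv A X \<gamma> = (\<lambda>p v. THE r. \<forall>Z\<in>vector_fields A. Z p = v \<longrightarrow>
     r = X p (\<lambda>q. \<gamma> q (Z q)) - \<gamma> p (lie_bracket X Z p))"

(* The differential (pushforward) of a smooth map F into the manifold with atlas B. *)
definition differential ::
    "('n, 'e::euclidean_space) chart set \<Rightarrow> ('m \<Rightarrow> 'n) \<Rightarrow> 'm tangent \<Rightarrow> 'n tangent" where
  "differential B F v = (\<lambda>g. if g \<in> smooth_funs B then v (g \<circ> F) else 0)"


section \<open>Almost paracontact structures\<close>

definition almost_paracontact ::
    "('m, 'e::euclidean_space) chart set \<Rightarrow> ('m \<Rightarrow> 'm tangent \<Rightarrow> 'm tangent) \<Rightarrow>
     ('m \<Rightarrow> 'm tangent) \<Rightarrow> ('m \<Rightarrow> 'm cotangent) \<Rightarrow> bool" where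
  "almost_paracontact A \<phi> \<xi> \<eta> \<longleftrightarrow>
     \<phi> \<in> endo_fields A \<and> \<xi> \<in> vector_fields A \<and> \<eta> \<in> one_forms A \<and>
     (\<forall>p. \<forall>v\<in>tangent_space A p. \<phi> p (\<phi> p v) = v - (\<lambda>f. \<eta> p v * \<xi> p f)) \<and>
     (\<forall>p. \<eta> p (\<xi> p) = 1) \<and>
     (\<forall>p. \<phi> p (\<xi> p) = 0) \<and>
     (\<forall>p. \<forall>v\<in>tangent_space A p. \<eta> p (\<phi> p v) = 0)"

definition nijenhuis ::
    "('m \<Rightarrow> 'm tangent \<Rightarrow> 'm tangent) \<Rightarrow> ('m \<Rightarrow> 'm tangent) \<Rightarrow> ('m \<Rightarrow> 'm tangent) \<Rightarrow> ('m \<Rightarrow> 'm tangent)" where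
  "nijenhuis \<phi> X Y = (\<lambda>p.
     lie_bracket (\<lambda>q. \<phi> q (X q)) (\<lambda>q. \<phi> q (Y q)) p
     + \<phi> p (\<phi> p (lie_bracket X Y p))
     - \<phi> p (lie_bracket (\<lambda>q. \<phi> q (X q)) Y p)
     - \<phi> p (lie_bracket X (\<lambda>q. \<phi> q (Y q)) p))"

definition normal_paracontact ::
    "('m, 'e::euclidean_space) chart set \<Rightarrow> ('m \<Rightarrow> 'm tangent \<Rightarrow> 'm tangent) \<Rightarrow>
     ('m \<Rightarrow> 'm tangent) \<Rightarrow> ('m \<Rightarrow> 'm cotangent) \<Rightarrow> bool" where
  "normal_paracontact A \<phi> \<xi> \<eta> \<longleftrightarrow>
     (\<forall>X\<in>vector_fields A. \<forall>Y\<in>vector_fields A. \<forall>p.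
        nijenhuis \<phi> X Y p - (\<lambda>f. d_form \<eta> X Y p * \<xi> p f) = 0)"


section \<open>Generalized geometry\<close>

type_synonym 'm gvec = "'m tangent \<times> 'm cotangent"

(* Sections X + \<alpha> of the generalized tangent bundle; s p is the pair (X p, \<alpha> p). *)
definition gsections :: "('m, 'e::euclidean_space) chart set \<Rightarrow> ('m \<Rightarrow> 'm gvec) set" where
  "gsections A = {s. (\<lambda>p. fst (s p)) \<in> vector_fields A \<and> (\<lambda>p. snd (s p)) \<in> one_forms A}"

definition courant_bracket ::
    "('m, 'e::euclidean_space) chart set \<Rightarrow> ('m \<Rightarrow> 'm gvec) \<Rightarrow> ('m \<Rightarrow> 'm gvec) \<Rightarrow> ('m \<Rightarrow> 'm gvec)" where
  "courant_bracket A s u =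
     (let X = (\<lambda>p. fst (s p)); \<alpha> = (\<lambda>p. snd (s p)); Y = (\<lambda>p. fst (u p)); \<gamma> = (\<lambda>p. snd (u p))
      in (\<lambda>p. (lie_bracket X Y p,
               lie_deriv A X \<gamma> p - lie_deriv A Y \<alpha> p
               + d_fun (\<lambda>q. 1/2 * (\<alpha> q (Y q) - \<gamma> q (X q))) p)))"

definition courant_nijenhuis ::
    "('m, 'e::euclidean_space) chart set \<Rightarrow> ('m \<Rightarrow> 'm gvec \<Rightarrow> 'm gvec) \<Rightarrow>
     ('m \<Rightarrow> 'm gvec) \<Rightarrow> ('m \<Rightarrow> 'm gvec) \<Rightarrow> ('m \<Rightarrow> 'm gvec)" where
  "courant_nijenhuis A P s u = (\<lambda>x.
     courant_bracket A (\<lambda>y. P y (s y)) (\<lambda>y. P y (u y)) x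
     + P x (P x (courant_bracket A s u x))
     - P x (courant_bracket A (\<lambda>y. P y (s y)) u x)
     - P x (courant_bracket A s (\<lambda>y. P y (u y)) x))"

(* A covector is zero iff it vanishes on the tangent space; see the remark at one_forms. *)
definition courant_integrable ::
    "('m, 'e::euclidean_space) chart set \<Rightarrow> ('m \<Rightarrow> 'm gvec \<Rightarrow> 'm gvec) \<Rightarrow> bool" where
  "courant_integrable A P \<longleftrightarrow>
     (\<forall>s\<in>gsections A. \<forall>u\<in>gsections A. \<forall>x.
        fst (courant_nijenhuis A P s u x) = 0 \<and>
        (\<forall>v\<in>tangent_space A x. snd (courant_nijenhuis A P s u x) v = 0))"

definition block_matrix ::
    "('m tangent \<Rightarrow> 'm tangent) \<Rightarrow> ('m cotangent \<Rightarrow> 'm tangent) \<Rightarrow>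
     ('m tangent \<Rightarrow> 'm cotangent) \<Rightarrow> ('m cotangent \<Rightarrow> 'm cotangent) \<Rightarrow> 'm gvec \<Rightarrow> 'm gvec" where
  "block_matrix a b c d = (\<lambda>(v, \<alpha>). (a v + b \<alpha>, c v + d \<alpha>))"

definition dual_map :: "('m tangent \<Rightarrow> 'm tangent) \<Rightarrow> ('m cotangent \<Rightarrow> 'm cotangent)" where
  "dual_map F \<alpha> = (\<lambda>v. \<alpha> (F v))"

definition induced_endo :: "('m \<Rightarrow> 'm tangent \<Rightarrow> 'm tangent) \<Rightarrow> ('m \<Rightarrow> 'm gvec \<Rightarrow> 'm gvec)" where
  "induced_endo \<phi> = (\<lambda>p. block_matrix (\<phi> p) 0 0 (- dual_map (\<phi> p)))"


section \<open>The product with the real line\<close>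

definition line_atlas :: "('m, 'e::euclidean_space) chart set \<Rightarrow> ('m \<times> real, 'e \<times> real) chart set" where
  "line_atlas A = (\<lambda>(U, \<kappa>). (U \<times> UNIV, \<lambda>(p, t). (\<kappa> p, t))) ` A"

definition d_dt :: "('m, 'e::euclidean_space) chart set \<Rightarrow> 'm \<times> real \<Rightarrow> ('m \<times> real) tangent" where
  "d_dt A = (\<lambda>(p, t) g. if g \<in> smooth_funs (line_atlas A) then deriv (\<lambda>s. g (p, s)) t else 0)"

definition dt :: "'m \<times> real \<Rightarrow> ('m \<times> real) cotangent" where
  "dt = d_fun snd"

(* Pushforward along the projection to M, and along the inclusion of M as the slice at time t. *)
definition proj_push :: "('m, 'e::euclidean_space) chart set \<Rightarrow> ('m \<times> real) tangent \<Rightarrow> 'm tangent" where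
  "proj_push A = differential A fst"

definition slice_push :: "('m, 'e::euclidean_space) chart set \<Rightarrow> real \<Rightarrow> 'm tangent \<Rightarrow> ('m \<times> real) tangent" where
  "slice_push A t = differential (line_atlas A) (\<lambda>p. (p, t))"

(* Objects on M viewed as t-independent objects on the product; endomorphisms are extended by 0
   on d/dt (and on dt, for endomorphisms of the generalized tangent bundle). *)
definition lift_field ::
    "('m, 'e::euclidean_space) chart set \<Rightarrow> ('m \<Rightarrow> 'm tangent) \<Rightarrow> 'm \<times> real \<Rightarrow> ('m \<times> real) tangent" where
  "lift_field A X = (\<lambda>(p, t). slice_push A t (X p))"

definition lift_form ::
    "('m, 'e::euclidean_space) chart set \<Rightarrow> ('m \<Rightarrow> 'm cotangent) \<Rightarrow> 'm \<times> real \<Rightarrow> ('m \<times> real) cotangent" where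
  "lift_form A \<alpha> = (\<lambda>(p, t) w. \<alpha> p (proj_push A w))"

definition lift_endo ::
    "('m, 'e::euclidean_space) chart set \<Rightarrow> ('m \<Rightarrow> 'm tangent \<Rightarrow> 'm tangent) \<Rightarrow>
     'm \<times> real \<Rightarrow> ('m \<times> real) tangent \<Rightarrow> ('m \<times> real) tangent" where
  "lift_endo A \<phi> = (\<lambda>(p, t) w. slice_push A t (\<phi> p (proj_push A w)))"

definition lift_gendo ::
    "('m, 'e::euclidean_space) chart set \<Rightarrow> ('m \<Rightarrow> 'm gvec \<Rightarrow> 'm gvec) \<Rightarrow>
     'm \<times> real \<Rightarrow> ('m \<times> real) gvec \<Rightarrow> ('m \<times> real) gvec" where
  "lift_gendo A \<Phi> = (\<lambda>(p, t) (w, a).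
     let (v, b) = \<Phi> p (proj_push A w, \<lambda>z. a (slice_push A t z))
     in (slice_push A t v, \<lambda>z. b (proj_push A z)))"

definition adapted_beta ::
    "('m, 'e::euclidean_space) chart set \<Rightarrow> ('m \<Rightarrow> 'm tangent) \<Rightarrow>
     'm \<times> real \<Rightarrow> ('m \<times> real) cotangent \<Rightarrow> ('m \<times> real) tangent" where
  "adapted_beta A \<xi> = (\<lambda>x \<alpha>.
     (\<lambda>g. \<alpha> (d_dt A x) * lift_field A \<xi> x g) - (\<lambda>g. \<alpha> (lift_field A \<xi> x) * d_dt A x g))"

definition adapted_B ::
    "('m, 'e::euclidean_space) chart set \<Rightarrow> ('m \<Rightarrow> 'm cotangent) \<Rightarrow>
     'm \<times> real \<Rightarrow> ('m \<times> real) tangent \<Rightarrow> ('m \<times> real) cotangent" where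
  "adapted_B A \<eta> = (\<lambda>x w.
     (\<lambda>z. lift_form A \<eta> x w * dt x z) - (\<lambda>z. dt x w * lift_form A \<eta> x z))"

definition adapted_product ::
    "('m, 'e::euclidean_space) chart set \<Rightarrow> ('m \<Rightarrow> 'm gvec \<Rightarrow> 'm gvec) \<Rightarrow>
     ('m \<Rightarrow> 'm tangent) \<Rightarrow> ('m \<Rightarrow> 'm cotangent) \<Rightarrow> 'm \<times> real \<Rightarrow> ('m \<times> real) gvec \<Rightarrow> ('m \<times> real) gvec" where
  "adapted_product A \<Phi> \<xi> \<eta> =
     (\<lambda>x. lift_gendo A \<Phi> x + block_matrix 0 (adapted_beta A \<xi> x) (adapted_B A \<eta> x) 0)"

(* For the structure induced by an almost paracontact structure this is the matrix
   with rows (\<phi>, \<beta>) and (B, minus the dual of \<phi>). *)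
lemma adapted_product_induced_endo:
  "adapted_product A (induced_endo \<phi>) \<xi> \<eta> x =
   block_matrix (lift_endo A \<phi> x) (adapted_beta A \<xi> x) (adapted_B A \<eta> x) (- dual_map (lift_endo A \<phi> x))"
  by (cases x) (auto simp: adapted_product_def lift_gendo_def lift_endo_def induced_endo_def
      block_matrix_def dual_map_def fun_eq_iff slice_push_def differential_def)

definition normal_generalized_paracontact ::
    "('m, 'e::euclidean_space) chart set \<Rightarrow> ('m \<Rightarrow> 'm gvec \<Rightarrow> 'm gvec) \<Rightarrow>
     ('m \<Rightarrow> 'm tangent) \<Rightarrow> ('m \<Rightarrow> 'm cotangent) \<Rightarrow> bool" where
  "normal_generalized_paracontact A \<Phi> \<xi> \<eta> \<longleftrightarrow>
     courant_integrable (line_atlas A) (adapted_product A \<Phi> \<xi> \<eta>)"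

end

theory Submission
  imports Defs
begin

text \<open>With \<open>T = d/dt\<close> and \<open>\<tau> = dt\<close>, the equivalence has two parts: an algebraic one on \<open>M \<times> \<real>\<close>, and a
comparison of \<open>M \<times> \<real>\<close> with \<open>M\<close>.

\<^item> Algebra (\<open>courant_integrable_iff\<close>). On any manifold with fields \<open>\<phi>, \<xi>, T\<close> and forms \<open>\<eta>, \<tau>\<close> such that
  \<open>\<phi>\<^sup>2 = I - \<eta> \<otimes> \<xi> - \<tau> \<otimes> T\<close>, \<open>\<tau>\<close> is closed and \<open>T\<close> preserves \<open>\<phi>, \<xi>, \<eta>\<close>, the map \<open>P\<close> with blocks
  \<open>\<phi>\<close>, \<open>\<xi> \<and> T\<close>, \<open>\<eta> \<and> \<tau>\<close> and minus the dual of \<open>\<phi>\<close> is integrable iff \<open>N\<^sub>\<phi> = d\<eta> \<otimes> \<xi>\<close>. For two vector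
  fields the vector part of the Courant--Nijenhuis tensor is \<open>N\<^sub>\<phi> - d\<eta> \<otimes> \<xi>\<close> up to a multiple of \<open>T\<close>,
  and \<open>\<tau>\<close> shows that this multiple vanishes with the tensor; this gives one direction. Conversely
  \<open>N\<^sub>\<phi> = d\<eta> \<otimes> \<xi>\<close> implies \<open>L\<^sub>\<xi> \<eta> = 0\<close>, \<open>L\<^sub>\<xi> \<phi> = 0\<close> and \<open>d\<eta>(\<phi> X, Y) + d\<eta>(X, \<phi> Y) = 0\<close>
  (\<open>dir_xi_eta\<close>, \<open>lie_xi_phi\<close>, \<open>eta_lie_phi\<close>), and these identities cancel everything else: the tensor is
  evaluated separately on pairs of two fields, a field and a form, and two forms.

\<^item> Comparison (\<open>normal_lift_iff\<close>). \<open>N\<^sub>\<phi> - d\<eta> \<otimes> \<xi>\<close> is a tensor. On \<open>M \<times> \<real>\<close> every tangent vector is a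
  lift of one on \<open>M\<close> plus a multiple of \<open>d/dt\<close> (\<open>line_tangent_split\<close>); the tensor vanishes on \<open>d/dt\<close>
  because nothing depends on \<open>t\<close>, and on lifts it is the lift of the tensor on \<open>M\<close> (\<open>lift_defect\<close>).

Both parts use that a tensor at a point depends only on the values of its arguments there
(\<open>tensor_pointwise\<close>), and even the definition of the Lie derivative of a form presupposes it. With
tangent vectors given as derivations of the global smooth functions this rests on
\<open>frame_expansion\<close>: up to a cut-off factor, every derivation is a combination of coordinate
derivatives. That follows from Hadamard's lemma, which in turn needs the elementary calculus of
smooth maps and bump functions developed first.\<close>

section \<open>Calculus of smooth maps\<close>

lemma Ck_on_Suc_imp: "Ck_on (Suc k) S f \<Longrightarrow> Ck_on k S f"
proof (induction k arbitrary: f)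
  case 0
  then show ?case
    by (auto intro!: continuous_at_imp_continuous_on differentiable_imp_continuous_within)
next
  case (Suc k)
  then show ?case by (metis Ck_on.simps(2))
qed

lemma Ck_on_cong:
  assumes "open S" "\<And>x. x \<in> S \<Longrightarrow> f x = g x" "Ck_on k S f"
  shows "Ck_on k S g"
  using assms(2,3)
proof (induction k arbitrary: f g)
  case 0
  then show ?case by (simp cong: continuous_on_cong)
next
  case (Suc k)
  have d: "g differentiable (at x)" if "x \<in> S" for x
  proof -
    have "(f has_derivative frechet_derivative f (at x)) (at x)"
      using Suc.prems(2) that by (simp add: frechet_derivative_works)
    then have "(g has_derivative frechet_derivative f (at x)) (at x)"
      by (rule has_derivative_transform_within_open[OF _ assms(1) that Suc.prems(1)])
    then show ?thesis by (auto simp: differentiable_def)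
  qed
  have "frechet_derivative f (at x) = frechet_derivative g (at x)" if "x \<in> S" for x
    using frechet_derivative_transform_within_open[OF _ assms(1) that Suc.prems(1)] Suc.prems(2) that by simp
  then have eq: "x \<in> S \<Longrightarrow> frechet_derivative f (at x) v = frechet_derivative g (at x) v" for x v
    by simp
  have "Ck_on k S (\<lambda>x. frechet_derivative g (at x) v)" for v
    by (rule Suc.IH[OF eq]) (use Suc.prems(2) in auto)
  then show ?case
    using d by simp
qed

lemma Ck_on_local:
  "(\<And>x. x \<in> S \<Longrightarrow> \<exists>T. open T \<and> x \<in> T \<and> Ck_on k T f) \<Longrightarrow> Ck_on k S f"
proof (induction k arbitrary: f)
  case 0
  have "isCont f x" if "x \<in> S" for x
    using 0[OF that] by (auto simp: continuous_on_eq_continuous_at)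
  then show ?case
    by (simp add: continuous_at_imp_continuous_on)
next
  case (Suc k)
  have "f differentiable (at x)" if "x \<in> S" for x
    using Suc.prems[OF that] by auto
  moreover have "Ck_on k S (\<lambda>x. frechet_derivative f (at x) v)" for v
  proof (rule Suc.IH)
    fix x assume "x \<in> S"
    then obtain T where "open T" "x \<in> T" "Ck_on (Suc k) T f" using Suc.prems by blast
    then show "\<exists>T. open T \<and> x \<in> T \<and> Ck_on k T (\<lambda>x. frechet_derivative f (at x) v)" by auto
  qed
  ultimately show ?case by simp
qed

lemma smooth_on_subset: "smooth_on S f \<Longrightarrow> T \<subseteq> S \<Longrightarrow> smooth_on T f"
proof -
  have "Ck_on k S f \<Longrightarrow> T \<subseteq> S \<Longrightarrow> Ck_on k T f" for k
    by (induction k arbitrary: f) (auto intro: continuous_on_subset)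
  then show "smooth_on S f \<Longrightarrow> T \<subseteq> S \<Longrightarrow> smooth_on T f"
    by (auto simp: smooth_on_def)
qed

lemma smooth_on_cong:
  "open S \<Longrightarrow> (\<And>x. x \<in> S \<Longrightarrow> f x = g x) \<Longrightarrow> smooth_on S f \<Longrightarrow> smooth_on S g"
  unfolding smooth_on_def using Ck_on_cong by metis

lemma smooth_on_local:
  "(\<And>x. x \<in> S \<Longrightarrow> \<exists>T. open T \<and> x \<in> T \<and> smooth_on T f) \<Longrightarrow> smooth_on S f"
  unfolding smooth_on_def by (intro allI Ck_on_local) metis

lemma smooth_on_differentiable: "smooth_on S f \<Longrightarrow> x \<in> S \<Longrightarrow> f differentiable (at x)"
  unfolding smooth_on_def by (metis Ck_on.simps(2))

lemma smooth_on_frechet_derivative: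
  "smooth_on S f \<Longrightarrow> smooth_on S (\<lambda>x. frechet_derivative f (at x) v)"
  unfolding smooth_on_def by (metis Ck_on.simps(2))

lemma smooth_on_continuous_on: "smooth_on S f \<Longrightarrow> continuous_on S f"
  unfolding smooth_on_def by (metis Ck_on.simps(1))

lemma Ck_on_const: "Ck_on k S (\<lambda>x. c)"
  by (induction k arbitrary: c) auto

text \<open>The recursive definition of \<open>Ck_on\<close> speaks of \<open>frechet_derivative\<close>; this form allows any explicit
formula for the derivative instead.\<close>
lemma Ck_on_SucI:
  assumes "open S" "\<And>x. x \<in> S \<Longrightarrow> (f has_derivative f' x) (at x)" "\<And>v. Ck_on k S (\<lambda>x. f' x v)"
  shows "Ck_on (Suc k) S f"
proof -
  have "Ck_on k S (\<lambda>x. frechet_derivative f (at x) v)" for v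
    by (rule Ck_on_cong[OF assms(1) _ assms(3)[of v]]) (simp add: frechet_derivative_at[OF assms(2), symmetric])
  then show ?thesis
    using assms(2) by (auto simp: differentiable_def)
qed

lemma Ck_on_Suc_has_derivative:
  "Ck_on (Suc k) S f \<Longrightarrow> x \<in> S \<Longrightarrow> (f has_derivative frechet_derivative f (at x)) (at x)"
  by (simp add: frechet_derivative_works)

lemma Ck_on_add:
  assumes "open S"
  shows "Ck_on k S f \<Longrightarrow> Ck_on k S g \<Longrightarrow> Ck_on k S (\<lambda>x. f x + g x)"
proof (induction k arbitrary: f g)
  case 0
  then show ?case by (auto intro: continuous_on_add)
next
  case (Suc k)
  show ?case
  proof (rule Ck_on_SucI[OF assms has_derivative_add[OF Ck_on_Suc_has_derivative[OF Suc.prems(1)] Ck_on_Suc_has_derivative[OF Suc.prems(2)]]])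
    show "Ck_on k S (\<lambda>x. frechet_derivative f (at x) v + frechet_derivative g (at x) v)" for v
      using Suc.prems by (intro Suc.IH) auto
  qed
qed

lemma Ck_on_bounded_linear:
  assumes "open S" "bounded_linear L"
  shows "Ck_on k S f \<Longrightarrow> Ck_on k S (\<lambda>x. L (f x))"
proof (induction k arbitrary: f)
  case 0
  then show ?case using assms(2) by (auto intro: bounded_linear.continuous_on)
next
  case (Suc k)
  show ?case
  proof (rule Ck_on_SucI[OF assms(1) bounded_linear.has_derivative[OF assms(2) Ck_on_Suc_has_derivative[OF Suc.prems(1)]]])
    show "Ck_on k S (\<lambda>x. L (frechet_derivative f (at x) v))" for v
      using Suc.prems by (intro Suc.IH) auto
  qed
qed

lemma Ck_on_scaleR:
  assumes "open S"
  shows "Ck_on k S f \<Longrightarrow> Ck_on k S g \<Longrightarrow> Ck_on k S (\<lambda>x. f x *\<^sub>R g x)"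
proof (induction k arbitrary: f g)
  case 0
  then show ?case by (auto intro: continuous_on_scaleR)
next
  case (Suc k)
  show ?case
  proof (rule Ck_on_SucI[OF assms(1) has_derivative_scaleR[OF Ck_on_Suc_has_derivative[OF Suc.prems(1)] Ck_on_Suc_has_derivative[OF Suc.prems(2)]]])
    show "Ck_on k S (\<lambda>x. f x *\<^sub>R frechet_derivative g (at x) v + frechet_derivative f (at x) v *\<^sub>R g x)" for v
      using Suc.prems Ck_on_Suc_imp[OF Suc.prems(1)] Ck_on_Suc_imp[OF Suc.prems(2)]
      by (intro Ck_on_add[OF assms] Suc.IH) auto
  qed
qed

lemma Ck_on_sum:
  assumes "open S" "\<And>i. i \<in> I \<Longrightarrow> Ck_on k S (f i)"
  shows "Ck_on k S (\<lambda>x. \<Sum>i\<in>I. f i x)"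
  using assms(2) by (induction I rule: infinite_finite_induct) (auto intro: Ck_on_const Ck_on_add[OF assms(1)])

text \<open>Finite dimension of the intermediate space is what makes the induction work: by the chain rule a
directional derivative of \<open>g \<circ> f\<close> is a finite sum of products of one-step-less-smooth functions, the
partial derivatives of \<open>g\<close> composed with \<open>f\<close>.\<close>
lemma Ck_on_compose:
  fixes f :: "'a::real_normed_vector \<Rightarrow> 'b::euclidean_space"
  assumes "open S" "f ` S \<subseteq> T"
  shows "Ck_on k T g \<Longrightarrow> Ck_on k S f \<Longrightarrow> Ck_on k S (\<lambda>x. g (f x))"
proof (induction k arbitrary: g)
  case 0
  then show ?case using assms(2) by (auto intro: continuous_on_compose2)
next
  case (Suc k)
  have *: "((\<lambda>x. g (f x)) has_derivative
      (\<lambda>v. frechet_derivative g (at (f x)) (frechet_derivative f (at x) v))) (at x)" if "x \<in> S" for x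
    using Suc.prems that assms(2)
    by (intro has_derivative_compose[of f _ x UNIV g]) (auto simp: frechet_derivative_works)
  have expand: "frechet_derivative g (at (f x)) w = (\<Sum>b\<in>Basis. (w \<bullet> b) *\<^sub>R frechet_derivative g (at (f x)) b)"
    if "x \<in> S" for x w
  proof -
    have "g differentiable at (f x)" using Suc.prems that assms(2) by auto
    then interpret bounded_linear "frechet_derivative g (at (f x))"
      by (simp add: frechet_derivative_works has_derivative_bounded_linear)
    show ?thesis
      by (subst euclidean_representation[of w, symmetric]) (simp add: sum scale)
  qed
  show ?case
  proof (rule Ck_on_SucI[OF assms(1) *])
    fix v
    have "Ck_on k S f" using Suc.prems(2) by (rule Ck_on_Suc_imp)
    then have "Ck_on k S (\<lambda>x. frechet_derivative g (at (f x)) b)" for b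
      using Suc.prems(1) by (intro Suc.IH[of "\<lambda>y. frechet_derivative g (at y) b"]) auto
    then have "Ck_on k S (\<lambda>x. \<Sum>b\<in>Basis. (frechet_derivative f (at x) v \<bullet> b) *\<^sub>R frechet_derivative g (at (f x)) b)"
      using Suc.prems(2)
      by (intro Ck_on_sum Ck_on_scaleR assms Ck_on_bounded_linear[OF assms(1) bounded_linear_inner_left]) auto
    then show "Ck_on k S (\<lambda>x. frechet_derivative g (at (f x)) (frechet_derivative f (at x) v))"
      by (rule Ck_on_cong[OF assms(1), rotated]) (rule expand[symmetric])
  qed
qed

lemma smooth_on_const: "smooth_on S (\<lambda>x. c)"
  by (simp add: smooth_on_def Ck_on_const)

lemma smooth_on_ident: "smooth_on S (\<lambda>x. x)"
proof -
  have "Ck_on k S (\<lambda>x::'a. x)" for k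
    by (cases k) (auto simp: Ck_on_const)
  then show ?thesis by (simp add: smooth_on_def)
qed

lemma smooth_on_add: "open S \<Longrightarrow> smooth_on S f \<Longrightarrow> smooth_on S g \<Longrightarrow> smooth_on S (\<lambda>x. f x + g x)"
  by (simp add: smooth_on_def Ck_on_add)

lemma smooth_on_scaleR:
  "open S \<Longrightarrow> smooth_on S f \<Longrightarrow> smooth_on S g \<Longrightarrow> smooth_on S (\<lambda>x. f x *\<^sub>R g x)"
  by (simp add: smooth_on_def Ck_on_scaleR)

lemma smooth_on_mult:
  fixes f g :: "'a::real_normed_vector \<Rightarrow> real"
  shows "open S \<Longrightarrow> smooth_on S f \<Longrightarrow> smooth_on S g \<Longrightarrow> smooth_on S (\<lambda>x. f x * g x)"
  using smooth_on_scaleR[of S f g] by simp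

lemma smooth_on_bounded_linear:
  "open S \<Longrightarrow> bounded_linear L \<Longrightarrow> smooth_on S f \<Longrightarrow> smooth_on S (\<lambda>x. L (f x))"
  by (simp add: smooth_on_def Ck_on_bounded_linear)

lemma smooth_on_diff: "open S \<Longrightarrow> smooth_on S f \<Longrightarrow> smooth_on S g \<Longrightarrow> smooth_on S (\<lambda>x. f x - g x)"
  using smooth_on_add[OF _ _ smooth_on_bounded_linear[OF _ bounded_linear_minus[OF bounded_linear_ident]], of S f g]
  by simp

lemma smooth_on_sum:
  "open S \<Longrightarrow> (\<And>i. i \<in> I \<Longrightarrow> smooth_on S (f i)) \<Longrightarrow> smooth_on S (\<lambda>x. \<Sum>i\<in>I. f i x)"
  by (simp add: smooth_on_def Ck_on_sum)

lemma smooth_on_compose: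
  fixes f :: "'a::real_normed_vector \<Rightarrow> 'b::euclidean_space"
  shows "open S \<Longrightarrow> smooth_on T g \<Longrightarrow> smooth_on S f \<Longrightarrow> f ` S \<subseteq> T \<Longrightarrow> smooth_on S (\<lambda>x. g (f x))"
  by (simp add: smooth_on_def Ck_on_compose)

lemma smooth_on_Pair:
  assumes "open S" "smooth_on S f" "smooth_on S g"
  shows "smooth_on S (\<lambda>x. (f x, g x))"
proof -
  have "smooth_on S (\<lambda>x. (f x, 0) + (0, g x))"
    using assms by (intro smooth_on_add smooth_on_bounded_linear[of S "\<lambda>a. (a, 0)"] smooth_on_bounded_linear[of S "\<lambda>a. (0, a)"]
       bounded_linear_Pair bounded_linear_ident bounded_linear_zero)
  then show ?thesis by simp
qed

lemma smooth_on_fst: "open S \<Longrightarrow> smooth_on S f \<Longrightarrow> smooth_on S (\<lambda>x. fst (f x))"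
  by (rule smooth_on_bounded_linear[OF _ bounded_linear_fst])

lemma smooth_on_snd: "open S \<Longrightarrow> smooth_on S f \<Longrightarrow> smooth_on S (\<lambda>x. snd (f x))"
  by (rule smooth_on_bounded_linear[OF _ bounded_linear_snd])

lemma Ck_on_Suc_real:
  fixes f :: "real \<Rightarrow> real"
  assumes "open S" "\<And>x. x \<in> S \<Longrightarrow> (f has_field_derivative f' x) (at x)" "Ck_on k S f'"
  shows "Ck_on (Suc k) S f"
  by (rule Ck_on_SucI[OF assms(1) assms(2)[unfolded has_field_derivative_def]
        Ck_on_bounded_linear[OF assms(1) bounded_linear_mult_left assms(3)]])

lemma DERIV_inverse_power:
  fixes x :: real
  assumes "x \<noteq> 0"
  shows "((\<lambda>x. inverse x ^ m) has_field_derivative (- real m * inverse x ^ Suc m)) (at x)"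
  using DERIV_power[OF DERIV_inverse[OF assms], of m] by (cases m) (simp_all add: algebra_simps)

lemma smooth_on_inverse: "smooth_on (- {0::real}) inverse"
proof -
  have "Ck_on k (- {0::real}) (\<lambda>x. inverse x ^ m)" for k m
  proof (induction k arbitrary: m)
    case 0
    show ?case by (auto intro!: continuous_intros)
  next
    case (Suc k)
    have "Ck_on k (- {0}) (\<lambda>x. - real m * inverse x ^ Suc m)"
      by (rule Ck_on_bounded_linear[OF _ bounded_linear_mult_right Suc]) (simp add: open_Compl)
    then show ?case
      by (rule Ck_on_Suc_real[rotated 2]) (use DERIV_inverse_power in \<open>auto intro: open_Compl\<close>)
  qed
  from this[of _ 1] show ?thesis by (simp add: smooth_on_def)
qed

text \<open>The functions \<open>x\<^sup>-\<^sup>m exp (- 1 / x)\<close>, extended by 0 to \<open>x \<le> 0\<close>. The powers are included because this family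
is closed under differentiation, so that one induction shows all its members to be smooth.\<close>
definition flat_exp :: "nat \<Rightarrow> real \<Rightarrow> real" where
  "flat_exp m x = (if x > 0 then exp (- inverse x) * inverse x ^ m else 0)"

lemma flat_exp_limit: "(flat_exp m \<longlongrightarrow> 0) (at 0)"
proof -
  have "((\<lambda>x::real. x ^ m / exp x) \<longlongrightarrow> 0) at_top" by (rule tendsto_power_div_exp_0)
  then have "((\<lambda>x::real. inverse x ^ m / exp (inverse x)) \<longlongrightarrow> 0) (at_right 0)"
    by (rule filterlim_compose) (rule filterlim_inverse_at_top_right)
  moreover have "eventually (\<lambda>x::real. inverse x ^ m / exp (inverse x) = flat_exp m x) (at_right 0)"
    by (rule eventually_mono[OF eventually_at_right_less]) (simp add: flat_exp_def exp_minus divide_inverse)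
  ultimately have "(flat_exp m \<longlongrightarrow> 0) (at_right 0)" by (rule Lim_transform_eventually)
  moreover have "(flat_exp m \<longlongrightarrow> 0) (at_left 0)"
    by (rule Lim_transform_eventually[OF tendsto_const]) (simp add: flat_exp_def eventually_at_filter)
  ultimately show ?thesis by (simp add: filterlim_split_at)
qed

lemma flat_exp_deriv: "(flat_exp m has_field_derivative (- real m * flat_exp (Suc m) x + flat_exp (Suc (Suc m)) x)) (at x)"
proof (cases "x = 0")
  case True
  have "((\<lambda>h. (flat_exp m h - flat_exp m 0) / (h - 0)) \<longlongrightarrow> 0) (at 0)"
    by (rule Lim_transform_eventually[OF flat_exp_limit[of "Suc m"]])
      (auto simp: flat_exp_def divide_inverse eventually_at_filter)
  then show ?thesis using True by (simp add: has_field_derivative_iff flat_exp_def)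
next
  case False
  show ?thesis
  proof (cases "x > 0")
    case True
    have "((\<lambda>x. exp (- inverse x) * inverse x ^ m) has_field_derivative (- real m * flat_exp (Suc m) x + flat_exp (Suc (Suc m)) x)) (at x)"
    proof -
      have "((\<lambda>x. exp (- inverse x)) has_field_derivative exp (- inverse x) * (inverse x)\<^sup>2) (at x)"
        using True by (auto intro!: derivative_eq_intros simp: power2_eq_square)
      from DERIV_mult[OF this DERIV_inverse_power[of x m]] True show ?thesis
        by (simp add: flat_exp_def algebra_simps power2_eq_square)
    qed
    then show ?thesis
      by (rule has_field_derivative_transform_within_open[where S="{0<..}"]) (use True in \<open>auto simp: flat_exp_def\<close>)
  next
    case neg: False
    have "((\<lambda>x. 0) has_field_derivative (- real m * flat_exp (Suc m) x + flat_exp (Suc (Suc m)) x)) (at x)"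
      using neg by (auto simp: flat_exp_def)
    then show ?thesis
      by (rule has_field_derivative_transform_within_open[where S="{..<0}"]) (use False neg in \<open>auto simp: flat_exp_def\<close>)
  qed
qed

lemma smooth_on_flat_exp: "smooth_on UNIV (flat_exp m)"
proof -
  have "Ck_on k UNIV (flat_exp m)" for k
  proof (induction k arbitrary: m)
    case 0
    show ?case using flat_exp_deriv by (auto intro!: continuous_at_imp_continuous_on DERIV_isCont)
  next
    case (Suc k)
    show ?case
      by (intro Ck_on_Suc_real[OF _ flat_exp_deriv] Ck_on_add Suc Ck_on_bounded_linear[OF _ bounded_linear_mult_right]) auto
  qed
  then show ?thesis by (simp add: smooth_on_def)
qed

text \<open>Differentiating under the integral in a direction \<open>v\<close> replaces \<open>f\<close> by its derivative in that direction
and \<open>m\<close> by \<open>m + 1\<close>; the factor \<open>s ^ m\<close> is there so that the induction on \<open>k\<close> stays within the family.\<close>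
lemma Ck_on_segment_average:
  fixes f :: "'a::euclidean_space \<Rightarrow> real"
  assumes V: "open V" "convex V" "q \<in> V"
  shows "smooth_on V f \<Longrightarrow> Ck_on k V (\<lambda>x. integral {0..1} (\<lambda>s. s ^ m * f (q + s *\<^sub>R (x - q))))"
proof (induction k arbitrary: m f)
  case (0 m f)
  have mem: "q + s *\<^sub>R (x - q) \<in> V" if "x \<in> V" "s \<in> {0..1}" for x s
    using convexD_alt[OF V(2) V(3) that(1), of s] that(2) by (simp add: algebra_simps)
  have "continuous_on (V \<times> cbox 0 1) (\<lambda>(x, s). s ^ m * f (q + s *\<^sub>R (x - q)))"
    unfolding split_beta
    by (intro continuous_intros continuous_on_compose2[OF smooth_on_continuous_on[OF 0]]) (auto intro!: mem)
  then have "continuous_on V (\<lambda>x. integral (cbox 0 1) (\<lambda>s. s ^ m * f (q + s *\<^sub>R (x - q))))"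
    by (rule integral_continuous_on_param)
  then show ?case by simp
next
  case (Suc k m f)
  have mem: "q + s *\<^sub>R (x - q) \<in> V" if "x \<in> V" "s \<in> {0..1}" for x s
    using convexD_alt[OF V(2) V(3) that(1), of s] that(2) by (simp add: algebra_simps)
  define D where "D = (\<lambda>b y. frechet_derivative f (at y) b)"
  have smD: "smooth_on V (D b)" for b
    unfolding D_def using smooth_on_frechet_derivative[OF Suc.prems] .
  have lin: "D w y = (\<Sum>b\<in>Basis. (w \<bullet> b) * D b y)" if "y \<in> V" for y w
  proof -
    interpret bounded_linear "frechet_derivative f (at y)"
      using smooth_on_differentiable[OF Suc.prems that]
      by (simp add: frechet_derivative_works has_derivative_bounded_linear)
    show ?thesis unfolding D_def
      by (subst euclidean_representation[of w, symmetric]) (simp add: sum scale)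
  qed
  define F' where "F' = (\<lambda>x s. \<Sum>b\<in>Basis. (s ^ Suc m * D b (q + s *\<^sub>R (x - q))) *\<^sub>R blinfun_inner_left b)"
  have F'_apply: "blinfun_apply (F' x s) v = s ^ Suc m * D v (q + s *\<^sub>R (x - q))" if "x \<in> V" "s \<in> {0..1}" for x s v
  proof -
    have "blinfun_apply (F' x s) v = (\<Sum>b\<in>Basis. (s ^ Suc m * D b (q + s *\<^sub>R (x - q))) * (v \<bullet> b))"
      by (simp add: F'_def blinfun.sum_left blinfun.scaleR_left)
    also have "\<dots> = (\<Sum>b\<in>Basis. s ^ Suc m * ((v \<bullet> b) * D b (q + s *\<^sub>R (x - q))))"
      by (rule sum.cong[OF refl]) (simp only: mult.assoc mult.commute[of "v \<bullet> _"])
    also have "\<dots> = s ^ Suc m * D v (q + s *\<^sub>R (x - q))"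
      unfolding sum_distrib_left[symmetric] using lin[OF mem[OF that], of v] by (rule arg_cong[OF sym])
    finally show ?thesis .
  qed
  have cont: "continuous_on (V \<times> cbox 0 1) (\<lambda>(x, s). F' x s)"
    unfolding split_beta F'_def
    by (intro continuous_intros continuous_on_compose2[OF smooth_on_continuous_on[OF smD]]) (auto intro!: mem)
  have der: "((\<lambda>x. s ^ m * f (q + s *\<^sub>R (x - q))) has_derivative blinfun_apply (F' x s)) (at x within V)"
    if "x \<in> V" "s \<in> cbox 0 1" for x s
  proof -
    have s: "s \<in> {0..1}" using that by auto
    have "(f has_derivative (\<lambda>v. D v (q + s *\<^sub>R (x - q)))) (at (q + s *\<^sub>R (x - q)))"
      using smooth_on_differentiable[OF Suc.prems mem[OF that(1) s]]
      by (simp add: D_def frechet_derivative_works)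
    moreover have "((\<lambda>x. q + s *\<^sub>R (x - q)) has_derivative (\<lambda>v. s *\<^sub>R v)) (at x within V)"
      by (auto intro!: derivative_eq_intros)
    ultimately have "((\<lambda>x. f (q + s *\<^sub>R (x - q))) has_derivative (\<lambda>v. D (s *\<^sub>R v) (q + s *\<^sub>R (x - q)))) (at x within V)"
      by (rule has_derivative_compose[rotated])
    then have "((\<lambda>x. s ^ m * f (q + s *\<^sub>R (x - q))) has_derivative (\<lambda>v. s ^ m * D (s *\<^sub>R v) (q + s *\<^sub>R (x - q)))) (at x within V)"
      by (rule has_derivative_mult_right)
    moreover have "s ^ m * D (s *\<^sub>R v) (q + s *\<^sub>R (x - q)) = F' x s v" for v
      using lin[OF mem[OF that(1) s], of v] lin[OF mem[OF that(1) s], of "s *\<^sub>R v"]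
      by (simp add: F'_apply[OF that(1) s] sum_distrib_left mult_ac)
    ultimately show ?thesis by simp
  qed
  have cF': "continuous_on (cbox 0 1) (F' x)" if "x \<in> V" for x
    using that by (intro continuous_on_compose2[OF cont, of _ "\<lambda>s. (x, s)", simplified]) (auto intro!: continuous_intros)
  have der_int: "((\<lambda>x. integral {0..1} (\<lambda>s. s ^ m * f (q + s *\<^sub>R (x - q)))) has_derivative
      (\<lambda>v. integral {0..1} (\<lambda>s. s ^ Suc m * D v (q + s *\<^sub>R (x - q))))) (at x)" if x: "x \<in> V" for x
  proof -
    have "((\<lambda>x. integral (cbox 0 1) (\<lambda>s. s ^ m * f (q + s *\<^sub>R (x - q)))) has_derivative
        blinfun_apply (integral (cbox 0 1) (F' x))) (at x within V)"
      by (rule leibniz_rule[OF der _ cont x V(2)])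
        (auto intro!: integrable_continuous_real continuous_intros continuous_on_compose2[OF smooth_on_continuous_on[OF Suc.prems]] mem)
    moreover have "blinfun_apply (integral (cbox 0 1) (F' x)) = (\<lambda>v. integral {0..1} (\<lambda>s. s ^ Suc m * D v (q + s *\<^sub>R (x - q))))"
    proof
      fix v
      have "blinfun_apply (integral (cbox 0 1) (F' x)) v = integral (cbox 0 1) ((\<lambda>B. blinfun_apply B v) \<circ> F' x)"
        by (rule integral_linear[OF integrable_continuous[OF cF'[OF x]] blinfun.bounded_linear_left, symmetric])
      also have "\<dots> = integral {0..1} (\<lambda>s. s ^ Suc m * D v (q + s *\<^sub>R (x - q)))"
        unfolding o_def cbox_interval by (rule integral_cong) (use F'_apply x in auto)
      finally show "blinfun_apply (integral (cbox 0 1) (F' x)) v = \<dots>" .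
    qed
    ultimately show ?thesis unfolding at_within_open[OF x V(1)] cbox_interval by (simp only:)
  qed
  show ?case
    unfolding Ck_on.simps
  proof (intro conjI ballI allI)
    fix x assume "x \<in> V"
    then show "(\<lambda>x. integral {0..1} (\<lambda>s. s ^ m * f (q + s *\<^sub>R (x - q)))) differentiable at x"
      using der_int by (auto simp: differentiable_def)
  next
    fix v
    show "Ck_on k V (\<lambda>x. frechet_derivative (\<lambda>x. integral {0..1} (\<lambda>s. s ^ m * f (q + s *\<^sub>R (x - q)))) (at x) v)"
      by (rule Ck_on_cong[OF V(1) _ Suc.IH[OF smD[of v], of "Suc m"]])
        (simp add: frechet_derivative_at[OF der_int, symmetric])
  qed
qed

text \<open>Along the segment from \<open>q\<close> to \<open>x\<close> the difference \<open>f x - f q\<close> is the integral of its derivative; the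
\<open>g b\<close> are the averages over the segment of the partial derivatives of \<open>f\<close>.\<close>
lemma hadamard:
  fixes f :: "'a::euclidean_space \<Rightarrow> real"
  assumes V: "open V" "convex V" "q \<in> V" and f: "smooth_on V f"
  obtains g where "\<And>b. smooth_on V (g b)"
    "\<And>x. x \<in> V \<Longrightarrow> f x = f q + (\<Sum>b\<in>Basis. ((x - q) \<bullet> b) * g b x)"
    "\<And>b. g b q = frechet_derivative f (at q) b"
proof
  define g where "g = (\<lambda>b x. integral {0..1} (\<lambda>s. s ^ 0 * frechet_derivative f (at (q + s *\<^sub>R (x - q))) b))"
  have mem: "q + s *\<^sub>R (x - q) \<in> V" if "x \<in> V" "s \<in> {0..1}" for x s
    using convexD_alt[OF V(2) V(3) that(1), of s] that(2) by (simp add: algebra_simps)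
  show "smooth_on V (g b)" for b
    unfolding smooth_on_def g_def
    using Ck_on_segment_average[OF V smooth_on_frechet_derivative[OF f]] by blast
  show "g b q = frechet_derivative f (at q) b" for b
    by (simp add: g_def)
  show "f x = f q + (\<Sum>b\<in>Basis. ((x - q) \<bullet> b) * g b x)" if x: "x \<in> V" for x
  proof -
    have "((\<lambda>s. f (q + s *\<^sub>R (x - q))) has_vector_derivative
        (\<Sum>b\<in>Basis. ((x - q) \<bullet> b) * frechet_derivative f (at (q + s *\<^sub>R (x - q))) b)) (at s within {0..1})"
      if s: "s \<in> {0..1}" for s
    proof -
      let ?L = "frechet_derivative f (at (q + s *\<^sub>R (x - q)))"
      have fd: "(f has_derivative ?L) (at (q + s *\<^sub>R (x - q)))"
        using smooth_on_differentiable[OF f mem[OF x s]] by (simp add: frechet_derivative_works)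
      interpret bounded_linear ?L using fd by (rule has_derivative_bounded_linear)
      have "((\<lambda>s. q + s *\<^sub>R (x - q)) has_derivative (\<lambda>h. h *\<^sub>R (x - q))) (at s within {0..1})"
        by (auto intro!: derivative_eq_intros)
      from has_derivative_compose[OF this fd]
      have "((\<lambda>s. f (q + s *\<^sub>R (x - q))) has_derivative (\<lambda>h. h *\<^sub>R ?L (x - q))) (at s within {0..1})"
        by (simp add: scale)
      moreover have "?L (x - q) = (\<Sum>b\<in>Basis. ((x - q) \<bullet> b) * ?L b)"
        by (subst euclidean_representation[of "x - q", symmetric]) (simp only: sum scale real_scaleR_def)
      ultimately show ?thesis by (simp add: has_vector_derivative_def)
    qed
    then have "((\<lambda>s. \<Sum>b\<in>Basis. ((x - q) \<bullet> b) * frechet_derivative f (at (q + s *\<^sub>R (x - q))) b) has_integral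
        (f (q + 1 *\<^sub>R (x - q)) - f (q + 0 *\<^sub>R (x - q)))) {0..1}"
      by (intro fundamental_theorem_of_calculus) auto
    then have "f x - f q = integral {0..1} (\<lambda>s. \<Sum>b\<in>Basis. ((x - q) \<bullet> b) * frechet_derivative f (at (q + s *\<^sub>R (x - q))) b)"
      by (simp add: integral_unique)
    also have "\<dots> = (\<Sum>b\<in>Basis. integral {0..1} (\<lambda>s. ((x - q) \<bullet> b) * frechet_derivative f (at (q + s *\<^sub>R (x - q))) b))"
      by (rule integral_sum)
        (auto intro!: integrable_continuous_real continuous_intros mem x
          continuous_on_compose2[OF smooth_on_continuous_on[OF smooth_on_frechet_derivative[OF f]]])
    also have "\<dots> = (\<Sum>b\<in>Basis. ((x - q) \<bullet> b) * g b x)"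
      by (simp add: g_def)
    finally show ?thesis by simp
  qed
qed

section \<open>Smooth functions and cut-offs on a manifold\<close>

locale smooth_manifold =
  fixes A :: "('m::{t2_space, second_countable_topology}, 'e::euclidean_space) chart set"
  assumes atlas: "smooth_atlas A"
begin

abbreviation C :: "('m \<Rightarrow> real) set" where "C \<equiv> smooth_funs A"

lemma
  assumes "(U, \<kappa>) \<in> A"
  shows chart_open: "open U"
    and chart_open_image: "open (\<kappa> ` U)"
    and chart_inj: "inj_on \<kappa> U"
    and chart_continuous: "continuous_on U \<kappa>"
    and chart_inv_continuous: "continuous_on (\<kappa> ` U) (inv_into U \<kappa>)"
proof -
  have c: "is_chart (U, \<kappa>)"
    using atlas assms unfolding smooth_atlas_def by blast
  then obtain g where g: "homeomorphism U (\<kappa> ` U) \<kappa> g"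
    by (auto simp: is_chart_def)
  show "open U" "open (\<kappa> ` U)" using c by (auto simp: is_chart_def)
  show inj: "inj_on \<kappa> U"
    using g by (metis homeomorphism_apply1 inj_onI)
  show "continuous_on U \<kappa>" using g by (rule homeomorphism_cont1)
  have "continuous_on (\<kappa> ` U) g" using g by (rule homeomorphism_cont2)
  moreover have "g y = inv_into U \<kappa> y" if "y \<in> \<kappa> ` U" for y
    using that g inj by (auto simp: homeomorphism_def)
  ultimately show "continuous_on (\<kappa> ` U) (inv_into U \<kappa>)"
    by (simp cong: continuous_on_cong)
qed

lemma chart_inv: "(U, \<kappa>) \<in> A \<Longrightarrow> q \<in> U \<Longrightarrow> inv_into U \<kappa> (\<kappa> q) = q"
  by (simp add: chart_inj inv_into_f_f)

lemma chart_exists: "\<exists>U \<kappa>. (U, \<kappa>) \<in> A \<and> p \<in> U"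
proof -
  have "p \<in> (\<Union>(U, \<kappa>)\<in>A. U)" using atlas by (simp add: smooth_atlas_def)
  then show ?thesis by auto
qed

lemma chart_open_map:
  assumes "(U, \<kappa>) \<in> A" "open W"
  shows "open (\<kappa> ` (U \<inter> W))"
proof -
  have "\<kappa> ` (U \<inter> W) = \<kappa> ` U \<inter> inv_into U \<kappa> -` W"
    using chart_inv[OF assms(1)] by (auto simp: image_iff)
  then show ?thesis
    using continuous_open_preimage[OF chart_inv_continuous[OF assms(1)] chart_open_image[OF assms(1)] assms(2)] by simp
qed

lemma chart_open_preimage:
  assumes "(U, \<kappa>) \<in> A" "open V"
  shows "open {q \<in> U. \<kappa> q \<in> V}"
proof -
  have "{q \<in> U. \<kappa> q \<in> V} = U \<inter> \<kappa> -` V" by auto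
  then show ?thesis
    using continuous_open_preimage[OF chart_continuous[OF assms(1)] chart_open[OF assms(1)] assms(2)] by simp
qed

lemma transition_smooth:
  assumes "(U, \<kappa>) \<in> A" "(W, \<psi>) \<in> A"
  shows "smooth_on (\<psi> ` (U \<inter> W)) (\<lambda>y. \<kappa> (inv_into W \<psi> y))"
proof -
  have "\<forall>(U, \<kappa>)\<in>A. \<forall>(V, \<psi>)\<in>A. smooth_on (\<kappa> ` (U \<inter> V)) (\<psi> \<circ> inv_into U \<kappa>)"
    using atlas by (simp add: smooth_atlas_def)
  from bspec[OF bspec[OF this assms(2), simplified] assms(1)]
  have "smooth_on (\<psi> ` (W \<inter> U)) (\<kappa> \<circ> inv_into W \<psi>)"
    by simp
  then show ?thesis by (simp add: o_def Int_commute)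
qed

lemma smooth_funD: "f \<in> C \<Longrightarrow> (U, \<kappa>) \<in> A \<Longrightarrow> smooth_on (\<kappa> ` U) (\<lambda>y. f (inv_into U \<kappa> y))"
  by (auto simp: smooth_funs_def o_def)

lemma smooth_funI: "(\<And>U \<kappa>. (U, \<kappa>) \<in> A \<Longrightarrow> smooth_on (\<kappa> ` U) (\<lambda>y. f (inv_into U \<kappa> y))) \<Longrightarrow> f \<in> C"
  by (auto simp: smooth_funs_def o_def)

lemma smooth_fun_const [simp, intro]: "(\<lambda>q. c) \<in> C"
  by (rule smooth_funI) (intro smooth_on_const)

lemma smooth_fun_add [simp, intro]: "f \<in> C \<Longrightarrow> g \<in> C \<Longrightarrow> (\<lambda>q. f q + g q) \<in> C"
  by (rule smooth_funI) (intro smooth_on_add chart_open_image smooth_funD)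

lemma smooth_fun_diff [simp, intro]: "f \<in> C \<Longrightarrow> g \<in> C \<Longrightarrow> (\<lambda>q. f q - g q) \<in> C"
  by (rule smooth_funI) (intro smooth_on_diff chart_open_image smooth_funD)

lemma smooth_fun_mult [simp, intro]: "f \<in> C \<Longrightarrow> g \<in> C \<Longrightarrow> (\<lambda>q. f q * g q) \<in> C"
  by (rule smooth_funI) (intro smooth_on_mult chart_open_image smooth_funD)

lemma smooth_fun_uminus [simp, intro]: "f \<in> C \<Longrightarrow> (\<lambda>q. - f q) \<in> C"
  using smooth_fun_diff[OF smooth_fun_const[of 0]] by simp

lemma smooth_fun_power [simp, intro]: "f \<in> C \<Longrightarrow> (\<lambda>q. f q ^ n) \<in> C"
  by (induction n) auto

lemma smooth_fun_sum [simp, intro]: "(\<And>i. i \<in> I \<Longrightarrow> f i \<in> C) \<Longrightarrow> (\<lambda>q. \<Sum>i\<in>I. f i q) \<in> C"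
  by (induction I rule: infinite_finite_induct) auto

text \<open>A function given in one chart and supported in a closed set inside that chart is smooth on the whole
manifold: near points of \<open>K\<close> it is read in the given chart by a transition map, and off \<open>K\<close> it is 0.\<close>
lemma smooth_fun_glue:
  assumes U: "(U, \<kappa>) \<in> A" and V: "open V" "V \<subseteq> \<kappa> ` U" and K: "closed K" "K \<subseteq> U" "\<kappa> ` K \<subseteq> V"
    and G: "smooth_on V G" and HG: "\<And>q. q \<in> U \<Longrightarrow> \<kappa> q \<in> V \<Longrightarrow> H q = G (\<kappa> q)"
    and H0: "\<And>q. q \<notin> K \<Longrightarrow> H q = 0"
  shows "H \<in> C"
proof (rule smooth_funI, rule smooth_on_local)
  fix W \<psi> y assume W: "(W, \<psi>) \<in> A" and "y \<in> \<psi> ` W"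
  then obtain q where q: "q \<in> W" "y = \<psi> q" by blast
  show "\<exists>T. open T \<and> y \<in> T \<and> smooth_on T (\<lambda>y. H (inv_into W \<psi> y))"
  proof (cases "q \<in> K")
    case True
    let ?O = "{q \<in> U. \<kappa> q \<in> V}"
    let ?T = "\<psi> ` (W \<inter> ?O)"
    have T: "open ?T"
      by (rule chart_open_map[OF W chart_open_preimage[OF U V(1)]])
    have "smooth_on ?T (\<lambda>y. \<kappa> (inv_into W \<psi> y))"
      by (rule smooth_on_subset[OF transition_smooth[OF U W]]) auto
    then have "smooth_on ?T (\<lambda>y. G (\<kappa> (inv_into W \<psi> y)))"
      by (rule smooth_on_compose[OF T G]) (auto simp: chart_inv[OF W])
    then have "smooth_on ?T (\<lambda>y. H (inv_into W \<psi> y))"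
      by (rule smooth_on_cong[OF T, rotated]) (auto simp: chart_inv[OF W] HG)
    moreover have "y \<in> ?T" using True q K by auto
    ultimately show ?thesis using T by blast
  next
    case False
    let ?T = "\<psi> ` (W \<inter> - K)"
    have T: "open ?T" using K(1) by (intro chart_open_map[OF W]) auto
    have "smooth_on ?T (\<lambda>y. H (inv_into W \<psi> y))"
      by (rule smooth_on_cong[OF T _ smooth_on_const[of _ 0]]) (auto simp: chart_inv[OF W] H0)
    moreover have "y \<in> ?T" using False q by auto
    ultimately show ?thesis using T by blast
  qed
qed

lemma smooth_fun_continuous:
  assumes "f \<in> C" shows "continuous_on UNIV f"
proof -
  have "isCont f p" for p
  proof -
    obtain U \<kappa> where U: "(U, \<kappa>) \<in> A" "p \<in> U" using chart_exists by blast
    have "continuous_on U (\<lambda>q. f (inv_into U \<kappa> (\<kappa> q)))"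
      by (rule continuous_on_compose2[OF smooth_on_continuous_on[OF smooth_funD[OF assms U(1)]] chart_continuous[OF U(1)]]) auto
    then have "continuous_on U f"
      by (rule continuous_on_eq) (simp add: chart_inv[OF U(1)])
    then show ?thesis using U(2) chart_open[OF U(1)] by (simp add: continuous_on_eq_continuous_at)
  qed
  then show ?thesis by (simp add: continuous_at_imp_continuous_on)
qed

text \<open>Smoothness is local, and smooth functions without zeros have smooth inverses. This replaces the use of
partitions of unity below: expansions in a local frame only hold after multiplication by a cut-off.\<close>
lemma smooth_fun_local_division:
  assumes "\<And>p. \<exists>h\<in>C. h p \<noteq> 0 \<and> (\<lambda>q. h q * F q) \<in> C"
  shows "F \<in> C"
proof (rule smooth_funI, rule smooth_on_local)
  fix W \<psi> y assume W: "(W, \<psi>) \<in> A" and "y \<in> \<psi> ` W"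
  then obtain p where p: "p \<in> W" "y = \<psi> p" by blast
  obtain h where h: "h \<in> C" "h p \<noteq> 0" "(\<lambda>q. h q * F q) \<in> C" using assms by blast
  let ?O = "{q. h q \<noteq> 0}"
  let ?T = "\<psi> ` (W \<inter> ?O)"
  have "open ?O"
    using smooth_fun_continuous[OF h(1)] by (intro open_Collect_neq) auto
  then have T: "open ?T" by (rule chart_open_map[OF W])
  have s: "smooth_on ?T (\<lambda>y. g (inv_into W \<psi> y))" if "g \<in> C" for g
    by (rule smooth_on_subset[OF smooth_funD[OF that W]]) auto
  have "smooth_on ?T (\<lambda>y. inverse (h (inv_into W \<psi> y)))"
    by (rule smooth_on_compose[OF T smooth_on_inverse s[OF h(1)]]) (auto simp: chart_inv[OF W])
  then have "smooth_on ?T (\<lambda>y. (h (inv_into W \<psi> y) * F (inv_into W \<psi> y)) * inverse (h (inv_into W \<psi> y)))"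
    by (rule smooth_on_mult[OF T s[OF h(3)]])
  then have "smooth_on ?T (\<lambda>y. F (inv_into W \<psi> y))"
    by (rule smooth_on_cong[OF T, rotated]) (auto simp: chart_inv[OF W])
  moreover have "y \<in> ?T" using p h(2) by auto
  ultimately show "\<exists>T. open T \<and> y \<in> T \<and> smooth_on T (\<lambda>y. F (inv_into W \<psi> y))"
    using T by blast
qed

text \<open>A chart together with a cut-off function \<open>h\<close>. The set \<open>V\<close> is a convex part of the coordinate
domain, for Hadamard's lemma; \<open>K\<close> is closed in the manifold and contains the support of \<open>h\<close>, for
extension by 0. With \<open>K\<close> closed rather than compact, the product of everything with the real line is a
cut-off again.\<close>
definition cutoff :: "'m set \<Rightarrow> ('m \<Rightarrow> 'e) \<Rightarrow> 'e set \<Rightarrow> 'm set \<Rightarrow> ('m \<Rightarrow> real) \<Rightarrow> bool" where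
  "cutoff U \<kappa> V K h \<longleftrightarrow> (U, \<kappa>) \<in> A \<and> open V \<and> convex V \<and> V \<subseteq> \<kappa> ` U \<and>
     closed K \<and> K \<subseteq> U \<and> \<kappa> ` K \<subseteq> V \<and> h \<in> C \<and> (\<forall>q. q \<notin> K \<longrightarrow> h q = 0)"

lemma cutoff_exists: "\<exists>U \<kappa> V K h. cutoff U \<kappa> V K h \<and> h p \<noteq> 0"
proof -
  obtain U \<kappa> where U: "(U, \<kappa>) \<in> A" "p \<in> U" using chart_exists by blast
  obtain r where r: "r > 0" "ball (\<kappa> p) r \<subseteq> \<kappa> ` U"
    using chart_open_image[OF U(1)] U(2) by (auto simp: open_contains_ball)
  define V where "V = ball (\<kappa> p) r"
  \<comment> \<open>half the radius, so that the support of the cut-off stays in the open ball \<open>V\<close>\<close>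
  define K where "K = inv_into U \<kappa> ` cball (\<kappa> p) (r / 2)"
  define h where "h = (\<lambda>q. if q \<in> U then flat_exp 0 ((r / 2)\<^sup>2 - (\<kappa> q - \<kappa> p) \<bullet> (\<kappa> q - \<kappa> p)) else 0)"
  have sub: "cball (\<kappa> p) (r / 2) \<subseteq> V" using r(1) by (auto simp: V_def)
  then have sub': "cball (\<kappa> p) (r / 2) \<subseteq> \<kappa> ` U" using r(2) by (auto simp: V_def)
  have "compact K" unfolding K_def
    by (intro compact_continuous_image continuous_on_subset[OF chart_inv_continuous[OF U(1)] sub']) simp
  then have K: "closed K" by (rule compact_imp_closed)
  have Keq: "K = {q \<in> U. dist (\<kappa> p) (\<kappa> q) \<le> r / 2}"
    using sub' chart_inv[OF U(1)] by (force simp: K_def image_iff subset_iff)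
  have h0: "h q = 0" if "q \<notin> K" for q
  proof (cases "q \<in> U")
    case True
    then have "r / 2 < norm (\<kappa> q - \<kappa> p)" using that by (auto simp: Keq dist_norm norm_minus_commute)
    then have "(r / 2)\<^sup>2 \<le> (norm (\<kappa> q - \<kappa> p))\<^sup>2" using r(1) by (intro power_mono) auto
    then show ?thesis by (simp add: h_def flat_exp_def dot_square_norm)
  qed (simp add: h_def)
  have V: "open V" "convex V" "V \<subseteq> \<kappa> ` U" using r by (auto simp: V_def)
  have inner: "smooth_on V (\<lambda>y. (y - \<kappa> p) \<bullet> (y - \<kappa> p))"
    by (subst euclidean_inner)
       (intro smooth_on_sum smooth_on_mult V smooth_on_bounded_linear[OF _ bounded_linear_inner_left]
          smooth_on_diff smooth_on_ident smooth_on_const)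
  have KU: "K \<subseteq> U" "\<kappa> ` K \<subseteq> V" using sub by (auto simp: Keq)
  have "smooth_on V (\<lambda>y. flat_exp 0 ((r / 2)\<^sup>2 - (y - \<kappa> p) \<bullet> (y - \<kappa> p)))"
    by (intro smooth_on_compose[OF _ smooth_on_flat_exp] smooth_on_diff smooth_on_const inner V) simp
  then have "h \<in> C"
    by (rule smooth_fun_glue[OF U(1) V(1,3) K KU]) (simp_all add: h0, simp add: h_def)
  moreover have "h p \<noteq> 0" using r(1) U(2) by (simp add: h_def flat_exp_def)
  ultimately have "cutoff U \<kappa> V K h \<and> h p \<noteq> 0"
    using U K KU V h0 by (simp add: cutoff_def)
  then show ?thesis by blast
qed

lemma cutoff_smooth:
  assumes "cutoff U \<kappa> V K h" "smooth_on V G"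
  shows "(\<lambda>q. h q * G (\<kappa> q)) \<in> C"
proof -
  have *: "(U, \<kappa>) \<in> A" "open V" "V \<subseteq> \<kappa> ` U" "closed K" "K \<subseteq> U" "\<kappa> ` K \<subseteq> V" "h \<in> C" "\<And>q. q \<notin> K \<Longrightarrow> h q = 0"
    using assms(1) by (auto simp: cutoff_def)
  show ?thesis
  proof (rule smooth_fun_glue[OF *(1-6)])
    show "smooth_on V (\<lambda>y. h (inv_into U \<kappa> y) * G y)"
      by (intro smooth_on_mult * assms(2) smooth_on_subset[OF smooth_funD[OF *(7,1)]])
  qed (auto simp: *(8) chart_inv[OF *(1)])
qed

lemma cutoff_coordinate: "cutoff U \<kappa> V K h \<Longrightarrow> (\<lambda>q. h q * (\<kappa> q \<bullet> b)) \<in> C"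
  by (rule cutoff_smooth) (auto intro!: smooth_on_bounded_linear[OF _ bounded_linear_inner_left] smooth_on_ident simp: cutoff_def)

end

section \<open>Tangent vectors, fields, forms and local frames\<close>

text \<open>A constant for scalar multiplication keeps rewrite rules for linear maps first-order.\<close>
definition scl :: "real \<Rightarrow> 'm tangent \<Rightarrow> 'm tangent" where
  "scl c v = (\<lambda>f. c * v f)"

lemma scl_simps [simp]: "scl 0 v = 0" "scl 1 v = v" "scl c 0 = 0" "scl (- 1) v = - v"
  by (simp_all add: scl_def fun_eq_iff)

lemma sum_fun_apply: "(\<Sum>i\<in>I. f i) x = (\<Sum>i\<in>I. f i x)"
  by (induction I rule: infinite_finite_induct) auto

context smooth_manifold
begin

abbreviation "TS \<equiv> tangent_space A"
abbreviation "VF \<equiv> vector_fields A"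

lemma
  assumes "v \<in> TS p"
  shows tangent_add: "f \<in> C \<Longrightarrow> g \<in> C \<Longrightarrow> v (\<lambda>q. f q + g q) = v f + v g"
    and tangent_cmult: "f \<in> C \<Longrightarrow> v (\<lambda>q. c * f q) = c * v f"
    and tangent_mult: "f \<in> C \<Longrightarrow> g \<in> C \<Longrightarrow> v (\<lambda>q. f q * g q) = f p * v g + g p * v f"
    and tangent_nonsmooth: "f \<notin> C \<Longrightarrow> v f = 0"
  using assms by (auto simp: tangent_space_def plus_fun_def times_fun_def)

lemma tangentI:
  assumes "\<And>f g. f \<in> C \<Longrightarrow> g \<in> C \<Longrightarrow> v (\<lambda>q. f q + g q) = v f + v g"
    and "\<And>c f. f \<in> C \<Longrightarrow> v (\<lambda>q. c * f q) = c * v f"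
    and "\<And>f g. f \<in> C \<Longrightarrow> g \<in> C \<Longrightarrow> v (\<lambda>q. f q * g q) = f p * v g + g p * v f"
    and "\<And>f. f \<notin> C \<Longrightarrow> v f = 0"
  shows "v \<in> TS p"
  using assms by (auto simp: tangent_space_def plus_fun_def times_fun_def)

lemma tangent_const: "v \<in> TS p \<Longrightarrow> v (\<lambda>q. c) = 0"
  using tangent_mult[of v p "\<lambda>q. 1" "\<lambda>q. 1"] tangent_cmult[of v p "\<lambda>q. 1" c] by simp

lemma tangent_diff: "v \<in> TS p \<Longrightarrow> f \<in> C \<Longrightarrow> g \<in> C \<Longrightarrow> v (\<lambda>q. f q - g q) = v f - v g"
  using tangent_add[of v p "\<lambda>q. f q - g q" g] by simp

lemma tangent_sum:
  assumes "v \<in> TS p" "\<And>i. i \<in> I \<Longrightarrow> f i \<in> C"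
  shows "v (\<lambda>q. \<Sum>i\<in>I. f i q) = (\<Sum>i\<in>I. v (f i))"
  using assms(2)
  by (induction I rule: infinite_finite_induct) (simp_all add: tangent_const[OF assms(1)] tangent_add[OF assms(1)])

lemma tangent_plus [simp]: "v \<in> TS p \<Longrightarrow> w \<in> TS p \<Longrightarrow> v + w \<in> TS p"
  by (rule tangentI) (auto simp: tangent_add tangent_cmult tangent_mult tangent_nonsmooth algebra_simps)

lemma tangent_scl [simp]: "v \<in> TS p \<Longrightarrow> scl c v \<in> TS p"
  by (rule tangentI) (auto simp: scl_def tangent_add tangent_cmult tangent_mult tangent_nonsmooth algebra_simps)

lemma tangent_zero [simp]: "0 \<in> TS p"
  by (rule tangentI) auto

lemma tangent_minus [simp]: "v \<in> TS p \<Longrightarrow> w \<in> TS p \<Longrightarrow> v - w \<in> TS p"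
proof -
  assume "v \<in> TS p" "w \<in> TS p"
  then have "v + scl (-1) w \<in> TS p" by (intro tangent_plus tangent_scl)
  then show "v - w \<in> TS p" by simp
qed

lemma tangent_uminus [simp]: "v \<in> TS p \<Longrightarrow> - v \<in> TS p"
  using tangent_minus[of 0 p v] by simp

lemma tangent_Sum [simp]: "(\<And>i. i \<in> I \<Longrightarrow> v i \<in> TS p) \<Longrightarrow> (\<Sum>i\<in>I. v i) \<in> TS p"
  by (induction I rule: infinite_finite_induct) auto

lemma fieldI:
  "(\<And>p. X p \<in> TS p) \<Longrightarrow> (\<And>f. f \<in> C \<Longrightarrow> (\<lambda>p. X p f) \<in> C) \<Longrightarrow> X \<in> VF"
  by (simp add: vector_fields_def)

lemma field_tangent [simp]: "X \<in> VF \<Longrightarrow> X p \<in> TS p"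
  by (simp add: vector_fields_def)

lemma field_smooth: "X \<in> VF \<Longrightarrow> f \<in> C \<Longrightarrow> (\<lambda>p. X p f) \<in> C"
  unfolding vector_fields_def by blast

lemma field_plus [simp]: "X \<in> VF \<Longrightarrow> Y \<in> VF \<Longrightarrow> (\<lambda>p. X p + Y p) \<in> VF"
  by (rule fieldI) (simp_all add: field_smooth)

lemma field_minus [simp]: "X \<in> VF \<Longrightarrow> Y \<in> VF \<Longrightarrow> (\<lambda>p. X p - Y p) \<in> VF"
  by (rule fieldI) (simp_all add: field_smooth)

lemma field_scl [simp]: "a \<in> C \<Longrightarrow> X \<in> VF \<Longrightarrow> (\<lambda>p. scl (a p) (X p)) \<in> VF"
  by (rule fieldI) (simp, simp add: scl_def field_smooth)

lemma field_zero [simp]: "(\<lambda>p. 0) \<in> VF"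
  by (rule fieldI) auto

lemma field_Sum [simp]: "(\<And>i. i \<in> I \<Longrightarrow> X i \<in> VF) \<Longrightarrow> (\<lambda>p. \<Sum>i\<in>I. X i p) \<in> VF"
  by (induction I rule: infinite_finite_induct) auto

lemma lie_bracket_field [simp]:
  assumes "X \<in> VF" "Y \<in> VF"
  shows "lie_bracket X Y \<in> VF"
proof (rule fieldI)
  note X = field_tangent[OF assms(1)] note Y = field_tangent[OF assms(2)]
  fix p show "lie_bracket X Y p \<in> TS p"
    using assms
    by (intro tangentI)
      (simp_all add: lie_bracket_def tangent_add[OF X] tangent_add[OF Y] tangent_cmult[OF X] tangent_cmult[OF Y]
        tangent_mult[OF X] tangent_mult[OF Y] tangent_nonsmooth[OF X] tangent_nonsmooth[OF Y]
        tangent_const[OF X] tangent_const[OF Y] field_smooth[OF assms(1)] field_smooth[OF assms(2)] algebra_simps)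
qed (use assms in \<open>simp add: lie_bracket_def field_smooth\<close>)

lemma lie_bracket_swap: "lie_bracket X Y p = - lie_bracket Y X p"
  by (simp add: lie_bracket_def fun_eq_iff)

lemma lie_bracket_plus_left:
  assumes "X \<in> VF" "Y \<in> VF" "Z \<in> VF"
  shows "lie_bracket (\<lambda>q. X q + Y q) Z p = lie_bracket X Z p + lie_bracket Y Z p"
proof
  fix f show "lie_bracket (\<lambda>q. X q + Y q) Z p f = (lie_bracket X Z p + lie_bracket Y Z p) f"
    using assms
    by (cases "f \<in> C") (simp_all add: lie_bracket_def tangent_add[OF field_tangent[OF assms(3)]] field_smooth
        tangent_nonsmooth[OF field_tangent] tangent_const[OF field_tangent])
qed

lemma lie_bracket_scl_left:
  assumes "a \<in> C" "X \<in> VF" "Z \<in> VF"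
  shows "lie_bracket (\<lambda>q. scl (a q) (X q)) Z p = scl (a p) (lie_bracket X Z p) - scl (Z p a) (X p)"
proof
  fix f show "lie_bracket (\<lambda>q. scl (a q) (X q)) Z p f = (scl (a p) (lie_bracket X Z p) - scl (Z p a) (X p)) f"
    using assms
    by (cases "f \<in> C") (simp_all add: lie_bracket_def scl_def field_smooth tangent_mult[OF field_tangent[OF assms(3)]]
        tangent_nonsmooth[OF field_tangent] tangent_const[OF field_tangent] algebra_simps)
qed

lemma lie_bracket_plus_right:
  assumes "X \<in> VF" "Y \<in> VF" "Z \<in> VF"
  shows "lie_bracket Z (\<lambda>q. X q + Y q) p = lie_bracket Z X p + lie_bracket Z Y p"
  using lie_bracket_plus_left[OF assms] by (simp add: lie_bracket_swap[of Z])

lemma lie_bracket_scl_right: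
  assumes "a \<in> C" "X \<in> VF" "Z \<in> VF"
  shows "lie_bracket Z (\<lambda>q. scl (a q) (X q)) p = scl (a p) (lie_bracket Z X p) + scl (Z p a) (X p)"
  using lie_bracket_scl_left[OF assms] by (simp add: lie_bracket_swap[of Z] fun_eq_iff scl_def)

lemma
  assumes "\<alpha> \<in> one_forms A"
  shows form_plus: "v \<in> TS p \<Longrightarrow> w \<in> TS p \<Longrightarrow> \<alpha> p (v + w) = \<alpha> p v + \<alpha> p w"
    and form_scl: "v \<in> TS p \<Longrightarrow> \<alpha> p (scl c v) = c * \<alpha> p v"
    and form_smooth: "X \<in> VF \<Longrightarrow> (\<lambda>p. \<alpha> p (X p)) \<in> C"
  using assms by (auto simp: one_forms_def scl_def)

lemma formI:
  assumes "\<And>p v w. v \<in> TS p \<Longrightarrow> w \<in> TS p \<Longrightarrow> \<alpha> p (v + w) = \<alpha> p v + \<alpha> p w"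
    and "\<And>p c v. v \<in> TS p \<Longrightarrow> \<alpha> p (scl c v) = c * \<alpha> p v"
    and "\<And>X. X \<in> VF \<Longrightarrow> (\<lambda>p. \<alpha> p (X p)) \<in> C"
  shows "\<alpha> \<in> one_forms A"
  using assms by (auto simp: one_forms_def scl_def)

lemma form_zero: "\<alpha> \<in> one_forms A \<Longrightarrow> \<alpha> p 0 = 0"
  using form_scl[of \<alpha> 0 p 0] by simp

lemma form_uminus: "\<alpha> \<in> one_forms A \<Longrightarrow> v \<in> TS p \<Longrightarrow> \<alpha> p (- v) = - \<alpha> p v"
  using form_plus[of \<alpha> v p "- v"] by (simp add: form_zero)

lemma form_minus: "\<alpha> \<in> one_forms A \<Longrightarrow> v \<in> TS p \<Longrightarrow> w \<in> TS p \<Longrightarrow> \<alpha> p (v - w) = \<alpha> p v - \<alpha> p w"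
  using form_plus[of \<alpha> v p "- w"] by (simp add: form_uminus)

lemma form_Sum:
  "\<alpha> \<in> one_forms A \<Longrightarrow> (\<And>i. i \<in> I \<Longrightarrow> v i \<in> TS p) \<Longrightarrow> \<alpha> p (\<Sum>i\<in>I. v i) = (\<Sum>i\<in>I. \<alpha> p (v i))"
  by (induction I rule: infinite_finite_induct) (auto simp: form_zero form_plus)

lemma
  assumes "\<phi> \<in> endo_fields A"
  shows endo_tangent: "v \<in> TS p \<Longrightarrow> \<phi> p v \<in> TS p"
    and endo_plus: "v \<in> TS p \<Longrightarrow> w \<in> TS p \<Longrightarrow> \<phi> p (v + w) = \<phi> p v + \<phi> p w"
    and endo_scl: "v \<in> TS p \<Longrightarrow> \<phi> p (scl c v) = scl c (\<phi> p v)"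
    and endo_field: "X \<in> VF \<Longrightarrow> (\<lambda>p. \<phi> p (X p)) \<in> VF"
  using assms by (auto simp: endo_fields_def scl_def)

lemma endoI:
  assumes "\<And>p v. v \<in> TS p \<Longrightarrow> \<phi> p v \<in> TS p"
    and "\<And>p v w. v \<in> TS p \<Longrightarrow> w \<in> TS p \<Longrightarrow> \<phi> p (v + w) = \<phi> p v + \<phi> p w"
    and "\<And>p c v. v \<in> TS p \<Longrightarrow> \<phi> p (scl c v) = scl c (\<phi> p v)"
    and "\<And>X. X \<in> VF \<Longrightarrow> (\<lambda>p. \<phi> p (X p)) \<in> VF"
  shows "\<phi> \<in> endo_fields A"
  using assms by (auto simp: endo_fields_def scl_def)

lemma endo_zero: "\<phi> \<in> endo_fields A \<Longrightarrow> \<phi> p 0 = 0"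
  using endo_scl[of \<phi> 0 p 0] by simp

lemma endo_uminus: "\<phi> \<in> endo_fields A \<Longrightarrow> v \<in> TS p \<Longrightarrow> \<phi> p (- v) = - \<phi> p v"
  using endo_scl[of \<phi> v p "-1"] by simp

lemma endo_minus: "\<phi> \<in> endo_fields A \<Longrightarrow> v \<in> TS p \<Longrightarrow> w \<in> TS p \<Longrightarrow> \<phi> p (v - w) = \<phi> p v - \<phi> p w"
  using endo_plus[of \<phi> v p "- w"] by (simp add: endo_uminus fun_eq_iff)

lemma endo_Sum:
  "\<phi> \<in> endo_fields A \<Longrightarrow> (\<And>i. i \<in> I \<Longrightarrow> v i \<in> TS p) \<Longrightarrow> \<phi> p (\<Sum>i\<in>I. v i) = (\<Sum>i\<in>I. \<phi> p (v i))"
  by (induction I rule: infinite_finite_induct) (auto simp: endo_zero endo_plus)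

text \<open>A coordinate derivative, made into a global vector field by the cut-off \<open>h\<close>.\<close>
definition cutoff_partial :: "'m set \<Rightarrow> ('m \<Rightarrow> 'e) \<Rightarrow> ('m \<Rightarrow> real) \<Rightarrow> 'e \<Rightarrow> 'm \<Rightarrow> 'm tangent" where
  "cutoff_partial U \<kappa> h b = (\<lambda>q f. if f \<in> C
     then h q * frechet_derivative (\<lambda>y. f (inv_into U \<kappa> y)) (at (\<kappa> q)) b else 0)"

lemma cutoff_partial_field:
  assumes cut: "cutoff U \<kappa> V K h"
  shows "cutoff_partial U \<kappa> h b \<in> VF"
proof (rule fieldI)
  have U: "(U, \<kappa>) \<in> A" and K: "K \<subseteq> U" and h0: "\<And>q. q \<notin> K \<Longrightarrow> h q = 0"
    using cut by (auto simp: cutoff_def)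
  fix p show "cutoff_partial U \<kappa> h b p \<in> TS p"
  proof (cases "p \<in> K")
    case False
    then have "cutoff_partial U \<kappa> h b p = 0" by (simp add: cutoff_partial_def fun_eq_iff h0)
    then show ?thesis by simp
  next
    case True
    then have p: "p \<in> U" using K by auto
    have d: "((\<lambda>y. f (inv_into U \<kappa> y)) has_derivative frechet_derivative (\<lambda>y. f (inv_into U \<kappa> y)) (at (\<kappa> p))) (at (\<kappa> p))"
      if "f \<in> C" for f
      using smooth_on_differentiable[OF smooth_funD[OF that U]] p by (simp add: frechet_derivative_works)
    show ?thesis
      by (rule tangentI)
        (simp_all add: cutoff_partial_def frechet_derivative_at[OF has_derivative_add[OF d d], symmetric]
          frechet_derivative_at[OF has_derivative_mult_right[OF d], symmetric]
          frechet_derivative_at[OF has_derivative_mult[OF d d], symmetric] chart_inv[OF U p] algebra_simps)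
  qed
next
  have U: "(U, \<kappa>) \<in> A" and V: "V \<subseteq> \<kappa> ` U"
    using cut by (auto simp: cutoff_def)
  fix f assume f: "f \<in> C"
  show "(\<lambda>q. cutoff_partial U \<kappa> h b q f) \<in> C"
    using cutoff_smooth[OF cut smooth_on_frechet_derivative[OF smooth_on_subset[OF smooth_funD[OF f U] V]]] f
    by (simp add: cutoff_partial_def)
qed

text \<open>Hadamard's lemma centred at \<open>q\<close> writes \<open>f - f q\<close> as a sum of products
whose first factor vanishes at \<open>q\<close>. Each factor is multiplied by \<open>h\<close>, so that it becomes a global smooth
function to which the derivation \<open>v\<close> can be applied by the product rule.\<close>
lemma cutoff_expansion:
  assumes cut: "cutoff U \<kappa> V K h" and v: "v \<in> TS q" and f: "f \<in> C"
  shows "h q ^ 2 * v f = (\<Sum>b\<in>Basis. (v (\<lambda>x. h x * (\<kappa> x \<bullet> b)) - (\<kappa> q \<bullet> b) * v h) * cutoff_partial U \<kappa> h b q f)"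
proof (cases "q \<in> K")
  case False
  then have "h q = 0" using cut by (simp add: cutoff_def)
  then show ?thesis using f by (simp add: cutoff_partial_def)
next
  case True
  have U: "(U, \<kappa>) \<in> A" and V: "open V" "convex V" "V \<subseteq> \<kappa> ` U" and K: "K \<subseteq> U" "\<kappa> ` K \<subseteq> V"
    and h: "h \<in> C" and h0: "\<And>q. q \<notin> K \<Longrightarrow> h q = 0"
    using cut by (auto simp: cutoff_def)
  have q: "q \<in> U" "\<kappa> q \<in> V" using True K by auto
  obtain g where g: "\<And>b. smooth_on V (g b)"
    "\<And>x. x \<in> V \<Longrightarrow> f (inv_into U \<kappa> x) = f (inv_into U \<kappa> (\<kappa> q)) + (\<Sum>b\<in>Basis. ((x - \<kappa> q) \<bullet> b) * g b x)"
    "\<And>b. g b (\<kappa> q) = frechet_derivative (\<lambda>y. f (inv_into U \<kappa> y)) (at (\<kappa> q)) b"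
    by (rule hadamard[OF V(1,2) q(2) smooth_on_subset[OF smooth_funD[OF f U] V(3)]]) blast
  have G: "(\<lambda>x. h x * g b (\<kappa> x)) \<in> C" for b
    by (rule cutoff_smooth[OF cut g(1)])
  have c: "(\<lambda>x. h x * (\<kappa> x \<bullet> b)) \<in> C" for b
    by (rule cutoff_coordinate[OF cut])
  have "(\<lambda>x. h x * h x * f x) =
    (\<lambda>x. f q * (h x * h x) + (\<Sum>b\<in>Basis. (h x * (\<kappa> x \<bullet> b) - (\<kappa> q \<bullet> b) * h x) * (h x * g b (\<kappa> x))))"
  proof
    fix x
    show "h x * h x * f x =
      f q * (h x * h x) + (\<Sum>b\<in>Basis. (h x * (\<kappa> x \<bullet> b) - (\<kappa> q \<bullet> b) * h x) * (h x * g b (\<kappa> x)))"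
    proof (cases "x \<in> K")
      case True
      then have "x \<in> U" "\<kappa> x \<in> V" using K by auto
      then have "f x = f q + (\<Sum>b\<in>Basis. ((\<kappa> x - \<kappa> q) \<bullet> b) * g b (\<kappa> x))"
        using g(2)[of "\<kappa> x"] q(1) by (simp add: chart_inv[OF U])
      then show ?thesis
        by (simp add: distrib_left sum_distrib_left inner_diff_left algebra_simps)
    qed (simp add: h0)
  qed
  then have "v (\<lambda>x. h x * h x * f x) =
    v (\<lambda>x. f q * (h x * h x) + (\<Sum>b\<in>Basis. (h x * (\<kappa> x \<bullet> b) - (\<kappa> q \<bullet> b) * h x) * (h x * g b (\<kappa> x))))"
    by simp
  moreover have "v (\<lambda>x. h x * h x * f x) = h q * h q * v f + f q * v (\<lambda>x. h x * h x)"
    using tangent_mult[OF v smooth_fun_mult[OF h h] f] by simp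
  moreover have "v (\<lambda>x. f q * (h x * h x) + (\<Sum>b\<in>Basis. (h x * (\<kappa> x \<bullet> b) - (\<kappa> q \<bullet> b) * h x) * (h x * g b (\<kappa> x)))) =
     f q * v (\<lambda>x. h x * h x) + (\<Sum>b\<in>Basis. v (\<lambda>x. (h x * (\<kappa> x \<bullet> b) - (\<kappa> q \<bullet> b) * h x) * (h x * g b (\<kappa> x))))"
    using h c G
    by (subst tangent_add[OF v]) (auto simp: tangent_cmult[OF v] tangent_sum[OF v])
  moreover have "v (\<lambda>x. (h x * (\<kappa> x \<bullet> b) - (\<kappa> q \<bullet> b) * h x) * (h x * g b (\<kappa> x))) =
     (v (\<lambda>x. h x * (\<kappa> x \<bullet> b)) - (\<kappa> q \<bullet> b) * v h) * cutoff_partial U \<kappa> h b q f" for b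
    using h c G f
    by (subst tangent_mult[OF v]) (auto simp: tangent_diff[OF v] tangent_cmult[OF v] g(3) cutoff_partial_def)
  ultimately show ?thesis
    by (simp add: power2_eq_square)
qed

text \<open>One more factor \<open>h\<close> than in the preceding expansion: the coordinate \<open>\<kappa> q \<bullet> b\<close> is only locally
defined, but \<open>h q * (\<kappa> q \<bullet> b)\<close> is a global smooth function of \<open>q\<close>, so that for a smooth field the
coefficients are smooth.\<close>
lemma frame_expansion:
  assumes cut: "cutoff U \<kappa> V K h" and v: "v \<in> TS q"
  shows "scl (h q ^ 3) v = (\<Sum>b\<in>Basis. scl (h q * v (\<lambda>x. h x * (\<kappa> x \<bullet> b)) - h q * (\<kappa> q \<bullet> b) * v h) (cutoff_partial U \<kappa> h b q))"
proof
  fix f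
  have "h q ^ 3 * v f = h q * (\<Sum>b\<in>Basis. (v (\<lambda>x. h x * (\<kappa> x \<bullet> b)) - (\<kappa> q \<bullet> b) * v h) * cutoff_partial U \<kappa> h b q f)"
  proof (cases "f \<in> C")
    case True
    then show ?thesis using cutoff_expansion[OF cut v True] by (simp add: power3_eq_cube power2_eq_square)
  qed (simp add: tangent_nonsmooth[OF v] cutoff_partial_def)
  also have "\<dots> = (\<Sum>b\<in>Basis. scl (h q * v (\<lambda>x. h x * (\<kappa> x \<bullet> b)) - h q * (\<kappa> q \<bullet> b) * v h) (cutoff_partial U \<kappa> h b q)) f"
    by (simp add: sum_distrib_left sum_fun_apply scl_def algebra_simps)
  finally show "scl (h q ^ 3) v f = \<dots>" by (simp add: scl_def)
qed

text \<open>By the frame expansion with the coefficients frozen at \<open>p\<close>.\<close>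
lemma field_through:
  assumes "v \<in> TS p"
  obtains Z where "Z \<in> VF" "Z p = v"
proof -
  obtain U \<kappa> V K h where cut: "cutoff U \<kappa> V K h" and hp: "h p \<noteq> 0" using cutoff_exists by blast
  define a where "a = (\<lambda>b. (h p * v (\<lambda>x. h x * (\<kappa> x \<bullet> b)) - h p * (\<kappa> p \<bullet> b) * v h))"
  define Z where "Z = (\<lambda>q. scl (inverse (h p ^ 3)) (\<Sum>b\<in>Basis. scl (a b) (cutoff_partial U \<kappa> h b q)))"
  have "Z p = scl (inverse (h p ^ 3)) (scl (h p ^ 3) v)"
    unfolding Z_def a_def by (simp add: frame_expansion[OF cut assms])
  also have "\<dots> = v" using hp by (simp add: scl_def fun_eq_iff)
  finally have "Z p = v" .
  moreover have "Z \<in> VF"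
    unfolding Z_def using cutoff_partial_field[OF cut]
    by (intro field_scl field_Sum smooth_fun_const)
  ultimately show ?thesis by (rule that[rotated])
qed

text \<open>Multiply \<open>Y\<close> by \<open>h ^ 3\<close> and expand it in the frame: the result depends on \<open>Y\<close> only through the
coefficients at \<open>p\<close>.\<close>
lemma tensor_pointwise:
  fixes \<tau> :: "('m \<Rightarrow> 'm tangent) \<Rightarrow> real"
  assumes add: "\<And>Y Z. Y \<in> VF \<Longrightarrow> Z \<in> VF \<Longrightarrow> \<tau> (\<lambda>q. Y q + Z q) = \<tau> Y + \<tau> Z"
    and scale: "\<And>a Y. a \<in> C \<Longrightarrow> Y \<in> VF \<Longrightarrow> \<tau> (\<lambda>q. scl (a q) (Y q)) = a p * \<tau> Y"
    and Y: "Y \<in> VF" and Z: "Z \<in> VF" and eq: "Y p = Z p"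
  shows "\<tau> Y = \<tau> Z"
proof -
  obtain U \<kappa> V K h where cut: "cutoff U \<kappa> V K h" and hp: "h p \<noteq> 0" using cutoff_exists by blast
  then have h: "h \<in> C" by (simp add: cutoff_def)
  have zero: "\<tau> (\<lambda>q. 0) = 0" using scale[of "\<lambda>q. 0" "\<lambda>q. 0"] by simp
  have Sum: "\<tau> (\<lambda>q. \<Sum>b\<in>I. X b q) = (\<Sum>b\<in>I. \<tau> (X b))" if "\<And>b. X b \<in> VF" for X :: "'e \<Rightarrow> _" and I
    using that by (induction I rule: infinite_finite_induct) (auto simp: zero add)
  note E = cutoff_partial_field[OF cut] note c = cutoff_coordinate[OF cut]
  have "h p ^ 3 * \<tau> X = (\<Sum>b\<in>Basis. (h p * X p (\<lambda>x. h x * (\<kappa> x \<bullet> b)) - h p * (\<kappa> p \<bullet> b) * X p h) * \<tau> (cutoff_partial U \<kappa> h b))"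
    if X: "X \<in> VF" for X
  proof -
    have a: "(\<lambda>q. h q * X q (\<lambda>x. h x * (\<kappa> x \<bullet> b)) - h q * (\<kappa> q \<bullet> b) * X q h) \<in> C" for b
      by (intro smooth_fun_diff smooth_fun_mult field_smooth[OF X] h c)
    have "h p ^ 3 * \<tau> X = \<tau> (\<lambda>q. scl (h q ^ 3) (X q))"
      using scale[of "\<lambda>q. h q ^ 3" X] h X by simp
    also have "(\<lambda>q. scl (h q ^ 3) (X q)) = (\<lambda>q. \<Sum>b\<in>Basis.
       scl (h q * X q (\<lambda>x. h x * (\<kappa> x \<bullet> b)) - h q * (\<kappa> q \<bullet> b) * X q h) (cutoff_partial U \<kappa> h b q))"
      using frame_expansion[OF cut field_tangent[OF X]] by simp
    also have "\<tau> \<dots> = (\<Sum>b\<in>Basis. \<tau> (\<lambda>q. scl (h q * X q (\<lambda>x. h x * (\<kappa> x \<bullet> b)) - h q * (\<kappa> q \<bullet> b) * X q h) (cutoff_partial U \<kappa> h b q)))"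
      by (rule Sum) (rule field_scl[OF a E])
    finally show ?thesis by (simp add: scale[OF a E])
  qed
  from this[OF Y] this[OF Z] eq have "h p ^ 3 * \<tau> Y = h p ^ 3 * \<tau> Z" by simp
  then show ?thesis using hp by simp
qed

text \<open>The expression on the right is tensorial in \<open>Z\<close>, so it depends on \<open>Z p\<close> alone and the definite
description that defines the Lie derivative denotes it.\<close>
lemma lie_deriv_eval:
  assumes X: "X \<in> VF" and \<gamma>: "\<gamma> \<in> one_forms A" and Z: "Z \<in> VF"
  shows "lie_deriv A X \<gamma> p (Z p) = X p (\<lambda>q. \<gamma> q (Z q)) - \<gamma> p (lie_bracket X Z p)"
proof -
  define \<tau> where "\<tau> = (\<lambda>Z. X p (\<lambda>q. \<gamma> q (Z q)) - \<gamma> p (lie_bracket X Z p))"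
  note simps = form_plus[OF \<gamma>] form_scl[OF \<gamma>] form_smooth[OF \<gamma>] tangent_add[OF field_tangent[OF X]] tangent_mult[OF field_tangent[OF X]]
  have indep: "\<tau> Z' = \<tau> Z" if "Z' \<in> VF" "Z' p = Z p" for Z'
  proof (rule tensor_pointwise[where p = p and \<tau> = \<tau> and Y = Z' and Z = Z])
    show "\<tau> (\<lambda>q. Y q + Z q) = \<tau> Y + \<tau> Z" if "Y \<in> VF" "Z \<in> VF" for Y Z
      using that X by (simp add: \<tau>_def simps lie_bracket_plus_right)
    show "\<tau> (\<lambda>q. scl (a q) (Y q)) = a p * \<tau> Y" if "a \<in> C" "Y \<in> VF" for a Y
      using that X by (simp add: \<tau>_def simps lie_bracket_scl_right algebra_simps)
  qed (use that Z in auto)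
  have "(THE r. \<forall>Z'\<in>VF. Z' p = Z p \<longrightarrow> r = \<tau> Z') = \<tau> Z"
  proof (rule the_equality)
    show "\<forall>Z'\<in>VF. Z' p = Z p \<longrightarrow> \<tau> Z = \<tau> Z'" using indep by metis
    show "r = \<tau> Z" if "\<forall>Z'\<in>VF. Z' p = Z p \<longrightarrow> r = \<tau> Z'" for r
      using that Z by blast
  qed
  then show ?thesis by (simp add: lie_deriv_def \<tau>_def)
qed

end

section \<open>The Courant bracket on sections\<close>

text \<open>Derivative of functions along a field and pairing of forms with fields, as constants: identities between
them are then usable as rewrite rules, while \<open>X p f\<close> and \<open>\<alpha> p (X p)\<close> with variable heads are not.\<close>
definition dir :: "('m \<Rightarrow> 'm tangent) \<Rightarrow> ('m \<Rightarrow> real) \<Rightarrow> 'm \<Rightarrow> real" where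
  "dir X f = (\<lambda>p. X p f)"

definition ev :: "('m \<Rightarrow> 'm cotangent) \<Rightarrow> ('m \<Rightarrow> 'm tangent) \<Rightarrow> 'm \<Rightarrow> real" where
  "ev \<alpha> X = (\<lambda>p. \<alpha> p (X p))"

context smooth_manifold
begin

lemma dir_smooth [simp]: "X \<in> VF \<Longrightarrow> f \<in> C \<Longrightarrow> dir X f \<in> C"
  by (simp add: dir_def field_smooth)

lemma ev_smooth [simp]: "\<alpha> \<in> one_forms A \<Longrightarrow> X \<in> VF \<Longrightarrow> ev \<alpha> X \<in> C"
  by (simp add: ev_def form_smooth)

lemma
  assumes "X \<in> VF"
  shows dir_add: "f \<in> C \<Longrightarrow> g \<in> C \<Longrightarrow> dir X (\<lambda>q. f q + g q) p = dir X f p + dir X g p"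
    and dir_diff: "f \<in> C \<Longrightarrow> g \<in> C \<Longrightarrow> dir X (\<lambda>q. f q - g q) p = dir X f p - dir X g p"
    and dir_cmult: "f \<in> C \<Longrightarrow> dir X (\<lambda>q. c * f q) p = c * dir X f p"
    and dir_uminus: "f \<in> C \<Longrightarrow> dir X (\<lambda>q. - f q) p = - dir X f p"
    and dir_mult: "f \<in> C \<Longrightarrow> g \<in> C \<Longrightarrow> dir X (\<lambda>q. f q * g q) p = f p * dir X g p + g p * dir X f p"
    and dir_const: "dir X (\<lambda>q. c) p = 0"
  using tangent_add[OF field_tangent[OF assms], of f g p] tangent_diff[OF field_tangent[OF assms], of f g p]
    tangent_cmult[OF field_tangent[OF assms], of f p c] tangent_cmult[OF field_tangent[OF assms], of f p "-1"]
    tangent_mult[OF field_tangent[OF assms], of f g p] tangent_const[OF field_tangent[OF assms], of p c]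
  by (simp_all add: dir_def)

lemmas dir_simps = dir_add dir_diff dir_cmult dir_uminus dir_mult dir_const

lemma lie_deriv_form:
  assumes X: "X \<in> VF" and \<gamma>: "\<gamma> \<in> one_forms A"
  shows "lie_deriv A X \<gamma> \<in> one_forms A"
proof (rule formI)
  have e: "lie_deriv A X \<gamma> p (Z p) = dir X (ev \<gamma> Z) p - \<gamma> p (lie_bracket X Z p)" if "Z \<in> VF" for Z p
    using lie_deriv_eval[OF X \<gamma> that] by (simp add: dir_def ev_def)
  fix p v w assume "v \<in> TS p" "w \<in> TS p"
  then obtain V W where V: "V \<in> VF" "V p = v" and W: "W \<in> VF" "W p = w" using field_through by metis
  have "ev \<gamma> (\<lambda>q. V q + W q) = (\<lambda>q. ev \<gamma> V q + ev \<gamma> W q)"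
    using V W by (simp add: ev_def form_plus[OF \<gamma>])
  then show "lie_deriv A X \<gamma> p (v + w) = lie_deriv A X \<gamma> p v + lie_deriv A X \<gamma> p w"
    using e[of "\<lambda>q. V q + W q" p] e[OF V(1), of p] e[OF W(1), of p] V W X \<gamma>
    by (simp add: lie_bracket_plus_right form_plus dir_simps)
next
  have e: "lie_deriv A X \<gamma> p (Z p) = dir X (ev \<gamma> Z) p - \<gamma> p (lie_bracket X Z p)" if "Z \<in> VF" for Z p
    using lie_deriv_eval[OF X \<gamma> that] by (simp add: dir_def ev_def)
  fix p c v assume "v \<in> TS p"
  then obtain V where V: "V \<in> VF" "V p = v" using field_through by metis
  have "ev \<gamma> (\<lambda>q. scl c (V q)) = (\<lambda>q. c * ev \<gamma> V q)"
    using V by (simp add: ev_def form_scl[OF \<gamma>])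
  then show "lie_deriv A X \<gamma> p (scl c v) = c * lie_deriv A X \<gamma> p v"
    using e[of "\<lambda>q. scl c (V q)" p] e[OF V(1), of p] V X \<gamma>
      lie_bracket_scl_right[of "\<lambda>q. c" V X p] tangent_const[OF field_tangent[OF X], of p c]
    by (simp add: form_scl dir_simps right_diff_distrib)
next
  fix Z assume Z: "Z \<in> VF"
  show "(\<lambda>p. lie_deriv A X \<gamma> p (Z p)) \<in> C"
    unfolding lie_deriv_eval[OF X \<gamma> Z]
    by (intro smooth_fun_diff field_smooth[OF X] form_smooth[OF \<gamma>] Z lie_bracket_field X)
qed

text \<open>The form part of the Courant bracket of \<open>X + \<alpha>\<close> and \<open>Y + \<gamma>\<close>, evaluated on \<open>Z\<close>. All computations
with forms below are carried out on such values.\<close>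
definition courant_form :: "('m \<Rightarrow> 'm tangent) \<Rightarrow> ('m \<Rightarrow> 'm cotangent) \<Rightarrow> ('m \<Rightarrow> 'm tangent) \<Rightarrow> ('m \<Rightarrow> 'm cotangent) \<Rightarrow>
    ('m \<Rightarrow> 'm tangent) \<Rightarrow> 'm \<Rightarrow> real" where
  "courant_form X \<alpha> Y \<gamma> Z p = dir X (ev \<gamma> Z) p - ev \<gamma> (lie_bracket X Z) p
     - dir Y (ev \<alpha> Z) p + ev \<alpha> (lie_bracket Y Z) p
     + 1/2 * dir Z (\<lambda>q. ev \<alpha> Y q - ev \<gamma> X q) p"

lemma courant_bracket_eval:
  assumes "X \<in> VF" "\<alpha> \<in> one_forms A" "Y \<in> VF" "\<gamma> \<in> one_forms A" "Z \<in> VF"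
  shows "snd (courant_bracket A (\<lambda>q. (X q, \<alpha> q)) (\<lambda>q. (Y q, \<gamma> q)) p) (Z p) = courant_form X \<alpha> Y \<gamma> Z p"
proof -
  have "Z p (\<lambda>q. 1/2 * (\<alpha> q (Y q) - \<gamma> q (X q))) = 1/2 * dir Z (\<lambda>q. ev \<alpha> Y q - ev \<gamma> X q) p"
  proof -
    have "(\<lambda>q. ev \<alpha> Y q - ev \<gamma> X q) \<in> C" using assms by simp
    from dir_cmult[OF assms(5) this, of "1/2" p] show ?thesis by (simp add: dir_def ev_def)
  qed
  then show ?thesis
    using lie_deriv_eval[OF assms(1,4,5), of p] lie_deriv_eval[OF assms(3,2,5), of p]
    by (simp add: courant_bracket_def Let_def courant_form_def dir_def ev_def d_fun_def)
qed

lemma courant_bracket_form_linear: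
  assumes "X \<in> VF" "\<alpha> \<in> one_forms A" "Y \<in> VF" "\<gamma> \<in> one_forms A"
  shows "v \<in> TS p \<Longrightarrow> w \<in> TS p \<Longrightarrow>
      snd (courant_bracket A (\<lambda>q. (X q, \<alpha> q)) (\<lambda>q. (Y q, \<gamma> q)) p) (v + w) =
      snd (courant_bracket A (\<lambda>q. (X q, \<alpha> q)) (\<lambda>q. (Y q, \<gamma> q)) p) v +
      snd (courant_bracket A (\<lambda>q. (X q, \<alpha> q)) (\<lambda>q. (Y q, \<gamma> q)) p) w"
    and "v \<in> TS p \<Longrightarrow>
      snd (courant_bracket A (\<lambda>q. (X q, \<alpha> q)) (\<lambda>q. (Y q, \<gamma> q)) p) (scl c v) =
      c * snd (courant_bracket A (\<lambda>q. (X q, \<alpha> q)) (\<lambda>q. (Y q, \<gamma> q)) p) v"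
  using lie_deriv_form[OF assms(1,4)] lie_deriv_form[OF assms(3,2)]
  by (simp_all add: courant_bracket_def Let_def form_plus form_scl d_fun_def) (simp_all add: scl_def algebra_simps)

lemma zero_form [simp]: "(\<lambda>q z. 0) \<in> one_forms A"
  by (rule formI) auto

lemma ev_zero_form [simp]: "ev (\<lambda>q z. 0) X = (\<lambda>q. 0)"
  by (simp add: ev_def)

lemma ev_zero_field [simp]: "\<alpha> \<in> one_forms A \<Longrightarrow> ev \<alpha> (\<lambda>q. 0) = (\<lambda>q. 0)"
  by (simp add: ev_def form_zero)

lemma dir_zero_field [simp]: "dir (\<lambda>q. 0) f p = 0"
  by (simp add: dir_def)

lemma courant_form_swap:
  assumes "X \<in> VF" "\<alpha> \<in> one_forms A" "Y \<in> VF" "\<gamma> \<in> one_forms A" "Z \<in> VF"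
  shows "courant_form Y \<gamma> X \<alpha> Z p = - courant_form X \<alpha> Y \<gamma> Z p"
  using assms by (simp add: courant_form_def dir_diff field_simps)

lemma form_add_fields [simp]: "\<alpha> \<in> one_forms A \<Longrightarrow> \<beta> \<in> one_forms A \<Longrightarrow> (\<lambda>q z. \<alpha> q z + \<beta> q z) \<in> one_forms A"
  by (rule formI) (simp_all add: form_plus form_scl form_smooth algebra_simps)

lemma courant_form_add_left:
  assumes "X \<in> VF" "\<alpha> \<in> one_forms A" "X' \<in> VF" "\<alpha>' \<in> one_forms A" "Y \<in> VF" "\<gamma> \<in> one_forms A" "Z \<in> VF"
  shows "courant_form (\<lambda>q. X q + X' q) (\<lambda>q z. \<alpha> q z + \<alpha>' q z) Y \<gamma> Z p = courant_form X \<alpha> Y \<gamma> Z p + courant_form X' \<alpha>' Y \<gamma> Z p"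
proof -
  have 1: "ev (\<lambda>q z. \<alpha> q z + \<alpha>' q z) W = (\<lambda>q. ev \<alpha> W q + ev \<alpha>' W q)" for W
    by (simp add: ev_def)
  have 2: "ev \<gamma> (\<lambda>q. X q + X' q) = (\<lambda>q. ev \<gamma> X q + ev \<gamma> X' q)"
    using assms by (simp add: ev_def form_plus)
  have 3: "ev \<gamma> (lie_bracket (\<lambda>q. X q + X' q) Z) p = ev \<gamma> (lie_bracket X Z) p + ev \<gamma> (lie_bracket X' Z) p"
    using assms by (simp add: ev_def lie_bracket_plus_left form_plus)
  have 4: "dir (\<lambda>q. X q + X' q) f p = dir X f p + dir X' f p" for f
    by (simp add: dir_def)
  show ?thesis
    unfolding courant_form_def 1 2 3 4 using assms by (simp add: dir_simps field_simps)
qed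

end

section \<open>Structures with an invariant transversal field\<close>

text \<open>What remains of an almost paracontact structure lifted to \<open>M \<times> \<real>\<close> once the product is forgotten:
\<open>T\<close> stands for \<open>d/dt\<close> and \<open>\<tau>\<close> for \<open>dt\<close>, and independence of \<open>t\<close> becomes invariance under \<open>T\<close>.\<close>
locale adapted_structure = smooth_manifold A
  for A :: "('m::{t2_space, second_countable_topology}, 'e::euclidean_space) chart set" +
  fixes \<phi> :: "'m \<Rightarrow> 'm tangent \<Rightarrow> 'm tangent" and \<xi> :: "'m \<Rightarrow> 'm tangent" and \<eta> :: "'m \<Rightarrow> 'm cotangent"
    and T :: "'m \<Rightarrow> 'm tangent" and \<tau> :: "'m \<Rightarrow> 'm cotangent"
  assumes phi_endo: "\<phi> \<in> endo_fields A"
    and xi_field [simp]: "\<xi> \<in> vector_fields A" and T_field [simp]: "T \<in> vector_fields A"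
    and eta_form [simp]: "\<eta> \<in> one_forms A" and tau_form [simp]: "\<tau> \<in> one_forms A"
    and phi_sq: "v \<in> tangent_space A p \<Longrightarrow> \<phi> p (\<phi> p v) = v - scl (\<eta> p v) (\<xi> p) - scl (\<tau> p v) (T p)"
    and phi_xi: "\<phi> p (\<xi> p) = 0" and phi_T: "\<phi> p (T p) = 0"
    and eta_xi: "\<eta> p (\<xi> p) = 1" and eta_T: "\<eta> p (T p) = 0"
    and tau_xi: "\<tau> p (\<xi> p) = 0" and tau_T: "\<tau> p (T p) = 1"
    and eta_phi: "v \<in> tangent_space A p \<Longrightarrow> \<eta> p (\<phi> p v) = 0"
    and tau_phi: "v \<in> tangent_space A p \<Longrightarrow> \<tau> p (\<phi> p v) = 0"
    and T_phi: "X \<in> vector_fields A \<Longrightarrow> lie_bracket T (\<lambda>q. \<phi> q (X q)) p = \<phi> p (lie_bracket T X p)"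
    and T_xi: "lie_bracket T \<xi> p = 0"
    and T_eta: "X \<in> vector_fields A \<Longrightarrow> T p (\<lambda>q. \<eta> q (X q)) = \<eta> p (lie_bracket T X p)"
    and tau_closed: "X \<in> vector_fields A \<Longrightarrow> Y \<in> vector_fields A \<Longrightarrow>
      \<tau> p (lie_bracket X Y p) = X p (\<lambda>q. \<tau> q (Y q)) - Y p (\<lambda>q. \<tau> q (X q))"
begin

definition phi :: "('m \<Rightarrow> 'm tangent) \<Rightarrow> 'm \<Rightarrow> 'm tangent" where
  "phi X = (\<lambda>q. \<phi> q (X q))"

definition beta_map :: "('m \<Rightarrow> 'm cotangent) \<Rightarrow> 'm \<Rightarrow> 'm tangent" where
  "beta_map \<alpha> = (\<lambda>q. scl (ev \<alpha> T q) (\<xi> q) - scl (ev \<alpha> \<xi> q) (T q))"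

definition B_map :: "('m \<Rightarrow> 'm tangent) \<Rightarrow> 'm \<Rightarrow> 'm cotangent" where
  "B_map X = (\<lambda>q z. ev \<eta> X q * \<tau> q z - ev \<tau> X q * \<eta> q z)"

definition neg_phi_dual :: "('m \<Rightarrow> 'm cotangent) \<Rightarrow> 'm \<Rightarrow> 'm cotangent" where
  "neg_phi_dual \<alpha> = (\<lambda>q z. - \<alpha> q (\<phi> q z))"

definition P :: "'m \<Rightarrow> 'm gvec \<Rightarrow> 'm gvec" where
  "P x = (\<lambda>(v, a). (\<phi> x v + (scl (a (T x)) (\<xi> x) - scl (a (\<xi> x)) (T x)),
     \<lambda>z. (\<eta> x v * \<tau> x z - \<tau> x v * \<eta> x z) + - a (\<phi> x z)))"

lemma phi_field [simp]: "X \<in> VF \<Longrightarrow> phi X \<in> VF"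
  unfolding phi_def by (rule endo_field[OF phi_endo])

lemma beta_map_field [simp]: "\<alpha> \<in> one_forms A \<Longrightarrow> beta_map \<alpha> \<in> VF"
  unfolding beta_map_def by simp

lemma B_map_form [simp]: "X \<in> VF \<Longrightarrow> B_map X \<in> one_forms A"
  unfolding B_map_def
  by (rule formI)
    (simp_all add: form_plus[OF eta_form] form_plus[OF tau_form] form_scl[OF eta_form] form_scl[OF tau_form] algebra_simps form_smooth)

lemma neg_phi_dual_form [simp]:
  assumes "\<alpha> \<in> one_forms A"
  shows "neg_phi_dual \<alpha> \<in> one_forms A"
proof (rule formI)
  fix X assume "X \<in> VF"
  then have "ev \<alpha> (phi X) \<in> C" using assms by simp
  then show "(\<lambda>p. neg_phi_dual \<alpha> p (X p)) \<in> C" by (simp add: neg_phi_dual_def ev_def phi_def)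
qed (use assms in \<open>simp_all add: neg_phi_dual_def form_plus form_scl endo_plus[OF phi_endo] endo_scl[OF phi_endo]
    endo_tangent[OF phi_endo]\<close>)

lemma P_section: "P x (X x, \<alpha> x) = (phi X x + beta_map \<alpha> x, \<lambda>z. B_map X x z + neg_phi_dual \<alpha> x z)"
  by (simp add: P_def phi_def beta_map_def B_map_def neg_phi_dual_def ev_def)

lemma ev_Bf: "ev (B_map X) Z = (\<lambda>q. ev \<eta> X q * ev \<tau> Z q - ev \<tau> X q * ev \<eta> Z q)"
  by (simp add: ev_def B_map_def)

lemma ev_fs: "ev (neg_phi_dual \<alpha>) Z = (\<lambda>q. - ev \<alpha> (phi Z) q)"
  by (simp add: ev_def neg_phi_dual_def phi_def)

lemma ev_bet: "\<gamma> \<in> one_forms A \<Longrightarrow> ev \<gamma> (beta_map \<alpha>) = (\<lambda>q. ev \<alpha> T q * ev \<gamma> \<xi> q - ev \<alpha> \<xi> q * ev \<gamma> T q)"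
  by (simp add: ev_def beta_map_def form_minus form_scl)

lemma ev_phi_phi:
  "\<gamma> \<in> one_forms A \<Longrightarrow> X \<in> VF \<Longrightarrow>
    ev \<gamma> (phi (phi X)) = (\<lambda>q. ev \<gamma> X q - ev \<eta> X q * ev \<gamma> \<xi> q - ev \<tau> X q * ev \<gamma> T q)"
  by (simp add: ev_def phi_def phi_sq form_minus form_scl)

lemma ev_frame [simp]:
  "ev \<eta> \<xi> = (\<lambda>q. 1)" "ev \<eta> T = (\<lambda>q. 0)" "ev \<tau> \<xi> = (\<lambda>q. 0)" "ev \<tau> T = (\<lambda>q. 1)"
  "X \<in> VF \<Longrightarrow> ev \<eta> (phi X) = (\<lambda>q. 0)" "X \<in> VF \<Longrightarrow> ev \<tau> (phi X) = (\<lambda>q. 0)"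
  "phi \<xi> = (\<lambda>q. 0)" "phi T = (\<lambda>q. 0)"
  by (simp_all add: ev_def phi_def eta_xi eta_T tau_xi tau_T eta_phi tau_phi phi_xi phi_T)

lemma phi_bet [simp]: "phi (beta_map \<alpha>) = (\<lambda>q. 0)"
  by (simp add: phi_def beta_map_def endo_minus[OF phi_endo] endo_scl[OF phi_endo] phi_xi phi_T)

lemma phi_zero [simp]: "phi (\<lambda>q. 0) = (\<lambda>q. 0)"
  by (simp add: phi_def endo_zero[OF phi_endo])

lemma dir_bet: "dir (beta_map \<alpha>) f p = ev \<alpha> T p * dir \<xi> f p - ev \<alpha> \<xi> p * dir T f p"
  by (simp add: dir_def beta_map_def scl_def)

lemma lie_bet:
  assumes "\<alpha> \<in> one_forms A" "Z \<in> VF"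
  shows "lie_bracket (beta_map \<alpha>) Z p = scl (ev \<alpha> T p) (lie_bracket \<xi> Z p) - scl (dir Z (ev \<alpha> T) p) (\<xi> p)
     - scl (ev \<alpha> \<xi> p) (lie_bracket T Z p) + scl (dir Z (ev \<alpha> \<xi>) p) (T p)"
proof -
  have "beta_map \<alpha> = (\<lambda>q. scl (ev \<alpha> T q) (\<xi> q) + scl (- ev \<alpha> \<xi> q) (T q))"
    by (simp add: beta_map_def scl_def fun_eq_iff)
  then have "lie_bracket (beta_map \<alpha>) Z p = lie_bracket (\<lambda>q. scl (ev \<alpha> T q) (\<xi> q)) Z p + lie_bracket (\<lambda>q. scl (- ev \<alpha> \<xi> q) (T q)) Z p"
    using assms by (simp add: lie_bracket_plus_left)
  also have "\<dots> = (scl (ev \<alpha> T p) (lie_bracket \<xi> Z p) - scl (dir Z (ev \<alpha> T) p) (\<xi> p)) +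
     (scl (- ev \<alpha> \<xi> p) (lie_bracket T Z p) - scl (- dir Z (ev \<alpha> \<xi>) p) (T p))"
    using assms dir_uminus[OF assms(2), of "ev \<alpha> \<xi>" p] by (simp add: lie_bracket_scl_left dir_def)
  also have "\<dots> = scl (ev \<alpha> T p) (lie_bracket \<xi> Z p) - scl (dir Z (ev \<alpha> T) p) (\<xi> p)
     - scl (ev \<alpha> \<xi> p) (lie_bracket T Z p) + scl (dir Z (ev \<alpha> \<xi>) p) (T p)"
    by (simp add: fun_eq_iff scl_def)
  finally show ?thesis .
qed

lemma ev_lie_bet:
  assumes "\<alpha> \<in> one_forms A" "Z \<in> VF" "\<gamma> \<in> one_forms A"
  shows "ev \<gamma> (lie_bracket (beta_map \<alpha>) Z) p = ev \<alpha> T p * ev \<gamma> (lie_bracket \<xi> Z) p - dir Z (ev \<alpha> T) p * ev \<gamma> \<xi> p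
     - ev \<alpha> \<xi> p * ev \<gamma> (lie_bracket T Z) p + dir Z (ev \<alpha> \<xi>) p * ev \<gamma> T p"
  using assms by (simp add: ev_def[of \<gamma>] lie_bet form_minus form_plus form_scl)

lemma phi_lie_bet:
  assumes "\<alpha> \<in> one_forms A" "Z \<in> VF"
  shows "phi (lie_bracket (beta_map \<alpha>) Z) p = scl (ev \<alpha> T p) (phi (lie_bracket \<xi> Z) p) - scl (ev \<alpha> \<xi> p) (phi (lie_bracket T Z) p)"
  using assms by (simp add: phi_def lie_bet endo_minus[OF phi_endo] endo_plus[OF phi_endo] endo_scl[OF phi_endo] phi_xi phi_T)

lemma ev_phi_lie_bet:
  assumes "\<alpha> \<in> one_forms A" "Z \<in> VF" "\<gamma> \<in> one_forms A"
  shows "ev \<gamma> (phi (lie_bracket (beta_map \<alpha>) Z)) p = ev \<alpha> T p * ev \<gamma> (phi (lie_bracket \<xi> Z)) p - ev \<alpha> \<xi> p * ev \<gamma> (phi (lie_bracket T Z)) p"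
  using assms by (simp add: ev_def[of \<gamma>] phi_lie_bet form_minus form_scl field_tangent[OF phi_field])

lemma dir_T_eta: "X \<in> VF \<Longrightarrow> dir T (ev \<eta> X) p = ev \<eta> (lie_bracket T X) p"
  by (simp add: dir_def ev_def T_eta)

lemma ev_tau_lie: "X \<in> VF \<Longrightarrow> Y \<in> VF \<Longrightarrow> ev \<tau> (lie_bracket X Y) p = dir X (ev \<tau> Y) p - dir Y (ev \<tau> X) p"
  by (simp add: dir_def ev_def tau_closed)

lemma lie_T_phi: "X \<in> VF \<Longrightarrow> lie_bracket T (phi X) = phi (lie_bracket T X)"
  by (simp add: phi_def T_phi fun_eq_iff[of "lie_bracket _ _"])

lemma lie_T_xi: "lie_bracket T \<xi> = (\<lambda>q. 0)"
  by (simp add: T_xi fun_eq_iff[of "lie_bracket _ _"])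

lemma ev_lie_swap: "\<gamma> \<in> one_forms A \<Longrightarrow> X \<in> VF \<Longrightarrow> Y \<in> VF \<Longrightarrow> ev \<gamma> (lie_bracket X Y) p = - ev \<gamma> (lie_bracket Y X) p"
  by (simp add: ev_def lie_bracket_swap[of X Y] form_uminus)

lemma ev_phi_lie_swap: "\<gamma> \<in> one_forms A \<Longrightarrow> X \<in> VF \<Longrightarrow> Y \<in> VF \<Longrightarrow> ev \<gamma> (phi (lie_bracket X Y)) p = - ev \<gamma> (phi (lie_bracket Y X)) p"
  by (simp add: ev_def phi_def lie_bracket_swap[of X Y] form_uminus endo_uminus[OF phi_endo] endo_tangent[OF phi_endo])

lemma phi_lie_swap: "X \<in> VF \<Longrightarrow> Y \<in> VF \<Longrightarrow> phi (lie_bracket X Y) p = - phi (lie_bracket Y X) p"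
  by (simp add: phi_def lie_bracket_swap[of X Y] endo_uminus[OF phi_endo])

text \<open>The vector and the form part of the Courant--Nijenhuis tensor on sections \<open>X + \<alpha>\<close> and \<open>Y + \<gamma>\<close>. The images
\<open>X' + \<alpha>'\<close> and \<open>Y' + \<gamma>'\<close> of the sections under \<open>P\<close> are separate arguments, which makes both parts
bilinear by inspection and allows fields and forms to be treated separately.\<close>
definition torsion_vec where
  "torsion_vec X \<alpha> X' \<alpha>' Y \<gamma> Y' \<gamma>' p = lie_bracket X' Y' p + lie_bracket X Y p
     - phi (lie_bracket X' Y) p - phi (lie_bracket X Y') p
     - scl (courant_form X' \<alpha>' Y \<gamma> T p + courant_form X \<alpha> Y' \<gamma>' T p) (\<xi> p)
     + scl (courant_form X' \<alpha>' Y \<gamma> \<xi> p + courant_form X \<alpha> Y' \<gamma>' \<xi> p) (T p)"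

definition torsion_form where
  "torsion_form X \<alpha> X' \<alpha>' Y \<gamma> Y' \<gamma>' Z p = courant_form X' \<alpha>' Y' \<gamma>' Z p + courant_form X \<alpha> Y \<gamma> Z p
     - ev \<eta> (lie_bracket X' Y) p * ev \<tau> Z p + ev \<tau> (lie_bracket X' Y) p * ev \<eta> Z p
     - ev \<eta> (lie_bracket X Y') p * ev \<tau> Z p + ev \<tau> (lie_bracket X Y') p * ev \<eta> Z p
     + courant_form X' \<alpha>' Y \<gamma> (phi Z) p + courant_form X \<alpha> Y' \<gamma>' (phi Z) p"

text \<open>The decisive computation. The first block contributes \<open>N\<^sub>\<phi>\<close>; the term \<open>d\<eta> \<otimes> \<xi>\<close> arises because
\<open>\<phi>\<^sup>2 [X, Y]\<close> and \<open>[X, Y]\<close> differ by multiples of \<open>\<xi>\<close> and \<open>T\<close>, and because \<open>\<xi> \<and> T\<close> is applied to the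
Lie derivatives of the images under \<open>\<eta> \<and> \<tau>\<close>.\<close>
lemma torsion_vec_vectors:
  assumes X: "X \<in> VF" and Y: "Y \<in> VF"
  shows "torsion_vec X (\<lambda>q z. 0) (phi X) (B_map X) Y (\<lambda>q z. 0) (phi Y) (B_map Y) p =
     nijenhuis \<phi> X Y p - scl (d_form \<eta> X Y p) (\<xi> p) +
     scl (ev \<tau> (lie_bracket X Y) p + (courant_form (phi X) (B_map X) Y (\<lambda>q z. 0) \<xi> p + courant_form X (\<lambda>q z. 0) (phi Y) (B_map Y) \<xi> p)) (T p)"
proof -
  have 1: "courant_form (phi X) (B_map X) Y (\<lambda>q z. 0) T p + courant_form X (\<lambda>q z. 0) (phi Y) (B_map Y) T p =
     dir X (ev \<eta> Y) p - dir Y (ev \<eta> X) p"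
    using X Y by (simp add: courant_form_def ev_Bf dir_simps ev_tau_lie dir_T_eta ev_lie_swap[of _ X T] ev_lie_swap[of _ Y T] field_simps)
  have 2: "phi (phi (lie_bracket X Y)) p = lie_bracket X Y p - scl (ev \<eta> (lie_bracket X Y) p) (\<xi> p) - scl (ev \<tau> (lie_bracket X Y) p) (T p)"
    using X Y by (simp add: phi_def phi_sq ev_def)
  have 3: "nijenhuis \<phi> X Y p = lie_bracket (phi X) (phi Y) p + phi (phi (lie_bracket X Y)) p - phi (lie_bracket (phi X) Y) p - phi (lie_bracket X (phi Y)) p"
    by (simp add: nijenhuis_def phi_def)
  have 4: "d_form \<eta> X Y p = dir X (ev \<eta> Y) p - dir Y (ev \<eta> X) p - ev \<eta> (lie_bracket X Y) p"
    by (simp add: d_form_def dir_def ev_def)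
  show ?thesis
    unfolding torsion_vec_def 1 3 2 4
    by (simp add: fun_eq_iff scl_def algebra_simps)
qed

lemma torsion_vec_swap:
  assumes "X \<in> VF" "\<alpha> \<in> one_forms A" "X' \<in> VF" "\<alpha>' \<in> one_forms A"
    and "Y \<in> VF" "\<gamma> \<in> one_forms A" "Y' \<in> VF" "\<gamma>' \<in> one_forms A"
  shows "torsion_vec Y \<gamma> Y' \<gamma>' X \<alpha> X' \<alpha>' p = - torsion_vec X \<alpha> X' \<alpha>' Y \<gamma> Y' \<gamma>' p"
  unfolding torsion_vec_def
  using assms
  by (simp add: courant_form_swap[of X \<alpha>] courant_form_swap[of X' \<alpha>'] lie_bracket_swap[of Y] lie_bracket_swap[of Y'] phi_lie_swap[of Y] phi_lie_swap[of Y'])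
    (simp add: fun_eq_iff scl_def algebra_simps)

lemma torsion_form_swap:
  assumes "X \<in> VF" "\<alpha> \<in> one_forms A" "X' \<in> VF" "\<alpha>' \<in> one_forms A"
    and "Y \<in> VF" "\<gamma> \<in> one_forms A" "Y' \<in> VF" "\<gamma>' \<in> one_forms A" and "Z \<in> VF"
  shows "torsion_form Y \<gamma> Y' \<gamma>' X \<alpha> X' \<alpha>' Z p = - torsion_form X \<alpha> X' \<alpha>' Y \<gamma> Y' \<gamma>' Z p"
  unfolding torsion_form_def
  using assms
  by (simp add: courant_form_swap[of X \<alpha>] courant_form_swap[of X' \<alpha>'] ev_lie_swap[of _ Y] ev_lie_swap[of _ Y'])

lemma torsion_vec_add_left:
  assumes "X \<in> VF" "\<alpha> \<in> one_forms A" "X' \<in> VF" "\<alpha>' \<in> one_forms A"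
    and "W \<in> VF" "\<omega> \<in> one_forms A" "W' \<in> VF" "\<omega>' \<in> one_forms A"
    and "Y \<in> VF" "\<gamma> \<in> one_forms A" "Y' \<in> VF" "\<gamma>' \<in> one_forms A"
  shows "torsion_vec (\<lambda>q. X q + W q) (\<lambda>q z. \<alpha> q z + \<omega> q z) (\<lambda>q. X' q + W' q) (\<lambda>q z. \<alpha>' q z + \<omega>' q z) Y \<gamma> Y' \<gamma>' p
    = torsion_vec X \<alpha> X' \<alpha>' Y \<gamma> Y' \<gamma>' p + torsion_vec W \<omega> W' \<omega>' Y \<gamma> Y' \<gamma>' p"
proof -
  have phi: "phi (lie_bracket (\<lambda>q. V q + V' q) U) p = phi (lie_bracket V U) p + phi (lie_bracket V' U) p"
    if "V \<in> VF" "V' \<in> VF" "U \<in> VF" for V V' U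
    using that by (simp add: phi_def lie_bracket_plus_left endo_plus[OF phi_endo])
  show ?thesis
    unfolding torsion_vec_def using assms
    by (simp add: lie_bracket_plus_left phi courant_form_add_left) (simp add: fun_eq_iff scl_def algebra_simps)
qed

lemma torsion_form_add_left:
  assumes "X \<in> VF" "\<alpha> \<in> one_forms A" "X' \<in> VF" "\<alpha>' \<in> one_forms A"
    and "W \<in> VF" "\<omega> \<in> one_forms A" "W' \<in> VF" "\<omega>' \<in> one_forms A"
    and "Y \<in> VF" "\<gamma> \<in> one_forms A" "Y' \<in> VF" "\<gamma>' \<in> one_forms A" and "Z \<in> VF"
  shows "torsion_form (\<lambda>q. X q + W q) (\<lambda>q z. \<alpha> q z + \<omega> q z) (\<lambda>q. X' q + W' q) (\<lambda>q z. \<alpha>' q z + \<omega>' q z) Y \<gamma> Y' \<gamma>' Z p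
    = torsion_form X \<alpha> X' \<alpha>' Y \<gamma> Y' \<gamma>' Z p + torsion_form W \<omega> W' \<omega>' Y \<gamma> Y' \<gamma>' Z p"
proof -
  have ev: "ev \<kappa> (lie_bracket (\<lambda>q. V q + V' q) U) p = ev \<kappa> (lie_bracket V U) p + ev \<kappa> (lie_bracket V' U) p"
    if "V \<in> VF" "V' \<in> VF" "U \<in> VF" "\<kappa> \<in> one_forms A" for V V' U \<kappa>
    using that by (simp add: ev_def lie_bracket_plus_left form_plus)
  show ?thesis
    unfolding torsion_form_def using assms
    by (simp add: ev courant_form_add_left) (simp add: algebra_simps)
qed

text \<open>The values of a covector outside the tangent space are arbitrary, hence the equality of the form parts on
tangent vectors only.\<close>
lemma P_involutive:
  assumes v: "v \<in> TS x"
    and add: "\<And>v w. v \<in> TS x \<Longrightarrow> w \<in> TS x \<Longrightarrow> a (v + w) = a v + a w"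
    and scale: "\<And>c v. v \<in> TS x \<Longrightarrow> a (scl c v) = c * a v"
  shows "fst (P x (P x (v, a))) = v" and "z \<in> TS x \<Longrightarrow> snd (P x (P x (v, a))) z = a z"
proof -
  have a0: "a 0 = 0" using scale[of 0 0] by simp
  have diff: "a (v - w) = a v - a w" if "v \<in> TS x" "w \<in> TS x" for v w
    using add[of v "scl (- 1) w"] scale[of w "-1"] that by simp
  note tangents = endo_tangent[OF phi_endo]
  note lin = form_plus[OF eta_form] form_minus[OF eta_form] form_scl[OF eta_form]
     form_plus[OF tau_form] form_minus[OF tau_form] form_scl[OF tau_form]
     endo_plus[OF phi_endo] endo_minus[OF phi_endo] endo_scl[OF phi_endo]
  note frame = phi_xi phi_T eta_xi eta_T tau_xi tau_T eta_phi tau_phi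
  show "fst (P x (P x (v, a))) = v"
    using v by (simp add: P_def tangents lin frame a0 phi_sq) (simp add: fun_eq_iff scl_def)
  show "snd (P x (P x (v, a))) z = a z" if "z \<in> TS x"
    using v that by (simp add: P_def tangents lin frame a0 phi_sq diff scale)
qed

lemma
  fixes X Y \<alpha> \<gamma>
  defines "s \<equiv> \<lambda>q. (X q, \<alpha> q)" and "u \<equiv> \<lambda>q. (Y q, \<gamma> q)"
    and "X' \<equiv> \<lambda>q. phi X q + beta_map \<alpha> q" and "\<alpha>' \<equiv> \<lambda>q z. B_map X q z + neg_phi_dual \<alpha> q z"
    and "Y' \<equiv> \<lambda>q. phi Y q + beta_map \<gamma> q" and "\<gamma>' \<equiv> \<lambda>q z. B_map Y q z + neg_phi_dual \<gamma> q z"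
  assumes s: "X \<in> VF" "\<alpha> \<in> one_forms A" and u: "Y \<in> VF" "\<gamma> \<in> one_forms A"
  shows fst_courant_nijenhuis: "fst (courant_nijenhuis A P s u p) = torsion_vec X \<alpha> X' \<alpha>' Y \<gamma> Y' \<gamma>' p"
    and snd_courant_nijenhuis: "Z \<in> VF \<Longrightarrow> snd (courant_nijenhuis A P s u p) (Z p) = torsion_form X \<alpha> X' \<alpha>' Y \<gamma> Y' \<gamma>' Z p"
proof -
  have s': "X' \<in> VF" "\<alpha>' \<in> one_forms A" and u': "Y' \<in> VF" "\<gamma>' \<in> one_forms A"
    using s u by (simp_all add: X'_def \<alpha>'_def Y'_def \<gamma>'_def)
  have Ps: "(\<lambda>y. P y (s y)) = (\<lambda>q. (X' q, \<alpha>' q))" and Pu: "(\<lambda>y. P y (u y)) = (\<lambda>q. (Y' q, \<gamma>' q))"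
    by (simp_all add: s_def u_def P_section X'_def \<alpha>'_def Y'_def \<gamma>'_def)
  have fst_cb: "fst (courant_bracket A (\<lambda>q. (V q, a q)) (\<lambda>q. (W q, b q)) p) = lie_bracket V W p" for V a W b
    by (simp add: courant_bracket_def)
  define c where "c = courant_bracket A s u p"
  have fst_c: "fst c = lie_bracket X Y p" by (simp add: c_def s_def u_def fst_cb)
  have v: "fst c \<in> TS p" unfolding fst_c using s u by simp
  have add: "snd c (z + w) = snd c z + snd c w" if "z \<in> TS p" "w \<in> TS p" for z w
    unfolding c_def s_def u_def using that by (rule courant_bracket_form_linear(1)[OF s u])
  have scale: "snd c (scl r z) = r * snd c z" if "z \<in> TS p" for r z
    unfolding c_def s_def u_def using that by (rule courant_bracket_form_linear(2)[OF s u])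
  have "fst (P p (P p (fst c, snd c))) = fst c"
    by (rule P_involutive(1)) (simp_all only: v add scale)
  then have PP: "fst (P p (P p c)) = lie_bracket X Y p"
    unfolding prod.collapse using fst_c by (rule trans)
  have "snd (P p (P p (fst c, snd c))) z = snd c z" if "z \<in> TS p" for z
    by (rule P_involutive(2)) (simp_all only: v add scale that)
  then have PP': "snd (P p (P p c)) z = snd c z" if "z \<in> TS p" for z
    unfolding prod.collapse using that by blast
  have PQ: "fst (P p w) = \<phi> p (fst w) + (scl (snd w (T p)) (\<xi> p) - scl (snd w (\<xi> p)) (T p))"
    "snd (P p w) z = (\<eta> p (fst w) * \<tau> p z - \<tau> p (fst w) * \<eta> p z) - snd w (\<phi> p z)" for w z
    by (simp_all add: P_def split_beta)
  note eval = courant_bracket_eval[OF s' u T_field] courant_bracket_eval[OF s' u xi_field]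
    courant_bracket_eval[OF s u' T_field] courant_bracket_eval[OF s u' xi_field]
  show "fst (courant_nijenhuis A P s u p) = torsion_vec X \<alpha> X' \<alpha>' Y \<gamma> Y' \<gamma>' p"
    unfolding courant_nijenhuis_def c_def[symmetric] Ps Pu
    by (simp only: fst_add fst_diff PP)
      (simp add: PQ(1) fst_cb s_def u_def eval torsion_vec_def phi_def, simp add: fun_eq_iff scl_def algebra_simps)
  show "snd (courant_nijenhuis A P s u p) (Z p) = torsion_form X \<alpha> X' \<alpha>' Y \<gamma> Y' \<gamma>' Z p" if Z: "Z \<in> VF"
  proof -
    have "snd (courant_bracket A (\<lambda>q. (V q, a q)) (\<lambda>q. (W q, b q)) p) (\<phi> p (Z p)) = courant_form V a W b (phi Z) p"
      if "V \<in> VF" "a \<in> one_forms A" "W \<in> VF" "b \<in> one_forms A" for V a W b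
      using courant_bracket_eval[OF that phi_field[OF Z], of p] by (simp add: phi_def)
    note eval = this[OF s' u] this[OF s u'] courant_bracket_eval[OF s' u' Z] courant_bracket_eval[OF s u Z]
    show ?thesis
      unfolding courant_nijenhuis_def c_def[symmetric] Ps Pu
      by (simp only: snd_add snd_diff plus_fun_apply minus_apply PP'[OF field_tangent[OF Z]])
        (simp add: PQ(2) c_def s_def u_def fst_cb eval torsion_form_def ev_def)
  qed
qed

end

section \<open>Normal structures are integrable\<close>

locale normal_adapted_structure = adapted_structure +
  assumes normal: "normal_paracontact A \<phi> \<xi> \<eta>"
begin

definition deta where
  "deta X Y p = dir X (ev \<eta> Y) p - dir Y (ev \<eta> X) p - ev \<eta> (lie_bracket X Y) p"

lemma lie_phi_phi:
  assumes "X \<in> VF" "Y \<in> VF"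
  shows "lie_bracket (phi X) (phi Y) p = phi (lie_bracket (phi X) Y) p + phi (lie_bracket X (phi Y)) p
    - phi (phi (lie_bracket X Y)) p + scl (deta X Y p) (\<xi> p)"
proof -
  have "nijenhuis \<phi> X Y p - (\<lambda>f. d_form \<eta> X Y p * \<xi> p f) = 0"
    using normal assms by (simp add: normal_paracontact_def)
  moreover have "nijenhuis \<phi> X Y p = lie_bracket (phi X) (phi Y) p + phi (phi (lie_bracket X Y)) p - phi (lie_bracket (phi X) Y) p - phi (lie_bracket X (phi Y)) p"
    by (simp add: nijenhuis_def phi_def)
  moreover have "d_form \<eta> X Y p = deta X Y p"
    by (simp add: d_form_def dir_def ev_def deta_def)
  ultimately show ?thesis by (simp add: fun_eq_iff scl_def algebra_simps)
qed

lemma lie_zero_left [simp]: "X \<in> VF \<Longrightarrow> lie_bracket (\<lambda>q. 0) X = (\<lambda>q. 0)"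
  by (simp add: lie_bracket_def fun_eq_iff tangent_const[OF field_tangent])

lemma lie_zero_right [simp]: "X \<in> VF \<Longrightarrow> lie_bracket X (\<lambda>q. 0) = (\<lambda>q. 0)"
  by (simp add: lie_bracket_def fun_eq_iff tangent_const[OF field_tangent])

lemma ev_lie_phi_phi:
  assumes "\<gamma> \<in> one_forms A" "X \<in> VF" "Y \<in> VF"
  shows "ev \<gamma> (lie_bracket (phi X) (phi Y)) p = ev \<gamma> (phi (lie_bracket (phi X) Y)) p
    + ev \<gamma> (phi (lie_bracket X (phi Y))) p - ev \<gamma> (phi (phi (lie_bracket X Y))) p + deta X Y p * ev \<gamma> \<xi> p"
  using assms by (simp only: ev_def lie_phi_phi) (simp add: form_plus form_minus form_scl field_tangent[OF phi_field])

lemma lie_self: "lie_bracket X X = (\<lambda>q. 0)"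
  by (simp add: lie_bracket_def fun_eq_iff)

text \<open>Apply \<open>\<eta>\<close> to the normality condition; \<open>\<eta> \<circ> \<phi> = 0\<close> leaves only this.\<close>
lemma eta_lie_phi_phi:
  assumes "X \<in> VF" "Y \<in> VF"
  shows "ev \<eta> (lie_bracket (phi X) (phi Y)) p = deta X Y p"
  using ev_lie_phi_phi[OF eta_form assms] assms by simp

text \<open>\<open>L\<^sub>\<xi> \<eta> = 0\<close>, from the preceding identity at \<open>Y = \<xi>\<close>.\<close>
lemma dir_xi_eta: "X \<in> VF \<Longrightarrow> dir \<xi> (ev \<eta> X) p = ev \<eta> (lie_bracket \<xi> X) p"
  using eta_lie_phi_phi[of X \<xi> p]
  by (simp add: deta_def dir_const ev_lie_swap[of \<eta> X \<xi>])

text \<open>\<open>L\<^sub>\<xi> \<phi> = 0\<close>. The normality condition at \<open>(\<xi>, X)\<close> gives this after one more application of \<open>\<phi>\<close>, which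
can be undone because both sides are killed by \<open>\<eta>\<close> and \<open>\<tau>\<close>, and \<open>\<phi>\<^sup>2\<close> is the identity on such vectors.\<close>
lemma lie_xi_phi:
  assumes X: "X \<in> VF"
  shows "lie_bracket \<xi> (phi X) = phi (lie_bracket \<xi> X)"
proof
  fix p
  have "phi (lie_bracket \<xi> (phi X)) p = phi (phi (lie_bracket \<xi> X)) p" for p
    using lie_phi_phi[OF xi_field X, of p] X dir_xi_eta[OF X, of p]
    by (simp add: deta_def dir_const fun_eq_iff)
  then have "phi (lie_bracket \<xi> (phi X)) = phi (phi (lie_bracket \<xi> X))" ..
  then have "phi (phi (lie_bracket \<xi> (phi X))) p = phi (phi (phi (lie_bracket \<xi> X))) p"
    by simp
  moreover have "phi (phi W) p = W p - scl (ev \<eta> W p) (\<xi> p) - scl (ev \<tau> W p) (T p)" if "W \<in> VF" for W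
    using that by (simp add: phi_def ev_def phi_sq)
  ultimately show "lie_bracket \<xi> (phi X) p = phi (lie_bracket \<xi> X) p"
    using X dir_xi_eta[of "phi X" p] by (simp add: ev_tau_lie dir_const)
qed

text \<open>This is \<open>d\<eta>(\<phi> X, Y) + d\<eta>(X, \<phi> Y) = 0\<close> in the form in which it is used for rewriting. It comes from
\<open>\<eta> [\<phi> X, \<phi> Y] = d\<eta>(X, Y)\<close> with \<open>\<phi> X\<close> in place of \<open>X\<close>.\<close>
lemma eta_lie_phi:
  assumes X: "X \<in> VF" and Y: "Y \<in> VF"
  shows "ev \<eta> (lie_bracket (phi X) Y) p =
    dir (phi X) (ev \<eta> Y) p - dir (phi Y) (ev \<eta> X) p - ev \<eta> (lie_bracket X (phi Y)) p"
proof -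
  \<comment> \<open>\<open>\<phi>\<^sup>2\<close> as a sum of scaled fields, so that the bracket can be expanded\<close>
  have "phi (phi X) = (\<lambda>q. X q + (scl (- ev \<eta> X q) (\<xi> q) + scl (- ev \<tau> X q) (T q)))"
    using X by (intro ext) (simp add: phi_def ev_def phi_sq scl_def)
  then have "ev \<eta> (lie_bracket (phi (phi X)) (phi Y)) p =
     ev \<eta> (lie_bracket (\<lambda>q. X q + (scl (- ev \<eta> X q) (\<xi> q) + scl (- ev \<tau> X q) (T q))) (phi Y)) p"
    by simp
  also have "\<dots> = ev \<eta> (lie_bracket X (phi Y)) p
     + (- ev \<eta> X p * ev \<eta> (lie_bracket \<xi> (phi Y)) p + dir (phi Y) (ev \<eta> X) p)
     + - ev \<tau> X p * ev \<eta> (lie_bracket T (phi Y)) p"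
    using X Y dir_uminus[of "phi Y" "ev \<eta> X" p]
    by (simp add: ev_def[of \<eta> "lie_bracket _ _"] lie_bracket_plus_left lie_bracket_scl_left form_plus form_minus form_scl
        eta_xi eta_T dir_def)
  also have "\<dots> = ev \<eta> (lie_bracket X (phi Y)) p + dir (phi Y) (ev \<eta> X) p"
    using Y by (simp add: lie_xi_phi lie_T_phi)
  finally show ?thesis
    using eta_lie_phi_phi[of "phi X" Y p] X Y by (simp add: deta_def dir_const)
qed

lemma torsion_vec_vectors_zero:
  assumes X: "X \<in> VF" and Y: "Y \<in> VF"
  shows "torsion_vec X (\<lambda>q z. 0) (phi X) (B_map X) Y (\<lambda>q z. 0) (phi Y) (B_map Y) p = 0"
proof -
  have "courant_form (phi X) (B_map X) Y (\<lambda>q z. 0) \<xi> p + courant_form X (\<lambda>q z. 0) (phi Y) (B_map Y) \<xi> p = - ev \<tau> (lie_bracket X Y) p"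
    using X Y by (simp add: courant_form_def ev_Bf dir_simps ev_tau_lie dir_xi_eta ev_lie_swap[of _ X \<xi>] ev_lie_swap[of _ Y \<xi>] field_simps)
  moreover have "nijenhuis \<phi> X Y p - scl (d_form \<eta> X Y p) (\<xi> p) = 0"
    using normal assms by (simp add: normal_paracontact_def scl_def)
  ultimately show ?thesis by (simp add: torsion_vec_vectors[OF X Y])
qed

text \<open>Here the identity \<open>d\<eta>(\<phi> X, Y) + d\<eta>(X, \<phi> Y) = 0\<close> is used, for all pairs among the three fields.\<close>
lemma torsion_form_vectors_zero:
  assumes X: "X \<in> VF" and Y: "Y \<in> VF" and Z: "Z \<in> VF"
  shows "torsion_form X (\<lambda>q z. 0) (phi X) (B_map X) Y (\<lambda>q z. 0) (phi Y) (B_map Y) Z p = 0"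
  using X Y Z
  by (simp add: torsion_form_def courant_form_def ev_Bf dir_simps ev_tau_lie eta_lie_phi field_simps)

lemma torsion_vec_mixed_zero:
  assumes X: "X \<in> VF" and \<gamma>: "\<gamma> \<in> one_forms A"
  shows "torsion_vec X (\<lambda>q z. 0) (phi X) (B_map X) (\<lambda>q. 0) \<gamma> (beta_map \<gamma>) (neg_phi_dual \<gamma>) p = 0"
proof -
  have 1: "lie_bracket (phi X) (beta_map \<gamma>) p = - lie_bracket (beta_map \<gamma>) (phi X) p"
    by (rule lie_bracket_swap)
  have 2: "phi (lie_bracket X (beta_map \<gamma>)) p = - phi (lie_bracket (beta_map \<gamma>) X) p"
    using X \<gamma> by (simp add: phi_lie_swap[of X])
  show ?thesis
    using X \<gamma>
    by (simp add: torsion_vec_def 1 2 lie_bet phi_lie_bet lie_xi_phi lie_T_phi)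
      (simp add: courant_form_def ev_Bf ev_fs ev_bet dir_simps dir_bet ev_tau_lie fun_eq_iff scl_def field_simps
        ev_lie_swap[of \<gamma> "phi X" \<xi>] ev_lie_swap[of \<gamma> "phi X" T] ev_phi_lie_swap[of \<gamma> X \<xi>] ev_phi_lie_swap[of \<gamma> X T]
        lie_xi_phi lie_T_phi)
qed

text \<open>Up to sign, part of the terms make up \<open>\<gamma>\<close> applied to \<open>N\<^sub>\<phi>(X, Z) - d\<eta>(X, Z) \<xi>\<close>; the others cancel by the
invariance of \<open>\<phi>\<close> and \<open>\<eta>\<close> under \<open>\<xi>\<close> and \<open>T\<close>.\<close>
lemma torsion_form_mixed_zero:
  assumes X: "X \<in> VF" and Z: "Z \<in> VF" and \<gamma>: "\<gamma> \<in> one_forms A"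
  shows "torsion_form X (\<lambda>q z. 0) (phi X) (B_map X) (\<lambda>q. 0) \<gamma> (beta_map \<gamma>) (neg_phi_dual \<gamma>) Z p = 0"
proof -
  have 1: "ev \<alpha> (lie_bracket W (beta_map \<gamma>)) p = - ev \<alpha> (lie_bracket (beta_map \<gamma>) W) p" if "W \<in> VF" "\<alpha> \<in> one_forms A" for W \<alpha>
    using that \<gamma> by (simp add: ev_lie_swap[of \<alpha> W])
  show ?thesis
    using X Z \<gamma>
    by (simp add: torsion_form_def courant_form_def ev_Bf ev_fs ev_bet dir_simps dir_bet 1 ev_lie_bet ev_phi_lie_bet ev_lie_phi_phi ev_phi_phi
        ev_tau_lie dir_T_eta dir_xi_eta lie_xi_phi lie_T_phi deta_def field_simps)
qed

lemma torsion_vec_forms_zero: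
  assumes \<alpha>: "\<alpha> \<in> one_forms A" and \<gamma>: "\<gamma> \<in> one_forms A"
  shows "torsion_vec (\<lambda>q. 0) \<alpha> (beta_map \<alpha>) (neg_phi_dual \<alpha>) (\<lambda>q. 0) \<gamma> (beta_map \<gamma>) (neg_phi_dual \<gamma>) p = 0"
proof -
  have swap: "lie_bracket \<xi> (beta_map \<gamma>) p = - lie_bracket (beta_map \<gamma>) \<xi> p" "lie_bracket T (beta_map \<gamma>) p = - lie_bracket (beta_map \<gamma>) T p"
    by (rule lie_bracket_swap)+
  show ?thesis
    using \<alpha> \<gamma>
    by (simp add: torsion_vec_def lie_bet swap lie_T_xi lie_self)
      (simp add: courant_form_def ev_Bf ev_fs ev_bet dir_simps dir_bet ev_lie_bet lie_T_xi lie_self ev_lie_swap[of _ \<xi> T]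
        lie_bracket_swap[of \<xi> T] fun_eq_iff scl_def field_simps)
qed

lemma torsion_form_forms_zero:
  assumes \<alpha>: "\<alpha> \<in> one_forms A" and \<gamma>: "\<gamma> \<in> one_forms A" and Z: "Z \<in> VF"
  shows "torsion_form (\<lambda>q. 0) \<alpha> (beta_map \<alpha>) (neg_phi_dual \<alpha>) (\<lambda>q. 0) \<gamma> (beta_map \<gamma>) (neg_phi_dual \<gamma>) Z p = 0"
  using \<alpha> \<gamma> Z
  by (simp add: torsion_form_def courant_form_def ev_Bf ev_fs ev_bet dir_simps dir_bet ev_lie_bet ev_phi_lie_bet lie_T_xi lie_xi_phi lie_T_phi field_simps)

end

context normal_adapted_structure
begin

text \<open>Bilinearity and skew symmetry reduce the claim to the three kinds of pairs treated above.\<close>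
lemma torsion_vec_zero:
  assumes s: "X \<in> VF" "\<alpha> \<in> one_forms A" and u: "Y \<in> VF" "\<gamma> \<in> one_forms A"
  shows "torsion_vec X \<alpha> (\<lambda>q. phi X q + beta_map \<alpha> q) (\<lambda>q z. B_map X q z + neg_phi_dual \<alpha> q z)
            Y \<gamma> (\<lambda>q. phi Y q + beta_map \<gamma> q) (\<lambda>q z. B_map Y q z + neg_phi_dual \<gamma> q z) p = 0"
proof -
  let ?O = "\<lambda>q. 0" and ?o = "\<lambda>q z. 0"
  have split: "torsion_vec X \<alpha> (\<lambda>q. phi X q + beta_map \<alpha> q) (\<lambda>q z. B_map X q z + neg_phi_dual \<alpha> q z) Y \<gamma> Y' \<gamma>' p =
      torsion_vec X ?o (phi X) (B_map X) Y \<gamma> Y' \<gamma>' p + torsion_vec ?O \<alpha> (beta_map \<alpha>) (neg_phi_dual \<alpha>) Y \<gamma> Y' \<gamma>' p"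
    if "X \<in> VF" "\<alpha> \<in> one_forms A" "Y \<in> VF" "\<gamma> \<in> one_forms A" "Y' \<in> VF" "\<gamma>' \<in> one_forms A" for X \<alpha> Y \<gamma> Y' \<gamma>'
    using torsion_vec_add_left[of X ?o "phi X" "B_map X" ?O \<alpha> "beta_map \<alpha>" "neg_phi_dual \<alpha>" Y \<gamma> Y' \<gamma>' p] that by simp
  have split': "torsion_vec X \<alpha> X' \<alpha>' Y \<gamma> (\<lambda>q. phi Y q + beta_map \<gamma> q) (\<lambda>q z. B_map Y q z + neg_phi_dual \<gamma> q z) p =
      torsion_vec X \<alpha> X' \<alpha>' Y ?o (phi Y) (B_map Y) p + torsion_vec X \<alpha> X' \<alpha>' ?O \<gamma> (beta_map \<gamma>) (neg_phi_dual \<gamma>) p"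
    if "X \<in> VF" "\<alpha> \<in> one_forms A" "X' \<in> VF" "\<alpha>' \<in> one_forms A" "Y \<in> VF" "\<gamma> \<in> one_forms A" for X \<alpha> X' \<alpha>' Y \<gamma>
  proof -
    let ?N = "\<lambda>Y \<gamma> Y' \<gamma>'. torsion_vec X \<alpha> X' \<alpha>' Y \<gamma> Y' \<gamma>' p"
    have "- ?N Y \<gamma> (\<lambda>q. phi Y q + beta_map \<gamma> q) (\<lambda>q z. B_map Y q z + neg_phi_dual \<gamma> q z) =
        - ?N Y ?o (phi Y) (B_map Y) - ?N ?O \<gamma> (beta_map \<gamma>) (neg_phi_dual \<gamma>)"
      using split[of Y \<gamma> X \<alpha> X' \<alpha>'] that by (simp add: torsion_vec_swap[of X \<alpha> X' \<alpha>'])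
    then have "- (- ?N Y \<gamma> (\<lambda>q. phi Y q + beta_map \<gamma> q) (\<lambda>q z. B_map Y q z + neg_phi_dual \<gamma> q z)) =
        - (- ?N Y ?o (phi Y) (B_map Y) - ?N ?O \<gamma> (beta_map \<gamma>) (neg_phi_dual \<gamma>))"
      by (rule arg_cong)
    then show ?thesis by (simp add: add.commute)
  qed
  have "torsion_vec ?O \<alpha> (beta_map \<alpha>) (neg_phi_dual \<alpha>) Y ?o (phi Y) (B_map Y) p = - torsion_vec Y ?o (phi Y) (B_map Y) ?O \<alpha> (beta_map \<alpha>) (neg_phi_dual \<alpha>) p"
    using s u by (intro torsion_vec_swap) simp_all
  then show ?thesis
    using s u by (simp add: split split' torsion_vec_vectors_zero torsion_vec_mixed_zero torsion_vec_forms_zero)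
qed

lemma torsion_form_zero:
  assumes s: "X \<in> VF" "\<alpha> \<in> one_forms A" and u: "Y \<in> VF" "\<gamma> \<in> one_forms A" and Z: "Z \<in> VF"
  shows "torsion_form X \<alpha> (\<lambda>q. phi X q + beta_map \<alpha> q) (\<lambda>q z. B_map X q z + neg_phi_dual \<alpha> q z)
            Y \<gamma> (\<lambda>q. phi Y q + beta_map \<gamma> q) (\<lambda>q z. B_map Y q z + neg_phi_dual \<gamma> q z) Z p = 0"
proof -
  let ?O = "\<lambda>q. 0" and ?o = "\<lambda>q z. 0"
  have split: "torsion_form X \<alpha> (\<lambda>q. phi X q + beta_map \<alpha> q) (\<lambda>q z. B_map X q z + neg_phi_dual \<alpha> q z) Y \<gamma> Y' \<gamma>' Z p =
      torsion_form X ?o (phi X) (B_map X) Y \<gamma> Y' \<gamma>' Z p + torsion_form ?O \<alpha> (beta_map \<alpha>) (neg_phi_dual \<alpha>) Y \<gamma> Y' \<gamma>' Z p"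
    if "X \<in> VF" "\<alpha> \<in> one_forms A" "Y \<in> VF" "\<gamma> \<in> one_forms A" "Y' \<in> VF" "\<gamma>' \<in> one_forms A" for X \<alpha> Y \<gamma> Y' \<gamma>'
    using torsion_form_add_left[of X ?o "phi X" "B_map X" ?O \<alpha> "beta_map \<alpha>" "neg_phi_dual \<alpha>" Y \<gamma> Y' \<gamma>' Z p] that Z by simp
  have split': "torsion_form X \<alpha> X' \<alpha>' Y \<gamma> (\<lambda>q. phi Y q + beta_map \<gamma> q) (\<lambda>q z. B_map Y q z + neg_phi_dual \<gamma> q z) Z p =
      torsion_form X \<alpha> X' \<alpha>' Y ?o (phi Y) (B_map Y) Z p + torsion_form X \<alpha> X' \<alpha>' ?O \<gamma> (beta_map \<gamma>) (neg_phi_dual \<gamma>) Z p"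
    if "X \<in> VF" "\<alpha> \<in> one_forms A" "X' \<in> VF" "\<alpha>' \<in> one_forms A" "Y \<in> VF" "\<gamma> \<in> one_forms A" for X \<alpha> X' \<alpha>' Y \<gamma>
    using split[of Y \<gamma> X \<alpha> X' \<alpha>'] that Z by (simp add: torsion_form_swap[of X \<alpha> X' \<alpha>'])
  have "torsion_form ?O \<alpha> (beta_map \<alpha>) (neg_phi_dual \<alpha>) Y ?o (phi Y) (B_map Y) Z p = - torsion_form Y ?o (phi Y) (B_map Y) ?O \<alpha> (beta_map \<alpha>) (neg_phi_dual \<alpha>) Z p"
    using s u Z by (intro torsion_form_swap) simp_all
  then show ?thesis
    using s u Z by (simp add: split split' torsion_form_vectors_zero torsion_form_mixed_zero torsion_form_forms_zero)
qed

lemma integrable: "courant_integrable A P"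
  unfolding courant_integrable_def
proof (intro ballI allI conjI)
  fix s u x assume s: "s \<in> gsections A" and u: "u \<in> gsections A"
  define X where "X = (\<lambda>p. fst (s p))"
  define \<alpha> where "\<alpha> = (\<lambda>p. snd (s p))"
  define Y where "Y = (\<lambda>p. fst (u p))"
  define \<gamma> where "\<gamma> = (\<lambda>p. snd (u p))"
  have su: "s = (\<lambda>q. (X q, \<alpha> q))" "u = (\<lambda>q. (Y q, \<gamma> q))"
    by (simp_all add: X_def \<alpha>_def Y_def \<gamma>_def)
  have mem: "X \<in> VF" "\<alpha> \<in> one_forms A" "Y \<in> VF" "\<gamma> \<in> one_forms A"
    using s u by (simp_all add: gsections_def X_def \<alpha>_def Y_def \<gamma>_def)
  show "fst (courant_nijenhuis A P s u x) = 0"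
    unfolding su fst_courant_nijenhuis[OF mem] by (rule torsion_vec_zero[OF mem])
  fix v assume "v \<in> TS x"
  then obtain Z where Z: "Z \<in> VF" "Z x = v" using field_through by metis
  show "snd (courant_nijenhuis A P s u x) v = 0"
    unfolding su Z(2)[symmetric] snd_courant_nijenhuis[OF mem Z(1)] by (rule torsion_form_zero[OF mem Z(1)])
qed

end

context adapted_structure
begin

theorem courant_integrable_iff: "courant_integrable A P \<longleftrightarrow> normal_paracontact A \<phi> \<xi> \<eta>"
proof
  assume "normal_paracontact A \<phi> \<xi> \<eta>"
  then interpret normal_adapted_structure A \<phi> \<xi> \<eta> T \<tau> by unfold_locales
  show "courant_integrable A P" by (rule integrable)
next
  assume int: "courant_integrable A P"
  show "normal_paracontact A \<phi> \<xi> \<eta>"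
    unfolding normal_paracontact_def
  proof (intro ballI allI)
    fix X Y p assume X: "X \<in> VF" and Y: "Y \<in> VF"
    have g: "(\<lambda>q. (X q, \<lambda>z. 0)) \<in> gsections A" "(\<lambda>q. (Y q, \<lambda>z. 0)) \<in> gsections A"
      using X Y by (simp_all add: gsections_def)
    define c where "c = ev \<tau> (lie_bracket X Y) p + (courant_form (phi X) (B_map X) Y (\<lambda>q z. 0) \<xi> p + courant_form X (\<lambda>q z. 0) (phi Y) (B_map Y) \<xi> p)"
    have "torsion_vec X (\<lambda>q z. 0) (phi X) (B_map X) Y (\<lambda>q z. 0) (phi Y) (B_map Y) p = 0"
      using int[unfolded courant_integrable_def, rule_format, OF g, THEN conjunct1, of p]
        fst_courant_nijenhuis[OF X zero_form Y zero_form, of p]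
      by (simp add: beta_map_def neg_phi_dual_def)
    then have eq: "nijenhuis \<phi> X Y p - scl (d_form \<eta> X Y p) (\<xi> p) + scl c (T p) = 0"
      unfolding torsion_vec_vectors[OF X Y] c_def .
    have nij: "nijenhuis \<phi> X Y p = lie_bracket (phi X) (phi Y) p + phi (phi (lie_bracket X Y)) p - phi (lie_bracket (phi X) Y) p - phi (lie_bracket X (phi Y)) p"
      by (simp add: nijenhuis_def phi_def)
    have tau_phi': "\<tau> p (phi W p) = 0" if "W \<in> VF" for W
      using that by (simp add: phi_def tau_phi)
    have "\<tau> p (lie_bracket (phi X) (phi Y) p) = 0"
      using ev_tau_lie[of "phi X" "phi Y" p] X Y by (simp add: ev_def[of _ "lie_bracket _ _"] dir_const)
    then have "\<tau> p (nijenhuis \<phi> X Y p) = 0"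
      using X Y by (simp add: nij form_plus form_minus tau_phi' field_tangent[OF phi_field] field_tangent[OF lie_bracket_field])
    moreover have "nijenhuis \<phi> X Y p \<in> TS p"
      using X Y by (simp add: nij field_tangent[OF phi_field] field_tangent[OF lie_bracket_field])
    moreover have "\<tau> p (nijenhuis \<phi> X Y p - scl (d_form \<eta> X Y p) (\<xi> p) + scl c (T p)) = 0"
      unfolding eq by (simp add: form_zero)
    \<comment> \<open>\<open>\<tau>\<close> kills \<open>N\<^sub>\<phi>\<close> and \<open>\<xi>\<close>, so it reads off the coefficient of \<open>T\<close>\<close>
    ultimately have "c = 0"
      by (simp add: form_plus form_minus form_scl tau_xi tau_T)
    then show "nijenhuis \<phi> X Y p - (\<lambda>f. d_form \<eta> X Y p * \<xi> p f) = 0"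
      using eq by (simp add: scl_def fun_eq_iff)
  qed
qed

end

section \<open>The normality tensor\<close>

context smooth_manifold
begin

definition defect :: "('m \<Rightarrow> 'm tangent \<Rightarrow> 'm tangent) \<Rightarrow> ('m \<Rightarrow> 'm tangent) \<Rightarrow> ('m \<Rightarrow> 'm cotangent) \<Rightarrow>
    ('m \<Rightarrow> 'm tangent) \<Rightarrow> ('m \<Rightarrow> 'm tangent) \<Rightarrow> ('m \<Rightarrow> 'm tangent)" where
  "defect \<phi> \<xi> \<eta> X Y p = nijenhuis \<phi> X Y p - scl (d_form \<eta> X Y p) (\<xi> p)"

lemma normal_paracontact_defect:
  "normal_paracontact A \<phi> \<xi> \<eta> \<longleftrightarrow> (\<forall>X\<in>VF. \<forall>Y\<in>VF. \<forall>p. defect \<phi> \<xi> \<eta> X Y p = 0)"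
  by (simp add: normal_paracontact_def defect_def scl_def)

lemma
  assumes \<phi>: "\<phi> \<in> endo_fields A" and \<eta>: "\<eta> \<in> one_forms A" and Z: "Z \<in> VF"
  shows defect_add: "X \<in> VF \<Longrightarrow> Y \<in> VF \<Longrightarrow>
      defect \<phi> \<xi> \<eta> (\<lambda>q. X q + Y q) Z p = defect \<phi> \<xi> \<eta> X Z p + defect \<phi> \<xi> \<eta> Y Z p"
    and defect_scl: "a \<in> C \<Longrightarrow> X \<in> VF \<Longrightarrow>
      defect \<phi> \<xi> \<eta> (\<lambda>q. scl (a q) (X q)) Z p = scl (a p) (defect \<phi> \<xi> \<eta> X Z p)"
    and defect_swap: "X \<in> VF \<Longrightarrow> defect \<phi> \<xi> \<eta> X Z p = - defect \<phi> \<xi> \<eta> Z X p"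
proof -
  note \<phi>Z = endo_field[OF \<phi> Z]
  note lin = endo_plus[OF \<phi>] endo_minus[OF \<phi>] endo_scl[OF \<phi>] endo_field[OF \<phi>] endo_tangent[OF \<phi>]
    form_plus[OF \<eta>] form_minus[OF \<eta>] form_scl[OF \<eta>] form_smooth[OF \<eta>]
  show "defect \<phi> \<xi> \<eta> (\<lambda>q. X q + Y q) Z p = defect \<phi> \<xi> \<eta> X Z p + defect \<phi> \<xi> \<eta> Y Z p"
    if X: "X \<in> VF" and Y: "Y \<in> VF"
  proof -
    have "nijenhuis \<phi> (\<lambda>q. X q + Y q) Z p = nijenhuis \<phi> X Z p + nijenhuis \<phi> Y Z p"
      using X Y Z \<phi>Z by (simp add: nijenhuis_def lin lie_bracket_plus_left)
    moreover have "d_form \<eta> (\<lambda>q. X q + Y q) Z p = d_form \<eta> X Z p + d_form \<eta> Y Z p"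
      using X Y Z by (simp add: d_form_def lin lie_bracket_plus_left tangent_add[OF field_tangent[OF Z]])
    ultimately show ?thesis by (simp add: defect_def fun_eq_iff scl_def algebra_simps)
  qed
  show "defect \<phi> \<xi> \<eta> (\<lambda>q. scl (a q) (X q)) Z p = scl (a p) (defect \<phi> \<xi> \<eta> X Z p)"
    if a: "a \<in> C" and X: "X \<in> VF"
  proof -
    have "nijenhuis \<phi> (\<lambda>q. scl (a q) (X q)) Z p = scl (a p) (nijenhuis \<phi> X Z p)"
      using a X Z \<phi>Z by (simp add: nijenhuis_def lin lie_bracket_scl_left) (simp add: fun_eq_iff scl_def algebra_simps)
    moreover have "d_form \<eta> (\<lambda>q. scl (a q) (X q)) Z p = a p * d_form \<eta> X Z p"
      using a X Z by (simp add: d_form_def lin lie_bracket_scl_left tangent_mult[OF field_tangent[OF Z]])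
        (simp add: scl_def algebra_simps)
    ultimately show ?thesis by (simp add: defect_def fun_eq_iff scl_def algebra_simps)
  qed
  show "defect \<phi> \<xi> \<eta> X Z p = - defect \<phi> \<xi> \<eta> Z X p" if X: "X \<in> VF"
  proof -
    note swap = lie_bracket_swap[of X] lie_bracket_swap[of "\<lambda>q. \<phi> q (X q)"]
    have "nijenhuis \<phi> X Z p = - nijenhuis \<phi> Z X p"
      using X Z \<phi>Z by (simp add: nijenhuis_def swap endo_uminus[OF \<phi>] lin)
    moreover have "d_form \<eta> X Z p = - d_form \<eta> Z X p"
      using X Z by (simp add: d_form_def swap form_uminus[OF \<eta>])
    ultimately show ?thesis by (simp add: defect_def fun_eq_iff scl_def)
  qed
qed

end

section \<open>The product with the real line\<close>

text \<open>The chart maps of the product with the line, written with projections so that values at variables that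
are not explicit pairs simplify.\<close>
definition line_map :: "('m \<Rightarrow> 'e) \<Rightarrow> 'm \<times> real \<Rightarrow> 'e \<times> real" where
  "line_map \<kappa> x = (\<kappa> (fst x), snd x)"

context smooth_manifold
begin

lemma line_chart_iff: "(W, \<psi>) \<in> line_atlas A \<longleftrightarrow> (\<exists>U \<kappa>. (U, \<kappa>) \<in> A \<and> W = U \<times> UNIV \<and> \<psi> = line_map \<kappa>)"
proof -
  have "line_map \<kappa> = (\<lambda>(p, t). (\<kappa> p, t))" for \<kappa> :: "'m \<Rightarrow> 'e"
    by (simp add: fun_eq_iff line_map_def)
  then show ?thesis unfolding line_atlas_def by auto
qed

lemma line_map_image: "line_map \<kappa> ` (U \<times> UNIV) = \<kappa> ` U \<times> UNIV"
proof (intro equalityI subsetI)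
  fix z assume "z \<in> \<kappa> ` U \<times> (UNIV :: real set)"
  then obtain q s where "q \<in> U" "z = line_map \<kappa> (q, s)" by (auto simp: line_map_def)
  then show "z \<in> line_map \<kappa> ` (U \<times> UNIV)" by blast
qed (auto simp: line_map_def)

lemma line_map_inv:
  assumes "(U, \<kappa>) \<in> A" "y \<in> \<kappa> ` U"
  shows "inv_into (U \<times> UNIV) (line_map \<kappa>) (y, s) = (inv_into U \<kappa> y, s)"
proof -
  obtain q where q: "q \<in> U" "y = \<kappa> q" using assms(2) by blast
  have "inj_on (line_map \<kappa>) (U \<times> UNIV)"
    using chart_inj[OF assms(1)] by (auto simp: inj_on_def line_map_def)
  then have "inv_into (U \<times> UNIV) (line_map \<kappa>) (line_map \<kappa> (q, s)) = (q, s)"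
    using q(1) by (intro inv_into_f_f) auto
  then show ?thesis using q by (simp add: line_map_def chart_inv[OF assms(1)])
qed

lemma line_chart:
  assumes "(U, \<kappa>) \<in> A"
  shows "is_chart (U \<times> UNIV, line_map \<kappa>)"
proof -
  have "homeomorphism (U \<times> UNIV) (\<kappa> ` U \<times> UNIV) (line_map \<kappa>) (\<lambda>x. (inv_into U \<kappa> (fst x), snd x))"
    unfolding homeomorphism_def
  proof (intro conjI ballI)
    show "continuous_on (U \<times> UNIV) (line_map \<kappa>)"
      unfolding line_map_def
      by (intro continuous_intros continuous_on_compose2[OF chart_continuous[OF assms]]) auto
    show "continuous_on (\<kappa> ` U \<times> UNIV) (\<lambda>x. (inv_into U \<kappa> (fst x), snd x))"
      by (intro continuous_intros continuous_on_compose2[OF chart_inv_continuous[OF assms]]) auto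
  qed (force simp: line_map_def chart_inv[OF assms] image_iff)+
  then show ?thesis
    using chart_open[OF assms] chart_open_image[OF assms]
    by (auto simp: is_chart_def line_map_image open_Times)
qed

lemma line_atlas_smooth: "smooth_atlas (line_atlas A)"
  unfolding smooth_atlas_def
proof (intro conjI ballI)
  have "x \<in> (\<Union>(W, \<psi>)\<in>line_atlas A. W)" for x
  proof -
    obtain U \<kappa> where "(U, \<kappa>) \<in> A" "fst x \<in> U" using chart_exists by blast
    then have "(U \<times> UNIV, line_map \<kappa>) \<in> line_atlas A" "x \<in> U \<times> UNIV"
      by (auto simp: line_chart_iff mem_Times_iff)
    then show ?thesis by blast
  qed
  then show "(\<Union>(W, \<psi>)\<in>line_atlas A. W) = UNIV" by blast
  show "is_chart c" if "c \<in> line_atlas A" for c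
    using that by (cases c) (auto simp: line_chart_iff line_chart)
  show "case c of (W, \<psi>) \<Rightarrow> \<forall>(W', \<psi>')\<in>line_atlas A. smooth_on (\<psi> ` (W \<inter> W')) (\<psi>' \<circ> inv_into W \<psi>)"
    if "c \<in> line_atlas A" for c
  proof -
    have "smooth_on (\<psi> ` (W \<inter> W')) (\<psi>' \<circ> inv_into W \<psi>)"
      if c1: "(W, \<psi>) \<in> line_atlas A" and c2: "(W', \<psi>') \<in> line_atlas A" for W \<psi> W' \<psi>'
    proof -
      obtain U \<kappa> where U: "(U, \<kappa>) \<in> A" "W = U \<times> UNIV" "\<psi> = line_map \<kappa>"
        using c1 unfolding line_chart_iff by blast
      obtain U' \<kappa>' where U': "(U', \<kappa>') \<in> A" "W' = U' \<times> UNIV" "\<psi>' = line_map \<kappa>'"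
        using c2 unfolding line_chart_iff by blast
      have img: "\<psi> ` (W \<inter> W') = \<kappa> ` (U \<inter> U') \<times> UNIV"
        using line_map_image[of \<kappa> "U \<inter> U'"] by (simp add: U U' Times_Int_Times)
      have op: "open (\<kappa> ` (U \<inter> U') \<times> (UNIV :: real set))"
        by (intro open_Times chart_open_map U(1) chart_open[OF U'(1)] open_UNIV)
      have "smooth_on (\<kappa> ` (U \<inter> U') \<times> (UNIV :: real set)) (\<lambda>z. (\<kappa>' (inv_into U \<kappa> (fst z)), snd z))"
        by (intro smooth_on_Pair op smooth_on_compose[OF op transition_smooth[OF U'(1) U(1)]]
             smooth_on_fst smooth_on_snd smooth_on_ident) auto
      then show ?thesis
        unfolding img
        by (rule smooth_on_cong[OF op, rotated])
          (auto simp: U U' line_map_inv[OF U(1)] line_map_def[of \<kappa>'])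
    qed
    then show ?thesis using that by (cases c) auto
  qed
qed

lemma line_manifold: "smooth_manifold (line_atlas A)"
  by unfold_locales (rule line_atlas_smooth)

interpretation L: smooth_manifold "line_atlas A"
  by (rule line_manifold)

lemma line_fun_smooth:
  assumes "g \<in> L.C" "(U, \<kappa>) \<in> A"
  shows "smooth_on (\<kappa> ` U \<times> UNIV) (\<lambda>z. g (inv_into U \<kappa> (fst z), snd z))"
proof -
  have "(U \<times> UNIV, line_map \<kappa>) \<in> line_atlas A" using assms(2) by (auto simp: line_chart_iff)
  from L.smooth_funD[OF assms(1) this]
  have "smooth_on (\<kappa> ` U \<times> UNIV) (\<lambda>y. g (inv_into (U \<times> UNIV) (line_map \<kappa>) y))"
    by (simp add: line_map_image)
  then show ?thesis
    by (rule smooth_on_cong[rotated 2])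
      (auto simp: line_map_inv[OF assms(2)] intro!: open_Times chart_open_image assms(2))
qed

lemma line_funI:
  assumes "\<And>U \<kappa>. (U, \<kappa>) \<in> A \<Longrightarrow> smooth_on (\<kappa> ` U \<times> UNIV) (\<lambda>z. g (inv_into U \<kappa> (fst z), snd z))"
  shows "g \<in> L.C"
proof (rule L.smooth_funI)
  fix W \<psi> assume "(W, \<psi>) \<in> line_atlas A"
  then obtain U \<kappa> where U: "(U, \<kappa>) \<in> A" "W = U \<times> UNIV" "\<psi> = line_map \<kappa>"
    unfolding line_chart_iff by blast
  show "smooth_on (\<psi> ` W) (\<lambda>y. g (inv_into W \<psi> y))"
    unfolding U(2,3) line_map_image
    by (rule smooth_on_cong[OF _ _ assms[OF U(1)]])
      (auto simp: line_map_inv[OF U(1)] intro!: open_Times chart_open_image U(1))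
qed

lemma pullback_fst: "f \<in> C \<Longrightarrow> (\<lambda>x. f (fst x)) \<in> L.C"
proof (rule line_funI)
  fix U \<kappa> assume f: "f \<in> C" and U: "(U, \<kappa>) \<in> A"
  have op: "open (\<kappa> ` U \<times> (UNIV :: real set))" by (intro open_Times chart_open_image U open_UNIV)
  show "smooth_on (\<kappa> ` U \<times> UNIV) (\<lambda>z. f (fst (inv_into U \<kappa> (fst z), snd z :: real)))"
    unfolding fst_conv
    by (rule smooth_on_compose[OF op smooth_funD[OF f U] smooth_on_fst[OF op smooth_on_ident]]) auto
qed

lemma snd_smooth: "snd \<in> L.C"
proof (rule line_funI)
  fix U \<kappa> assume U: "(U, \<kappa>) \<in> A"
  have op: "open (\<kappa> ` U \<times> (UNIV :: real set))" by (intro open_Times chart_open_image U open_UNIV)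
  show "smooth_on (\<kappa> ` U \<times> UNIV) (\<lambda>z. snd (inv_into U \<kappa> (fst z), snd z :: real))"
    unfolding snd_conv by (rule smooth_on_snd[OF op smooth_on_ident])
qed

lemma slice_smooth: "g \<in> L.C \<Longrightarrow> (\<lambda>p. g (p, t)) \<in> C"
proof (rule smooth_funI)
  fix U \<kappa> assume g: "g \<in> L.C" and U: "(U, \<kappa>) \<in> A"
  have op: "open (\<kappa> ` U)" by (rule chart_open_image[OF U])
  have "smooth_on (\<kappa> ` U) (\<lambda>y. (\<lambda>z. g (inv_into U \<kappa> (fst z), snd z)) (y, t))"
    by (rule smooth_on_compose[OF op line_fun_smooth[OF g U]])
      (auto intro!: smooth_on_Pair op smooth_on_ident smooth_on_const)
  then show "smooth_on (\<kappa> ` U) (\<lambda>y. g (inv_into U \<kappa> y, t))" by simp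
qed

lemma line_deriv:
  assumes g: "g \<in> L.C" and U: "(U, \<kappa>) \<in> A" "p \<in> U"
  shows "((\<lambda>s. g (p, s)) has_field_derivative
    frechet_derivative (\<lambda>z. g (inv_into U \<kappa> (fst z), snd z)) (at (\<kappa> p, t)) (0, 1)) (at t)"
proof -
  let ?G = "\<lambda>z. g (inv_into U \<kappa> (fst z), snd z)"
  have G: "(?G has_derivative frechet_derivative ?G (at (\<kappa> p, t))) (at (\<kappa> p, t))"
    using smooth_on_differentiable[OF line_fun_smooth[OF g U(1)], of "(\<kappa> p, t)"] U(2)
    by (simp add: frechet_derivative_works)
  interpret bounded_linear "frechet_derivative ?G (at (\<kappa> p, t))"
    using G by (rule has_derivative_bounded_linear)
  have "((\<lambda>s. (\<kappa> p, s)) has_derivative (\<lambda>h. (0, h))) (at t)"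
    by (auto intro!: derivative_eq_intros)
  from has_derivative_compose[OF this G]
  have "((\<lambda>s. g (p, s)) has_derivative (\<lambda>h. frechet_derivative ?G (at (\<kappa> p, t)) (0, h))) (at t)"
    by (simp add: chart_inv[OF U])
  moreover have "(\<lambda>h. frechet_derivative ?G (at (\<kappa> p, t)) (0, h)) = (*) (frechet_derivative ?G (at (\<kappa> p, t)) (0, 1))"
  proof
    fix h :: real
    show "frechet_derivative ?G (at (\<kappa> p, t)) (0, h) = frechet_derivative ?G (at (\<kappa> p, t)) (0, 1) * h"
      using scale[of h "(0, 1)"] by (simp add: mult.commute)
  qed
  ultimately show ?thesis unfolding has_field_derivative_def by (rule back_subst[where P = "\<lambda>f'. (_ has_derivative f') _"])
qed

lemma line_deriv_deriv:
  assumes "g \<in> L.C"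
  shows "((\<lambda>s. g (p, s)) has_field_derivative deriv (\<lambda>s. g (p, s)) t) (at t)"
proof -
  obtain U \<kappa> where U: "(U, \<kappa>) \<in> A" "p \<in> U" using chart_exists by blast
  show ?thesis using line_deriv[OF assms U, of t] DERIV_imp_deriv[OF line_deriv[OF assms U, of t]] by simp
qed

lemma d_dt_apply: "g \<in> L.C \<Longrightarrow> d_dt A x g = deriv (\<lambda>s. g (fst x, s)) (snd x)"
  by (simp add: d_dt_def split_beta)

lemma d_dt_field: "d_dt A \<in> L.VF"
proof (rule L.fieldI)
  fix x show "d_dt A x \<in> L.TS x"
  proof (rule L.tangentI)
    fix f g assume f: "f \<in> L.C" and g: "g \<in> L.C"
    note d = line_deriv_deriv[OF f, of "fst x" "snd x"] line_deriv_deriv[OF g, of "fst x" "snd x"]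
    show "d_dt A x (\<lambda>q. f q + g q) = d_dt A x f + d_dt A x g"
      using f g DERIV_imp_deriv[OF DERIV_add[OF d]] by (simp add: d_dt_apply)
    show "d_dt A x (\<lambda>q. f q * g q) = f x * d_dt A x g + g x * d_dt A x f"
      using f g DERIV_imp_deriv[OF DERIV_mult[OF d]] by (simp add: d_dt_apply algebra_simps)
  next
    fix c f assume f: "f \<in> L.C"
    show "d_dt A x (\<lambda>q. c * f q) = c * d_dt A x f"
      using f DERIV_imp_deriv[OF DERIV_cmult[OF line_deriv_deriv[OF f, of "fst x" "snd x"], of c]] by (simp add: d_dt_apply)
  qed (simp add: d_dt_def split_beta)
next
  fix g assume g: "g \<in> L.C"
  show "(\<lambda>x. d_dt A x g) \<in> L.C"
  proof (rule line_funI)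
    fix U \<kappa> assume U: "(U, \<kappa>) \<in> A"
    have op: "open (\<kappa> ` U \<times> (UNIV :: real set))" by (intro open_Times chart_open_image U open_UNIV)
    show "smooth_on (\<kappa> ` U \<times> UNIV) (\<lambda>z. d_dt A (inv_into U \<kappa> (fst z), snd z) g)"
      by (rule smooth_on_cong[OF op _ smooth_on_frechet_derivative[OF line_fun_smooth[OF g U], of "(0, 1)"]])
        (auto simp: d_dt_apply g chart_inv[OF U] DERIV_imp_deriv[OF line_deriv[OF g U]])
  qed
qed

lemma slice_push_apply: "g \<in> L.C \<Longrightarrow> slice_push A t v g = v (\<lambda>p. g (p, t))"
  by (simp add: slice_push_def differential_def o_def)

lemma slice_push_nonsmooth: "g \<notin> L.C \<Longrightarrow> slice_push A t v g = 0"
  by (simp add: slice_push_def differential_def)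

lemma proj_push_apply: "f \<in> C \<Longrightarrow> proj_push A w f = w (\<lambda>x. f (fst x))"
  by (simp add: proj_push_def differential_def o_def)

lemma proj_push_nonsmooth: "f \<notin> C \<Longrightarrow> proj_push A w f = 0"
  by (simp add: proj_push_def differential_def)

lemma slice_push_tangent:
  assumes "v \<in> TS p" shows "slice_push A t v \<in> L.TS (p, t)"
  by (rule L.tangentI)
    (simp_all add: slice_push_apply slice_push_nonsmooth slice_smooth tangent_add[OF assms] tangent_cmult[OF assms] tangent_mult[OF assms])

lemma proj_push_tangent:
  assumes "w \<in> L.TS x" shows "proj_push A w \<in> TS (fst x)"
  by (rule tangentI)
    (simp_all add: proj_push_apply proj_push_nonsmooth pullback_fst L.tangent_add[OF assms] L.tangent_cmult[OF assms] L.tangent_mult[OF assms])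

lemma push_linear:
  "slice_push A t (v + w) = slice_push A t v + slice_push A t w"
  "slice_push A t (v - w) = slice_push A t v - slice_push A t w"
  "slice_push A t (scl c v) = scl c (slice_push A t v)"
  "proj_push A (v' + w') = proj_push A v' + proj_push A w'"
  "proj_push A (scl c v') = scl c (proj_push A v')"
  "slice_push A t 0 = 0"
  by (auto simp: slice_push_def proj_push_def differential_def scl_def fun_eq_iff)

lemma slice_push_Sum: "slice_push A t (\<Sum>i\<in>I. v i) = (\<Sum>i\<in>I. slice_push A t (v i))"
  by (rule ext) (simp add: slice_push_def differential_def sum_fun_apply)

lemma proj_slice: "v \<in> TS p \<Longrightarrow> proj_push A (slice_push A t v) = v"
proof
  fix f assume v: "v \<in> TS p"
  show "proj_push A (slice_push A t v) f = v f"
    by (cases "f \<in> C") (simp_all add: proj_push_apply proj_push_nonsmooth slice_push_apply pullback_fst tangent_nonsmooth[OF v])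
qed

lemma proj_d_dt: "proj_push A (d_dt A x) = 0"
proof
  fix f show "proj_push A (d_dt A x) f = 0 f"
    by (cases "f \<in> C") (simp_all add: proj_push_apply proj_push_nonsmooth d_dt_apply pullback_fst)
qed

lemma slice_push_snd: "v \<in> TS p \<Longrightarrow> slice_push A t v snd = 0"
  by (simp add: slice_push_apply snd_smooth tangent_const)

lemma d_dt_snd: "d_dt A x snd = 1"
  by (simp add: d_dt_apply snd_smooth)

lemma line_cutoff:
  assumes "cutoff U \<kappa> V K h"
  shows "L.cutoff (U \<times> UNIV) (line_map \<kappa>) (V \<times> UNIV) (K \<times> UNIV) (\<lambda>x. h (fst x))"
  using assms unfolding cutoff_def L.cutoff_def line_map_image
  by (auto simp: line_chart_iff open_Times closed_Times convex_Times pullback_fst line_map_def)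

text \<open>The coordinate functions of a product chart, cut off by a function lifted from \<open>M\<close>, are lifts of
functions on \<open>M\<close> or such a lift times \<open>t\<close>. A derivation that kills lifts and \<open>t\<close> therefore kills all
coefficients of its expansion in the frame. This replaces symmetry of second
derivatives: identities between brackets on the product need only be tested on lifts and on \<open>t\<close>.\<close>
lemma line_tangent_eq_0:
  assumes u: "u \<in> L.TS x" and fst0: "\<And>f. f \<in> C \<Longrightarrow> u (\<lambda>x. f (fst x)) = 0" and snd0: "u snd = 0"
  shows "u = 0"
proof
  fix g show "u g = 0 g"
  proof (cases "g \<in> L.C")
    case True
    obtain U \<kappa> V K h where cut: "cutoff U \<kappa> V K h" and hp: "h (fst x) \<noteq> 0" using cutoff_exists by blast
    have h: "h \<in> C" using cut by (simp add: cutoff_def)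
    have "u (\<lambda>x. h (fst x) * (line_map \<kappa> x \<bullet> b)) = 0" for b
    proof -
      have "(\<lambda>x. h (fst x) * (line_map \<kappa> x \<bullet> b)) =
          (\<lambda>x. (\<lambda>p. h p * (\<kappa> p \<bullet> fst b)) (fst x) + snd b * (h (fst x) * snd x))"
        by (simp add: line_map_def inner_prod_def fun_eq_iff algebra_simps)
      then show ?thesis
        using pullback_fst[OF cutoff_coordinate[OF cut]] pullback_fst[OF h] snd_smooth
        by (simp add: L.tangent_add[OF u] L.tangent_cmult[OF u] L.tangent_mult[OF u] fst0[OF h] fst0[OF cutoff_coordinate[OF cut]] snd0)
    qed
    then have "h (fst x) ^ 2 * u g = 0"
      using L.cutoff_expansion[OF line_cutoff[OF cut] u True] by (simp add: fst0[OF h])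
    then show ?thesis using hp by simp
  qed (simp add: L.tangent_nonsmooth[OF u])
qed

lemma line_tangent_eqI:
  assumes u: "u \<in> L.TS x" and w: "w \<in> L.TS x"
    and fst: "\<And>f. f \<in> C \<Longrightarrow> u (\<lambda>x. f (fst x)) = w (\<lambda>x. f (fst x))" and snd: "u snd = w snd"
  shows "u = w"
proof -
  have "u - w = 0"
    by (rule line_tangent_eq_0[of _ x]) (simp_all add: u w fst snd)
  then show ?thesis by simp
qed

lemma line_tangent_split:
  assumes w: "w \<in> L.TS (p, t)"
  shows "w = slice_push A t (proj_push A w) + scl (w snd) (d_dt A (p, t))"
proof (rule line_tangent_eqI[OF w])
  have v: "proj_push A w \<in> TS p" using proj_push_tangent[OF w] by simp
  show "slice_push A t (proj_push A w) + scl (w snd) (d_dt A (p, t)) \<in> L.TS (p, t)"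
    by (intro L.tangent_plus L.tangent_scl slice_push_tangent v L.field_tangent d_dt_field)
  show "w snd = (slice_push A t (proj_push A w) + scl (w snd) (d_dt A (p, t))) snd"
    by (simp add: slice_push_snd[OF v] scl_def d_dt_snd)
  fix f assume f: "f \<in> C"
  show "w (\<lambda>x. f (fst x)) = (slice_push A t (proj_push A w) + scl (w snd) (d_dt A (p, t))) (\<lambda>x. f (fst x))"
    using f by (simp add: slice_push_apply pullback_fst proj_push_apply scl_def d_dt_apply)
qed

section \<open>Lifts of fields, forms and endomorphisms\<close>

lemma lift_field_apply: "lift_field A X x = slice_push A (snd x) (X (fst x))"
  by (simp add: lift_field_def split_beta)

lemma lift_form_apply: "lift_form A \<alpha> x w = \<alpha> (fst x) (proj_push A w)"
  by (simp add: lift_form_def split_beta)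

lemma lift_endo_apply: "lift_endo A \<phi> x w = slice_push A (snd x) (\<phi> (fst x) (proj_push A w))"
  by (simp add: lift_endo_def split_beta)

lemma cutoff_partial_slice:
  assumes cut: "cutoff U \<kappa> V K h" and g: "g \<in> L.C"
  shows "cutoff_partial U \<kappa> h b q (\<lambda>p. g (p, s)) =
    L.cutoff_partial (U \<times> UNIV) (line_map \<kappa>) (\<lambda>x. h (fst x)) (b, 0) (q, s) g"
proof (cases "q \<in> K")
  case False
  then have "h q = 0" using cut by (simp add: cutoff_def)
  then show ?thesis by (simp add: cutoff_partial_def L.cutoff_partial_def)
next
  case True
  then have U: "(U, \<kappa>) \<in> A" "q \<in> U" using cut by (auto simp: cutoff_def)
  have W: "(U \<times> UNIV, line_map \<kappa>) \<in> line_atlas A" using U(1) unfolding line_chart_iff by blast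
  let ?G = "\<lambda>z. g (inv_into (U \<times> UNIV) (line_map \<kappa>) z)"
  have G: "(?G has_derivative frechet_derivative ?G (at (\<kappa> q, s))) (at (\<kappa> q, s))"
    using smooth_on_differentiable[OF L.smooth_funD[OF g W], of "(\<kappa> q, s)"] U(2)
    by (simp add: line_map_image frechet_derivative_works)
  have "((\<lambda>y. (y, s)) has_derivative (\<lambda>v. (v, 0))) (at (\<kappa> q))"
    by (auto intro!: derivative_eq_intros)
  from has_derivative_compose[OF this G]
  have "((\<lambda>y. ?G (y, s)) has_derivative (\<lambda>v. frechet_derivative ?G (at (\<kappa> q, s)) (v, 0))) (at (\<kappa> q))" .
  then have "((\<lambda>y. g (inv_into U \<kappa> y, s)) has_derivative (\<lambda>v. frechet_derivative ?G (at (\<kappa> q, s)) (v, 0))) (at (\<kappa> q))"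
    by (rule has_derivative_transform_within_open[OF _ chart_open_image[OF U(1)]])
      (use U in \<open>auto simp: line_map_inv[OF U(1)]\<close>)
  then show ?thesis
    using g by (simp add: cutoff_partial_def L.cutoff_partial_def slice_smooth frechet_derivative_at[symmetric] line_map_def)
qed

lemma lift_field_field:
  assumes X: "X \<in> VF" shows "lift_field A X \<in> L.VF"
proof (rule L.fieldI)
  show "lift_field A X x \<in> L.TS x" for x
    using slice_push_tangent[OF field_tangent[OF X, of "fst x"], of "snd x"] by (simp add: lift_field_apply)
  fix g assume g: "g \<in> L.C"
  show "(\<lambda>x. lift_field A X x g) \<in> L.C"
  proof (rule L.smooth_fun_local_division)
    fix x :: "'m \<times> real"
    obtain U \<kappa> V K h where cut: "cutoff U \<kappa> V K h" and hp: "h (fst x) \<noteq> 0" using cutoff_exists by blast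
    have h: "h \<in> C" using cut by (simp add: cutoff_def)
    define a where "a = (\<lambda>b q. h q * X q (\<lambda>x. h x * (\<kappa> x \<bullet> b)) - h q * (\<kappa> q \<bullet> b) * X q h)"
    have a: "a b \<in> C" for b
      unfolding a_def
      by (rule smooth_fun_diff[OF smooth_fun_mult[OF h field_smooth[OF X cutoff_coordinate[OF cut]]]
            smooth_fun_mult[OF cutoff_coordinate[OF cut] field_smooth[OF X h]]])
    define E where "E = (\<lambda>b. L.cutoff_partial (U \<times> UNIV) (line_map \<kappa>) (\<lambda>x. h (fst x)) (b, 0))"
    have E: "E b \<in> L.VF" for b
      unfolding E_def by (rule L.cutoff_partial_field[OF line_cutoff[OF cut]])
    have "h (fst y) ^ 3 * lift_field A X y g = (\<Sum>b\<in>Basis. a b (fst y) * E b y g)" for y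
    proof -
      have "h (fst y) ^ 3 * lift_field A X y g = scl (h (fst y) ^ 3) (X (fst y)) (\<lambda>p. g (p, snd y))"
        by (simp add: lift_field_apply slice_push_apply g scl_def)
      also have "\<dots> = (\<Sum>b\<in>Basis. a b (fst y) * cutoff_partial U \<kappa> h b (fst y) (\<lambda>p. g (p, snd y)))"
        using fun_cong[OF frame_expansion[OF cut field_tangent[OF X, of "fst y"]], of "\<lambda>p. g (p, snd y)"]
        by (simp add: a_def sum_fun_apply scl_def)
      also have "\<dots> = (\<Sum>b\<in>Basis. a b (fst y) * E b y g)"
        by (simp add: cutoff_partial_slice[OF cut g] E_def)
      finally show ?thesis .
    qed
    moreover have "(\<lambda>y. \<Sum>b\<in>Basis. a b (fst y) * E b y g) \<in> L.C"
      by (intro L.smooth_fun_sum L.smooth_fun_mult pullback_fst a L.field_smooth[OF E g])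
    ultimately show "\<exists>h\<in>L.C. h x \<noteq> 0 \<and> (\<lambda>y. h y * lift_field A X y g) \<in> L.C"
      using hp by (intro bexI[of _ "\<lambda>y. h (fst y) ^ 3"]) (simp_all add: pullback_fst[OF h])
  qed
qed

text \<open>The frame expansion of the projection to \<open>M\<close> of a field on the product; the coefficients depend on
\<open>t\<close> too.\<close>
lemma push_frame_expansion:
  assumes cut: "cutoff U \<kappa> V K h" and X: "X \<in> L.VF"
  obtains a where "\<And>b. a b \<in> L.C"
    and "\<And>y. scl (h (fst y) ^ 3) (proj_push A (X y)) = (\<Sum>b\<in>Basis. scl (a b y) (cutoff_partial U \<kappa> h b (fst y)))"
proof
  have h: "h \<in> C" using cut by (simp add: cutoff_def)
  define a where "a = (\<lambda>b y. h (fst y) * X y (\<lambda>x. h (fst x) * (\<kappa> (fst x) \<bullet> b)) - h (fst y) * (\<kappa> (fst y) \<bullet> b) * X y (\<lambda>x. h (fst x)))"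
  have hL: "(\<lambda>x. h (fst x)) \<in> L.C" and cL: "(\<lambda>x. h (fst x) * (\<kappa> (fst x) \<bullet> b)) \<in> L.C" for b
    by (rule pullback_fst[OF h], rule pullback_fst[OF cutoff_coordinate[OF cut, of b]])
  show "a b \<in> L.C" for b
    unfolding a_def
    by (rule L.smooth_fun_diff[OF L.smooth_fun_mult[OF hL L.field_smooth[OF X cL]] L.smooth_fun_mult[OF cL L.field_smooth[OF X hL]]])
  show "scl (h (fst y) ^ 3) (proj_push A (X y)) = (\<Sum>b\<in>Basis. scl (a b y) (cutoff_partial U \<kappa> h b (fst y)))" for y
    unfolding frame_expansion[OF cut proj_push_tangent[OF L.field_tangent[OF X]]] a_def
    by (simp add: proj_push_apply h cutoff_coordinate[OF cut])
qed

lemma lift_form_form: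
  assumes \<alpha>: "\<alpha> \<in> one_forms A" shows "lift_form A \<alpha> \<in> one_forms (line_atlas A)"
proof (rule L.formI)
  fix X assume X: "X \<in> L.VF"
  show "(\<lambda>x. lift_form A \<alpha> x (X x)) \<in> L.C"
  proof (rule L.smooth_fun_local_division)
    fix x :: "'m \<times> real"
    obtain U \<kappa> V K h where cut: "cutoff U \<kappa> V K h" and hp: "h (fst x) \<noteq> 0" using cutoff_exists by blast
    have h: "h \<in> C" using cut by (simp add: cutoff_def)
    obtain a where a: "\<And>b. a b \<in> L.C"
      and ex: "\<And>y. scl (h (fst y) ^ 3) (proj_push A (X y)) = (\<Sum>b\<in>Basis. scl (a b y) (cutoff_partial U \<kappa> h b (fst y)))"
      by (rule push_frame_expansion[OF cut X]) blast
    note E = cutoff_partial_field[OF cut]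
    have "h (fst y) ^ 3 * lift_form A \<alpha> y (X y) = (\<Sum>b\<in>Basis. a b y * ev \<alpha> (cutoff_partial U \<kappa> h b) (fst y))" for y
    proof -
      have "h (fst y) ^ 3 * lift_form A \<alpha> y (X y) = \<alpha> (fst y) (scl (h (fst y) ^ 3) (proj_push A (X y)))"
        by (simp add: lift_form_apply form_scl[OF \<alpha> proj_push_tangent[OF L.field_tangent[OF X]]])
      then show ?thesis
        unfolding ex by (simp add: form_Sum[OF \<alpha>] form_scl[OF \<alpha>] field_tangent[OF E] ev_def)
    qed
    moreover have "(\<lambda>y. \<Sum>b\<in>Basis. a b y * ev \<alpha> (cutoff_partial U \<kappa> h b) (fst y)) \<in> L.C"
      by (intro L.smooth_fun_sum L.smooth_fun_mult pullback_fst a ev_smooth \<alpha> E)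
    ultimately show "\<exists>h\<in>L.C. h x \<noteq> 0 \<and> (\<lambda>y. h y * lift_form A \<alpha> y (X y)) \<in> L.C"
      using hp by (intro bexI[of _ "\<lambda>y. h (fst y) ^ 3"]) (simp_all add: pullback_fst[OF h])
  qed
qed (simp_all add: lift_form_apply push_linear form_plus[OF \<alpha>] form_scl[OF \<alpha>] proj_push_tangent)

lemma lift_endo_endo:
  assumes \<phi>: "\<phi> \<in> endo_fields A" shows "lift_endo A \<phi> \<in> endo_fields (line_atlas A)"
proof (rule L.endoI)
  have tan: "lift_endo A \<phi> x w \<in> L.TS x" if "w \<in> L.TS x" for x w
    using slice_push_tangent[OF endo_tangent[OF \<phi> proj_push_tangent[OF that]], of "snd x"]
    by (simp add: lift_endo_apply)
  then show "\<And>x w. w \<in> L.TS x \<Longrightarrow> lift_endo A \<phi> x w \<in> L.TS x" .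
  fix X assume X: "X \<in> L.VF"
  show "(\<lambda>x. lift_endo A \<phi> x (X x)) \<in> L.VF"
  proof (rule L.fieldI)
    show "lift_endo A \<phi> x (X x) \<in> L.TS x" for x by (rule tan[OF L.field_tangent[OF X]])
    fix g assume g: "g \<in> L.C"
    show "(\<lambda>x. lift_endo A \<phi> x (X x) g) \<in> L.C"
    proof (rule L.smooth_fun_local_division)
      fix x :: "'m \<times> real"
      obtain U \<kappa> V K h where cut: "cutoff U \<kappa> V K h" and hp: "h (fst x) \<noteq> 0" using cutoff_exists by blast
      have h: "h \<in> C" using cut by (simp add: cutoff_def)
      obtain a where a: "\<And>b. a b \<in> L.C"
        and ex: "\<And>y. scl (h (fst y) ^ 3) (proj_push A (X y)) = (\<Sum>b\<in>Basis. scl (a b y) (cutoff_partial U \<kappa> h b (fst y)))"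
        by (rule push_frame_expansion[OF cut X]) blast
      note E = cutoff_partial_field[OF cut]
      define F where "F = (\<lambda>b. lift_field A (\<lambda>q. \<phi> q (cutoff_partial U \<kappa> h b q)))"
      have F: "F b \<in> L.VF" for b
        unfolding F_def by (rule lift_field_field[OF endo_field[OF \<phi> E]])
      have "h (fst y) ^ 3 * lift_endo A \<phi> y (X y) g = (\<Sum>b\<in>Basis. a b y * F b y g)" for y
      proof -
        have "scl (h (fst y) ^ 3) (lift_endo A \<phi> y (X y)) = slice_push A (snd y) (\<phi> (fst y) (scl (h (fst y) ^ 3) (proj_push A (X y))))"
          by (simp add: lift_endo_apply endo_scl[OF \<phi> proj_push_tangent[OF L.field_tangent[OF X]]] push_linear)
        also have "\<dots> = (\<Sum>b\<in>Basis. scl (a b y) (F b y))"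
          unfolding ex
          by (simp add: endo_Sum[OF \<phi>] endo_scl[OF \<phi>] field_tangent[OF E] slice_push_Sum push_linear F_def lift_field_apply)
        finally have "scl (h (fst y) ^ 3) (lift_endo A \<phi> y (X y)) g = (\<Sum>b\<in>Basis. scl (a b y) (F b y)) g"
          by (rule fun_cong)
        then show ?thesis by (simp add: scl_def sum_fun_apply)
      qed
      moreover have "(\<lambda>y. \<Sum>b\<in>Basis. a b y * F b y g) \<in> L.C"
        by (intro L.smooth_fun_sum L.smooth_fun_mult a L.field_smooth[OF F g])
      ultimately show "\<exists>h\<in>L.C. h x \<noteq> 0 \<and> (\<lambda>y. h y * lift_endo A \<phi> y (X y) g) \<in> L.C"
        using hp by (intro bexI[of _ "\<lambda>y. h (fst y) ^ 3"]) (simp_all add: pullback_fst[OF h])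
    qed
  qed
qed (simp_all add: lift_endo_apply push_linear endo_plus[OF \<phi>] endo_scl[OF \<phi>] proj_push_tangent)

lemma dt_form: "dt \<in> one_forms (line_atlas A)"
  by (rule L.formI) (simp_all add: dt_def d_fun_def scl_def L.field_smooth snd_smooth)

lemma d_dt_pullback: "f \<in> C \<Longrightarrow> d_dt A x (\<lambda>y. f (fst y)) = 0"
  by (simp add: d_dt_apply pullback_fst)

lemma lift_field_pullback: "f \<in> C \<Longrightarrow> lift_field A X x (\<lambda>y. f (fst y)) = X (fst x) f"
  by (simp add: lift_field_apply slice_push_apply pullback_fst)

lemma lift_field_snd: "X \<in> VF \<Longrightarrow> lift_field A X x snd = 0"
  by (simp add: lift_field_apply slice_push_snd[OF field_tangent])

lemma lie_d_dt_lift: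
  assumes X: "X \<in> VF" shows "lie_bracket (d_dt A) (lift_field A X) x = 0"
proof (rule line_tangent_eq_0)
  show "lie_bracket (d_dt A) (lift_field A X) x \<in> L.TS x"
    by (intro L.field_tangent L.lie_bracket_field d_dt_field lift_field_field X)
  show "lie_bracket (d_dt A) (lift_field A X) x (\<lambda>y. f (fst y)) = 0" if "f \<in> C" for f
    using that X
    by (simp add: lie_bracket_def d_dt_pullback lift_field_pullback d_dt_pullback[OF field_smooth[OF X that]]
        L.tangent_const[OF L.field_tangent[OF lift_field_field[OF X]]])
  show "lie_bracket (d_dt A) (lift_field A X) x snd = 0"
    using X
    by (simp add: lie_bracket_def d_dt_snd lift_field_snd
        L.tangent_const[OF L.field_tangent[OF lift_field_field[OF X]]] L.tangent_const[OF L.field_tangent[OF d_dt_field]])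
qed

text \<open>By pointwise dependence, \<open>Y\<close> may be replaced by a lift plus a constant multiple of \<open>d/dt\<close>.\<close>
lemma line_tensor_eq_0:
  fixes \<tau> :: "('m \<times> real \<Rightarrow> ('m \<times> real) tangent) \<Rightarrow> real"
  assumes add: "\<And>Y Z. Y \<in> L.VF \<Longrightarrow> Z \<in> L.VF \<Longrightarrow> \<tau> (\<lambda>q. Y q + Z q) = \<tau> Y + \<tau> Z"
    and scale: "\<And>a Y. a \<in> L.C \<Longrightarrow> Y \<in> L.VF \<Longrightarrow> \<tau> (\<lambda>q. scl (a q) (Y q)) = a x * \<tau> Y"
    and lift: "\<And>X. X \<in> VF \<Longrightarrow> \<tau> (lift_field A X) = 0" and d_dt: "\<tau> (d_dt A) = 0"
    and Y: "Y \<in> L.VF"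
  shows "\<tau> Y = 0"
proof -
  obtain X where X: "X \<in> VF" "X (fst x) = proj_push A (Y x)"
    using field_through[OF proj_push_tangent[OF L.field_tangent[OF Y]]] by metis
  let ?Z = "\<lambda>q. lift_field A X q + scl (Y x snd) (d_dt A q)"
  have c: "(\<lambda>q. Y x snd) \<in> L.C" by simp
  have s: "(\<lambda>q. scl (Y x snd) (d_dt A q)) \<in> L.VF"
    by (rule L.field_scl[OF c d_dt_field])
  have Z: "?Z \<in> L.VF"
    by (rule L.field_plus[OF lift_field_field[OF X(1)] s])
  have eq: "Y x = ?Z x"
    using line_tangent_split[of "Y x" "fst x" "snd x"] L.field_tangent[OF Y, of x] by (simp add: lift_field_apply X(2))
  have "\<tau> Y = \<tau> ?Z"
    by (rule L.tensor_pointwise[where \<tau> = \<tau> and p = x and Y = Y and Z = ?Z, OF _ _ Y Z eq]) (fact add, fact scale)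
  also have "\<dots> = 0"
    using scale[OF c d_dt_field] by (simp add: add[OF lift_field_field[OF X(1)] s] lift[OF X(1)] d_dt)
  finally show ?thesis .
qed

text \<open>\<open>L\<^bsub>d/dt\<^esub>\<close> kills lifted forms: the difference of the two sides is tensorial in \<open>Y\<close>, and vanishes on lifts
and on \<open>d/dt\<close>.\<close>
lemma d_dt_lift_form:
  assumes \<alpha>: "\<alpha> \<in> one_forms A" and Y: "Y \<in> L.VF"
  shows "d_dt A x (\<lambda>y. lift_form A \<alpha> y (Y y)) = lift_form A \<alpha> x (lie_bracket (d_dt A) Y x)"
proof -
  define \<tau> where "\<tau> = (\<lambda>Y. d_dt A x (\<lambda>y. lift_form A \<alpha> y (Y y)) - lift_form A \<alpha> x (lie_bracket (d_dt A) Y x))"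
  note l = lift_form_form[OF \<alpha>]
  have "\<tau> Y = 0"
  proof (rule line_tensor_eq_0[of \<tau> x, OF _ _ _ _ Y])
    show "\<tau> (\<lambda>q. Y q + Z q) = \<tau> Y + \<tau> Z" if "Y \<in> L.VF" "Z \<in> L.VF" for Y Z
      using that d_dt_field
      by (simp add: \<tau>_def L.form_plus[OF l] L.lie_bracket_plus_right L.tangent_add[OF L.field_tangent[OF d_dt_field]] L.form_smooth[OF l])
    show "\<tau> (\<lambda>q. scl (a q) (Y q)) = a x * \<tau> Y" if "a \<in> L.C" "Y \<in> L.VF" for a Y
      using that d_dt_field
      by (simp add: \<tau>_def L.form_plus[OF l] L.form_scl[OF l] L.lie_bracket_scl_right
          L.tangent_mult[OF L.field_tangent[OF d_dt_field]] L.form_smooth[OF l] algebra_simps)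
    show "\<tau> (lift_field A X) = 0" if X: "X \<in> VF" for X
    proof -
      have "(\<lambda>y. lift_form A \<alpha> y (lift_field A X y)) = (\<lambda>y. (\<lambda>p. \<alpha> p (X p)) (fst y))"
        by (simp add: lift_form_apply lift_field_apply proj_slice[OF field_tangent[OF X]])
      then have "d_dt A x (\<lambda>y. lift_form A \<alpha> y (lift_field A X y)) = 0"
        using d_dt_pullback[OF form_smooth[OF \<alpha> X]] by simp
      then show ?thesis by (simp add: \<tau>_def lie_d_dt_lift[OF X] L.form_zero[OF l])
    qed
    show "\<tau> (d_dt A) = 0"
    proof -
      have "lie_bracket (d_dt A) (d_dt A) x = 0" by (simp add: lie_bracket_def fun_eq_iff)
      moreover have "(\<lambda>y. lift_form A \<alpha> y (d_dt A y)) = (\<lambda>y. 0)"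
        by (simp add: lift_form_apply proj_d_dt form_zero[OF \<alpha>])
      ultimately show ?thesis
        by (simp add: \<tau>_def L.tangent_const[OF L.field_tangent[OF d_dt_field]] L.form_zero[OF l])
    qed
  qed
  then show ?thesis by (simp add: \<tau>_def)
qed

text \<open>Tested on a function lifted from \<open>M\<close>, with differential \<open>df\<close>, this is the invariance of the lift of the form
\<open>df \<circ> \<phi>\<close>.\<close>
lemma lie_d_dt_lift_endo:
  assumes \<phi>: "\<phi> \<in> endo_fields A" and Y: "Y \<in> L.VF"
  shows "lie_bracket (d_dt A) (\<lambda>y. lift_endo A \<phi> y (Y y)) x = lift_endo A \<phi> x (lie_bracket (d_dt A) Y x)"
proof (rule line_tangent_eqI)
  note e = lift_endo_endo[OF \<phi>]
  note b = L.lie_bracket_field[OF d_dt_field Y]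
  note \<phi>Y = L.endo_field[OF e Y]
  show "lie_bracket (d_dt A) (\<lambda>y. lift_endo A \<phi> y (Y y)) x \<in> L.TS x"
    by (rule L.field_tangent[OF L.lie_bracket_field[OF d_dt_field \<phi>Y]])
  show "lift_endo A \<phi> x (lie_bracket (d_dt A) Y x) \<in> L.TS x"
    by (rule L.endo_tangent[OF e L.field_tangent[OF b]])
  have snd: "lift_endo A \<phi> y w snd = 0" if "w \<in> L.TS y" for y w
    by (simp add: lift_endo_apply slice_push_snd[OF endo_tangent[OF \<phi> proj_push_tangent[OF that]]])
  show "lie_bracket (d_dt A) (\<lambda>y. lift_endo A \<phi> y (Y y)) x snd = lift_endo A \<phi> x (lie_bracket (d_dt A) Y x) snd"
    by (simp add: snd[OF L.field_tangent[OF b]] lie_bracket_def[of "d_dt A" "\<lambda>y. lift_endo A \<phi> y (Y y)"] snd[OF L.field_tangent[OF Y]] d_dt_snd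
        L.tangent_const[OF L.field_tangent[OF d_dt_field]] L.tangent_const[OF L.field_tangent[OF \<phi>Y]])
  fix f assume f: "f \<in> C"
  \<comment> \<open>the form \<open>df \<circ> \<phi>\<close> on \<open>M\<close>\<close>
  define \<alpha> where "\<alpha> = (\<lambda>p v. \<phi> p v f)"
  have \<alpha>: "\<alpha> \<in> one_forms A"
    unfolding \<alpha>_def
    by (rule formI) (simp_all add: endo_plus[OF \<phi>] endo_scl[OF \<phi>] field_smooth[OF endo_field[OF \<phi>] f], simp add: scl_def)
  have ev: "lift_endo A \<phi> y w (\<lambda>x. f (fst x)) = lift_form A \<alpha> y w" for y w
    by (simp add: lift_endo_apply slice_push_apply pullback_fst f lift_form_apply \<alpha>_def)
  show "lie_bracket (d_dt A) (\<lambda>y. lift_endo A \<phi> y (Y y)) x (\<lambda>x. f (fst x)) =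
      lift_endo A \<phi> x (lie_bracket (d_dt A) Y x) (\<lambda>x. f (fst x))"
    unfolding ev d_dt_lift_form[OF \<alpha> Y, symmetric]
    by (simp add: lie_bracket_def[of "d_dt A" "\<lambda>y. lift_endo A \<phi> y (Y y)"] ev d_dt_pullback[OF f] L.tangent_const[OF L.field_tangent[OF \<phi>Y]])
qed

section \<open>Normality of the lifted structure\<close>

lemma lift_bracket:
  assumes X: "X \<in> VF" and Y: "Y \<in> VF"
  shows "lie_bracket (lift_field A X) (lift_field A Y) = lift_field A (lie_bracket X Y)"
proof
  fix x
  show "lie_bracket (lift_field A X) (lift_field A Y) x = lift_field A (lie_bracket X Y) x"
  proof (rule line_tangent_eqI)
    show "lie_bracket (lift_field A X) (lift_field A Y) x \<in> L.TS x"
      by (intro L.field_tangent L.lie_bracket_field lift_field_field X Y)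
    show "lift_field A (lie_bracket X Y) x \<in> L.TS x"
      by (intro L.field_tangent lift_field_field lie_bracket_field X Y)
    note c = L.tangent_const[OF L.field_tangent[OF lift_field_field]]
    show "lie_bracket (lift_field A X) (lift_field A Y) x snd = lift_field A (lie_bracket X Y) x snd"
      using X Y by (simp add: lift_field_snd) (simp add: lie_bracket_def lift_field_snd c)
    fix f assume f: "f \<in> C"
    show "lie_bracket (lift_field A X) (lift_field A Y) x (\<lambda>x. f (fst x)) = lift_field A (lie_bracket X Y) x (\<lambda>x. f (fst x))"
      by (simp add: lift_field_pullback f)
        (simp add: lie_bracket_def lift_field_pullback f lift_field_pullback[OF field_smooth[OF X f]] lift_field_pullback[OF field_smooth[OF Y f]])
  qed
qed

lemma lift_endo_lift: "X \<in> VF \<Longrightarrow> (\<lambda>x. lift_endo A \<phi> x (lift_field A X x)) = lift_field A (\<lambda>p. \<phi> p (X p))"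
  by (rule ext) (simp add: lift_endo_apply lift_field_apply proj_slice[OF field_tangent])

lemma lift_form_lift: "X \<in> VF \<Longrightarrow> lift_form A \<alpha> x (lift_field A X x) = \<alpha> (fst x) (X (fst x))"
  by (simp add: lift_form_apply lift_field_apply proj_slice[OF field_tangent])

lemma lift_defect:
  assumes \<phi>: "\<phi> \<in> endo_fields A" and \<eta>: "\<eta> \<in> one_forms A" and X: "X \<in> VF" and Y: "Y \<in> VF"
  shows "L.defect (lift_endo A \<phi>) (lift_field A \<xi>) (lift_form A \<eta>) (lift_field A X) (lift_field A Y) =
    lift_field A (defect \<phi> \<xi> \<eta> X Y)"
proof
  fix x
  note e = endo_field[OF \<phi>]
  have endo_at: "lift_endo A \<phi> x (lift_field A W x) = lift_field A (\<lambda>p. \<phi> p (W p)) x" if "W \<in> VF" for W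
    using fun_cong[OF lift_endo_lift[OF that]] .
  have "d_form (lift_form A \<eta>) (lift_field A X) (lift_field A Y) x = d_form \<eta> X Y (fst x)"
    using X Y
    by (simp add: d_form_def lift_bracket lift_form_lift lift_field_pullback[OF form_smooth[OF \<eta> X]] lift_field_pullback[OF form_smooth[OF \<eta> Y]])
  moreover have "nijenhuis (lift_endo A \<phi>) (lift_field A X) (lift_field A Y) x = lift_field A (nijenhuis \<phi> X Y) x"
    using X Y e[OF X] e[OF Y]
    by (simp add: nijenhuis_def lift_bracket lift_endo_lift endo_at e) (simp add: lift_field_apply push_linear)
  ultimately show "L.defect (lift_endo A \<phi>) (lift_field A \<xi>) (lift_form A \<eta>) (lift_field A X) (lift_field A Y) x =
    lift_field A (defect \<phi> \<xi> \<eta> X Y) x"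
    by (simp add: L.defect_def defect_def lift_field_apply push_linear)
qed

lemma defect_tangent:
  assumes "\<phi> \<in> endo_fields A" "\<xi> \<in> VF" "X \<in> VF" "Y \<in> VF"
  shows "defect \<phi> \<xi> \<eta> X Y p \<in> TS p"
  unfolding defect_def nijenhuis_def
  by (intro tangent_minus tangent_plus tangent_scl endo_tangent[OF assms(1)] field_tangent lie_bracket_field
      endo_field[OF assms(1)] assms)

context
  fixes \<phi> \<xi> \<eta>
  assumes str: "almost_paracontact A \<phi> \<xi> \<eta>"
begin

lemma
  shows str_phi: "\<phi> \<in> endo_fields A" and str_xi: "\<xi> \<in> VF" and str_eta: "\<eta> \<in> one_forms A"
    and str_sq: "v \<in> TS p \<Longrightarrow> \<phi> p (\<phi> p v) = v - scl (\<eta> p v) (\<xi> p)"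
    and str_eta_xi: "\<eta> p (\<xi> p) = 1" and str_phi_xi: "\<phi> p (\<xi> p) = 0"
    and str_eta_phi: "v \<in> TS p \<Longrightarrow> \<eta> p (\<phi> p v) = 0"
  using str by (simp_all add: almost_paracontact_def scl_def)

lemma lifted_adapted_structure:
  "adapted_structure (line_atlas A) (lift_endo A \<phi>) (lift_field A \<xi>) (lift_form A \<eta>) (d_dt A) dt"
proof unfold_locales
  note proj = proj_push_tangent
  note p\<phi> = endo_tangent[OF str_phi proj]
  show "lift_endo A \<phi> \<in> endo_fields (line_atlas A)" by (rule lift_endo_endo[OF str_phi])
  show "lift_field A \<xi> \<in> L.VF" by (rule lift_field_field[OF str_xi])
  show "d_dt A \<in> L.VF" by (rule d_dt_field)
  show "lift_form A \<eta> \<in> one_forms (line_atlas A)" by (rule lift_form_form[OF str_eta])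
  show "dt \<in> one_forms (line_atlas A)" by (rule dt_form)
  show "lift_endo A \<phi> x (lift_endo A \<phi> x v) = v - scl (lift_form A \<eta> x v) (lift_field A \<xi> x) - scl (dt x v) (d_dt A x)"
    if v: "v \<in> L.TS x" for x v
  proof -
    have "lift_endo A \<phi> x (lift_endo A \<phi> x v) = slice_push A (snd x) (proj_push A v) - scl (lift_form A \<eta> x v) (lift_field A \<xi> x)"
      by (simp add: lift_endo_apply lift_form_apply lift_field_apply proj_slice[OF p\<phi>[OF v]] str_sq[OF proj[OF v]] push_linear)
    moreover have "v = slice_push A (snd x) (proj_push A v) + scl (dt x v) (d_dt A x)"
      using line_tangent_split[of v "fst x" "snd x"] v by (simp add: dt_def d_fun_def)
    ultimately show ?thesis by (simp add: fun_eq_iff)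
  qed
  have proj_\<xi>: "proj_push A (lift_field A \<xi> x) = \<xi> (fst x)" for x
    by (simp add: lift_field_apply proj_slice[OF field_tangent[OF str_xi]])
  show "lift_endo A \<phi> x (lift_field A \<xi> x) = 0" for x
    by (simp add: lift_endo_apply proj_\<xi> str_phi_xi push_linear)
  show "lift_endo A \<phi> x (d_dt A x) = 0" for x
    by (simp add: lift_endo_apply proj_d_dt endo_zero[OF str_phi] push_linear)
  show "lift_form A \<eta> x (lift_field A \<xi> x) = 1" for x
    by (simp add: lift_form_apply proj_\<xi> str_eta_xi)
  show "lift_form A \<eta> x (d_dt A x) = 0" for x
    by (simp add: lift_form_apply proj_d_dt form_zero[OF str_eta])
  show "dt x (lift_field A \<xi> x) = 0" for x
    by (simp add: dt_def d_fun_def lift_field_snd[OF str_xi])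
  show "dt x (d_dt A x) = 1" for x
    by (simp add: dt_def d_fun_def d_dt_snd)
  show "lift_form A \<eta> x (lift_endo A \<phi> x v) = 0" if "v \<in> L.TS x" for x v
    by (simp add: lift_form_apply lift_endo_apply proj_slice[OF p\<phi>[OF that]] str_eta_phi[OF proj[OF that]])
  show "dt x (lift_endo A \<phi> x v) = 0" if "v \<in> L.TS x" for x v
    by (simp add: dt_def d_fun_def lift_endo_apply slice_push_snd[OF p\<phi>[OF that]])
  show "lie_bracket (d_dt A) (\<lambda>q. lift_endo A \<phi> q (X q)) x = lift_endo A \<phi> x (lie_bracket (d_dt A) X x)"
    if "X \<in> L.VF" for X x
    by (rule lie_d_dt_lift_endo[OF str_phi that])
  show "lie_bracket (d_dt A) (lift_field A \<xi>) x = 0" for x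
    by (rule lie_d_dt_lift[OF str_xi])
  show "d_dt A x (\<lambda>q. lift_form A \<eta> q (X q)) = lift_form A \<eta> x (lie_bracket (d_dt A) X x)"
    if "X \<in> L.VF" for X x
    by (rule d_dt_lift_form[OF str_eta that])
  show "dt x (lie_bracket X Y x) = X x (\<lambda>q. dt q (Y q)) - Y x (\<lambda>q. dt q (X q))" for X Y x
    by (simp add: dt_def d_fun_def lie_bracket_def)
qed

interpretation N: adapted_structure "line_atlas A" "lift_endo A \<phi>" "lift_field A \<xi>" "lift_form A \<eta>" "d_dt A" dt
  by (rule lifted_adapted_structure)

lemma N_P: "N.P = adapted_product A (induced_endo \<phi>) \<xi> \<eta>"
  by (rule ext) (simp add: adapted_product_induced_endo N.P_def block_matrix_def adapted_beta_def adapted_B_def dual_map_def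
      scl_def fun_eq_iff split_beta)

lemma defect_d_dt:
  assumes Y: "Y \<in> L.VF"
  shows "L.defect (lift_endo A \<phi>) (lift_field A \<xi>) (lift_form A \<eta>) (d_dt A) Y x = 0"
proof -
  have "d_form (lift_form A \<eta>) (d_dt A) Y x = 0"
    by (simp add: d_form_def N.T_eta[OF Y] N.eta_T L.tangent_const[OF L.field_tangent[OF Y]])
  moreover have zero: "lie_bracket (\<lambda>q. 0) Z = (\<lambda>q. 0)" if "Z \<in> L.VF" for Z :: "'m \<times> real \<Rightarrow> _"
    using that by (simp add: lie_bracket_def fun_eq_iff L.tangent_const[OF L.field_tangent])
  have "nijenhuis (lift_endo A \<phi>) (d_dt A) Y x = 0"
    by (simp add: nijenhuis_def N.phi_T zero Y L.endo_field[OF N.phi_endo] N.T_phi L.endo_zero[OF N.phi_endo])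
  ultimately show ?thesis by (simp add: L.defect_def)
qed

text \<open>From \<open>M \<times> \<real>\<close> to \<open>M\<close> by evaluating on lifts. From \<open>M\<close> to \<open>M \<times> \<real>\<close>, tensoriality reduces first one
argument to a lift and then, by skew symmetry, the other.\<close>
lemma normal_lift_iff:
  "normal_paracontact (line_atlas A) (lift_endo A \<phi>) (lift_field A \<xi>) (lift_form A \<eta>) \<longleftrightarrow>
   normal_paracontact A \<phi> \<xi> \<eta>"
proof
  assume N: "normal_paracontact (line_atlas A) (lift_endo A \<phi>) (lift_field A \<xi>) (lift_form A \<eta>)"
  show "normal_paracontact A \<phi> \<xi> \<eta>"
    unfolding normal_paracontact_defect
  proof (intro ballI allI)
    fix X Y p assume X: "X \<in> VF" and Y: "Y \<in> VF"
    have "lift_field A (defect \<phi> \<xi> \<eta> X Y) (p, 0) = 0"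
      using N lift_field_field[OF X] lift_field_field[OF Y]
      unfolding L.normal_paracontact_defect lift_defect[OF str_phi str_eta X Y, symmetric] by blast
    then have "proj_push A (slice_push A 0 (defect \<phi> \<xi> \<eta> X Y p)) = proj_push A 0"
      by (simp add: lift_field_apply)
    then show "defect \<phi> \<xi> \<eta> X Y p = 0"
      unfolding proj_slice[OF defect_tangent[OF str_phi str_xi X Y]]
      by (simp add: proj_push_def differential_def fun_eq_iff)
  qed
next
  assume "normal_paracontact A \<phi> \<xi> \<eta>"
  then have normal: "defect \<phi> \<xi> \<eta> X Y p = 0" if "X \<in> VF" "Y \<in> VF" for X Y p
    using that by (simp add: normal_paracontact_defect)
  let ?D = "L.defect (lift_endo A \<phi>) (lift_field A \<xi>) (lift_form A \<eta>)"
  note tensor = L.defect_add[OF N.phi_endo N.eta_form] L.defect_scl[OF N.phi_endo N.eta_form]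
  have first: "?D X Z x g = 0" if Z: "Z \<in> L.VF" and lift: "\<And>X. X \<in> VF \<Longrightarrow> ?D (lift_field A X) Z x g = 0" and X: "X \<in> L.VF"
    for X Z x g
    by (rule line_tensor_eq_0[where \<tau> = "\<lambda>X. ?D X Z x g" and x = x, OF _ _ _ _ X])
      (simp_all add: tensor Z lift defect_d_dt, simp add: scl_def)
  show "normal_paracontact (line_atlas A) (lift_endo A \<phi>) (lift_field A \<xi>) (lift_form A \<eta>)"
    unfolding L.normal_paracontact_defect
  proof (intro ballI allI ext)
    fix X Y x g assume X: "X \<in> L.VF" and Y: "Y \<in> L.VF"
    have "?D X Y x g = 0"
    proof (rule first[OF Y _ X])
      fix X0 assume X0: "X0 \<in> VF"
      have "?D Y (lift_field A X0) x g = 0"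
      proof (rule first[OF lift_field_field[OF X0] _ Y])
        fix Y0 assume Y0: "Y0 \<in> VF"
        show "?D (lift_field A Y0) (lift_field A X0) x g = 0"
          unfolding lift_defect[OF str_phi str_eta Y0 X0] by (simp add: lift_field_apply normal Y0 X0 push_linear)
      qed
      then show "?D (lift_field A X0) Y x g = 0"
        using L.defect_swap[OF N.phi_endo N.eta_form Y lift_field_field[OF X0]] by simp
    qed
    then show "?D X Y x g = 0 g" by simp
  qed
qed

lemma normal_generalized_iff:
  "normal_generalized_paracontact A (induced_endo \<phi>) \<xi> \<eta> \<longleftrightarrow> normal_paracontact A \<phi> \<xi> \<eta>"
  unfolding normal_generalized_paracontact_def N_P[symmetric] N.courant_integrable_iff by (rule normal_lift_iff)

end

end

theorem proposition3p5:
  fixes A :: "('m::{t2_space, second_countable_topology}, 'e::euclidean_space) chart set"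
    and \<phi> :: "'m \<Rightarrow> 'm tangent \<Rightarrow> 'm tangent"
    and \<xi> :: "'m \<Rightarrow> 'm tangent"
    and \<eta> :: "'m \<Rightarrow> 'm cotangent"
  assumes "smooth_atlas A"
    and "odd DIM('e)"
    and "almost_paracontact A \<phi> \<xi> \<eta>"
  shows "normal_generalized_paracontact A (induced_endo \<phi>) \<xi> \<eta> \<longleftrightarrow> normal_paracontact A \<phi> \<xi> \<eta>"
proof -
  interpret smooth_manifold A using assms(1) by unfold_locales
  show ?thesis by (rule normal_generalized_iff[OF assms(3)])
qed

end
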